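(* Let $(G,\omega^+)$ be a connected symplectic Lie group. Denote by $r$ the associated solution of the Classical Yang–Baxter Equation and by $r^+$ (resp. $r^-$) the corresponding left (resp. right) invariant Poisson tensor. Then the Poisson Lie tensor $\pi=r^+-r^-$ is polynomial, of degree smaller than or equal to $2$, relative to the left invariant affine structure on $G$ defined by $\omega^+$. That is, in a neighborhood of every point of $G$ there exist local affine coordinates $(x_1,\dots,x_{2n})$ satisfying, for all $i,j$, $$\{x_i,x_j\}_\pi=\sum_s b_s x_s+\sum_{l,k}b_{lk}x_lx_k,$$ where the $b_s,b_{lk}$ (depending on $i,j$) are in $\mathbb R$.
   Context: Lie groups and Lie algebras are real and finite-dimensional; $\dim G=2n$. A symplectic Lie group $(G,\omega^+)$ is a Lie group with a left invariant symplectic form $\omega^+$; let $\mathfrak g$ be its Lie algebra and $\omega=\omega^+_\epsilon$ the value at the unit $\epsilon$. Let $q:\mathfrak g\to\mathfrak g^*$, $q(x)=\omega(x,\cdot)$, and $r=q^{-1}:\mathfrak g^*\to\mathfrak g$, regarded as an element of $\wedge^2\mathfrak g$ via $r(\alpha,\beta)=\langle r(\alpha),\beta\rangle$; it is the solution of the Classical Yang–Baxter Equation associated to $\omega^+$. The tensors $r^+,r^-$ are the left, resp. right, invariant bivector fields on $G$ with value $r$ at $\epsilon$, and $\{f,g\}_\pi=\pi(df,dg)$. The left invariant affine structure defined by $\omega^+$ is the left invariant, flat, torsion free connection $\nabla$ with $\omega^+(\nabla_{x^+}y^+,z^+)=-\omega^+(y^+,[x^+,z^+])$ for $x,y,z\in\mathfrak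 g$, where $x^+$ is the left invariant vector field with value $x$ at $\epsilon$. Local affine coordinates are local coordinates in which $\nabla$ is the standard flat connection (charts of the corresponding affine atlas). *)

theory Defs
  imports "HOL-Analysis.Analysis" "HOL-Algebra.Group"
begin

section \<open>Smooth maps between open subsets of Euclidean spaces\<close>

text \<open>All of this is meant for open \<open>S\<close>; the class of functions is \<open>C\<^sup>k\<close> by the
  iterated existence of directional derivatives that are themselves \<open>C\<^sup>k\<^sup>-\<^sup>1\<close>.\<close>

primrec Ck_on :: "nat \<Rightarrow> 'a::euclidean_space set \<Rightarrow> ('a \<Rightarrow> 'b::real_normed_vector) \<Rightarrow> bool" where
  "Ck_on 0 S = (\<lambda>f. continuous_on S f)"
| "Ck_on (Suc k) S = (\<lambda>f. (\<forall>x\<in>S. f differentiable (at x)) \<and>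
      (\<forall>v. Ck_on k S (\<lambda>x. frechet_derivative f (at x) v)))"

definition smooth_on :: "'a::euclidean_space set \<Rightarrow> ('a \<Rightarrow> 'b::real_normed_vector) \<Rightarrow> bool" where
  "smooth_on S f \<longleftrightarrow> (\<forall>k. Ck_on k S f)"


section \<open>Smooth manifolds\<close>

type_synonym ('g, 'e) chart = "'g set \<times> ('g \<Rightarrow> 'e)"

definition is_chart :: "('g::topological_space, 'e::euclidean_space) chart \<Rightarrow> bool" where
  "is_chart c \<longleftrightarrow> open (fst c) \<and> open (snd c ` fst c) \<and>
     homeomorphism (fst c) (snd c ` fst c) (snd c) (inv_into (fst c) (snd c))"

definition smooth_transition :: "('g, 'e::euclidean_space) chart \<Rightarrow> ('g, 'e) chart \<Rightarrow> bool" where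
  "smooth_transition c d \<longleftrightarrow>
     smooth_on (snd c ` (fst c \<inter> fst d)) (snd d \<circ> inv_into (fst c) (snd c))"

definition smooth_atlas :: "'g::topological_space set \<Rightarrow> ('g, 'e::euclidean_space) chart set \<Rightarrow> bool" where
  "smooth_atlas M A \<longleftrightarrow> (\<forall>c\<in>A. is_chart c) \<and> (\<Union>c\<in>A. fst c) = M \<and>
     (\<forall>c\<in>A. \<forall>d\<in>A. smooth_transition c d)"

definition maximal_atlas :: "('g::topological_space, 'e::euclidean_space) chart set \<Rightarrow> ('g, 'e) chart set" where
  "maximal_atlas A = {c. is_chart c \<and> fst c \<subseteq> (\<Union>d\<in>A. fst d) \<and>
     (\<forall>d\<in>A. smooth_transition c d \<and> smooth_transition d c)}"

definition prod_atlas ::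
  "('g, 'e) chart set \<Rightarrow> ('h, 'f) chart set \<Rightarrow> ('g \<times> 'h, 'e \<times> 'f) chart set" where
  "prod_atlas A B = {(fst c \<times> fst d, map_prod (snd c) (snd d)) | c d. c \<in> A \<and> d \<in> B}"

definition smooth_map :: "('g::topological_space, 'e::euclidean_space) chart set \<Rightarrow>
    ('h::topological_space, 'f::euclidean_space) chart set \<Rightarrow> ('g \<Rightarrow> 'h) \<Rightarrow> bool" where
  "smooth_map A B F \<longleftrightarrow>
     continuous_on (\<Union>c\<in>A. fst c) F \<and> F ` (\<Union>c\<in>A. fst c) \<subseteq> (\<Union>d\<in>B. fst d) \<and>
     (\<forall>c\<in>A. \<forall>d\<in>B. smooth_on (snd c ` (fst c \<inter> F -` fst d))
        (snd d \<circ> F \<circ> inv_into (fst c) (snd c)))"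

definition smooth_fun_on :: "('g, 'e::euclidean_space) chart set \<Rightarrow> 'g set \<Rightarrow> ('g \<Rightarrow> real) \<Rightarrow> bool" where
  "smooth_fun_on A S f \<longleftrightarrow>
     (\<forall>c\<in>A. smooth_on (snd c ` (fst c \<inter> S)) (f \<circ> inv_into (fst c) (snd c)))"

definition smooth_near :: "('g::topological_space, 'e::euclidean_space) chart set \<Rightarrow> 'g \<Rightarrow> ('g \<Rightarrow> real) \<Rightarrow> bool" where
  "smooth_near A p f \<longleftrightarrow> (\<exists>S. open S \<and> p \<in> S \<and> smooth_fun_on A S f)"


section \<open>Tangent vectors and tensor fields\<close>

text \<open>A tangent vector at \<open>p\<close> is a derivation of the algebra of functions that are smooth near
  \<open>p\<close>. Since functions are total, it is given the value \<open>0\<close> on all other functions, so that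
  equality of tangent vectors is equality in HOL. Dependence on the germ only follows from the
  Leibniz rule.\<close>

type_synonym 'g tvec = "('g \<Rightarrow> real) \<Rightarrow> real"
type_synonym 'g vfield = "'g \<Rightarrow> 'g tvec"

definition tangent_space :: "('g::topological_space, 'e::euclidean_space) chart set \<Rightarrow> 'g \<Rightarrow> 'g tvec set" where
  "tangent_space A p = {v.
     (\<forall>f g. smooth_near A p f \<longrightarrow> smooth_near A p g \<longrightarrow>
        v (\<lambda>q. f q + g q) = v f + v g \<and>
        v (\<lambda>q. f q * g q) = f p * v g + g p * v f) \<and>
     (\<forall>c f. smooth_near A p f \<longrightarrow> v (\<lambda>q. c * f q) = c * v f) \<and>
     (\<forall>f. \<not> smooth_near A p f \<longrightarrow> v f = 0)}"

text \<open>The tangent map of a local diffeomorphism \<open>F\<close>.\<close>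

definition push :: "('g \<Rightarrow> 'g) \<Rightarrow> 'g tvec \<Rightarrow> 'g tvec" where
  "push F v = (\<lambda>f. v (f \<circ> F))"

definition linear_on_space :: "'g tvec set \<Rightarrow> ('g tvec \<Rightarrow> real) \<Rightarrow> bool" where
  "linear_on_space V \<alpha> \<longleftrightarrow>
     (\<forall>v\<in>V. \<forall>w\<in>V. \<alpha> (\<lambda>f. v f + w f) = \<alpha> v + \<alpha> w) \<and>
     (\<forall>c. \<forall>v\<in>V. \<alpha> (\<lambda>f. c * v f) = c * \<alpha> v)"

text \<open>Cotangent vectors are extensional outside the tangent space.\<close>

definition differential_at :: "('g::topological_space, 'e::euclidean_space) chart set \<Rightarrow>
    'g \<Rightarrow> ('g \<Rightarrow> real) \<Rightarrow> 'g tvec \<Rightarrow> real" where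
  "differential_at A p f = (\<lambda>v\<in>tangent_space A p. v f)"

definition vector_field :: "('g::topological_space, 'e::euclidean_space) chart set \<Rightarrow> 'g vfield \<Rightarrow> bool" where
  "vector_field A X \<longleftrightarrow> (\<forall>p\<in>(\<Union>c\<in>A. fst c). X p \<in> tangent_space A p) \<and>
     (\<forall>S f. open S \<and> S \<subseteq> (\<Union>c\<in>A. fst c) \<and> smooth_fun_on A S f \<longrightarrow>
        smooth_fun_on A S (\<lambda>p. X p f))"

definition lie_bracket :: "('g::topological_space, 'e::euclidean_space) chart set \<Rightarrow>
    'g vfield \<Rightarrow> 'g vfield \<Rightarrow> 'g vfield" where
  "lie_bracket A X Y = (\<lambda>p f. if smooth_near A p f
     then X p (\<lambda>q. Y q f) - Y p (\<lambda>q. X q f) else 0)"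

type_synonym 'g form2 = "'g \<Rightarrow> 'g tvec \<Rightarrow> 'g tvec \<Rightarrow> real"

definition two_form :: "('g::topological_space, 'e::euclidean_space) chart set \<Rightarrow> 'g form2 \<Rightarrow> bool" where
  "two_form A \<Omega> \<longleftrightarrow>
     (\<forall>p\<in>(\<Union>c\<in>A. fst c). \<forall>v\<in>tangent_space A p.
        linear_on_space (tangent_space A p) (\<Omega> p v) \<and>
        (\<forall>w\<in>tangent_space A p. \<Omega> p v w = - \<Omega> p w v)) \<and>
     (\<forall>X Y. vector_field A X \<and> vector_field A Y \<longrightarrow>
        smooth_fun_on A (\<Union>c\<in>A. fst c) (\<lambda>p. \<Omega> p (X p) (Y p)))"

definition exterior_derivative2 :: "('g::topological_space, 'e::euclidean_space) chart set \<Rightarrow> 'g form2 \<Rightarrow>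
    'g vfield \<Rightarrow> 'g vfield \<Rightarrow> 'g vfield \<Rightarrow> 'g \<Rightarrow> real" where
  "exterior_derivative2 A \<Omega> X Y Z p =
     X p (\<lambda>q. \<Omega> q (Y q) (Z q)) - Y p (\<lambda>q. \<Omega> q (X q) (Z q)) + Z p (\<lambda>q. \<Omega> q (X q) (Y q))
     - \<Omega> p (lie_bracket A X Y p) (Z p) + \<Omega> p (lie_bracket A X Z p) (Y p)
     - \<Omega> p (lie_bracket A Y Z p) (X p)"

definition symplectic_form :: "('g::topological_space, 'e::euclidean_space) chart set \<Rightarrow> 'g form2 \<Rightarrow> bool" where
  "symplectic_form A \<Omega> \<longleftrightarrow> two_form A \<Omega> \<and>
     (\<forall>p\<in>(\<Union>c\<in>A. fst c). \<forall>v\<in>tangent_space A p.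
        (\<forall>w\<in>tangent_space A p. \<Omega> p v w = 0) \<longrightarrow> v = (\<lambda>f. 0)) \<and>
     (\<forall>X Y Z. vector_field A X \<and> vector_field A Y \<and> vector_field A Z \<longrightarrow>
        (\<forall>p\<in>(\<Union>c\<in>A. fst c). exterior_derivative2 A \<Omega> X Y Z p = 0))"


section \<open>Affine connections\<close>

text \<open>Vector fields are only meaningful on the manifold; identities between them are therefore
  required at its points only.\<close>

type_synonym 'g connection = "'g vfield \<Rightarrow> 'g vfield \<Rightarrow> 'g vfield"

definition affine_connection :: "('g::topological_space, 'e::euclidean_space) chart set \<Rightarrow> 'g connection \<Rightarrow> bool" where
  "affine_connection A D \<longleftrightarrow>
     (\<forall>X Y. vector_field A X \<and> vector_field A Y \<longrightarrow> vector_field A (D X Y)) \<and>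
     (\<forall>X Y Z. vector_field A X \<and> vector_field A Y \<and> vector_field A Z \<longrightarrow>
        (\<forall>p\<in>(\<Union>c\<in>A. fst c).
           D (\<lambda>q f. X q f + Y q f) Z p = (\<lambda>f. D X Z p f + D Y Z p f) \<and>
           D X (\<lambda>q f. Y q f + Z q f) p = (\<lambda>f. D X Y p f + D X Z p f))) \<and>
     (\<forall>h X Y. smooth_fun_on A (\<Union>c\<in>A. fst c) h \<and> vector_field A X \<and> vector_field A Y \<longrightarrow>
        (\<forall>p\<in>(\<Union>c\<in>A. fst c).
           D (\<lambda>q f. h q * X q f) Y p = (\<lambda>f. h p * D X Y p f) \<and>
           D X (\<lambda>q f. h q * Y q f) p = (\<lambda>f. h p * D X Y p f + X p h * Y p f)))"

definition torsion_free :: "('g::topological_space, 'e::euclidean_space) chart set \<Rightarrow> 'g connection \<Rightarrow> bool" where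
  "torsion_free A D \<longleftrightarrow> (\<forall>X Y. vector_field A X \<and> vector_field A Y \<longrightarrow>
     (\<forall>p\<in>(\<Union>c\<in>A. fst c). (\<lambda>f. D X Y p f - D Y X p f) = lie_bracket A X Y p))"

definition flat :: "('g::topological_space, 'e::euclidean_space) chart set \<Rightarrow> 'g connection \<Rightarrow> bool" where
  "flat A D \<longleftrightarrow> (\<forall>X Y Z. vector_field A X \<and> vector_field A Y \<and> vector_field A Z \<longrightarrow>
     (\<forall>p\<in>(\<Union>c\<in>A. fst c).
        (\<lambda>f. D X (D Y Z) p f - D Y (D X Z) p f) = D (lie_bracket A X Y) Z p))"

text \<open>A chart of the manifold in which \<open>D\<close> is the standard flat connection
  \<open>D X Y = (\<Sum>i. X(Y i) \<partial>/\<partial>x i)\<close>, where \<open>Y i = Y(x i)\<close> is the \<open>i\<close>-th component of \<open>Y\<close>.\<close>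

definition affine_chart :: "('g::topological_space, real ^ 'n) chart set \<Rightarrow> 'g connection \<Rightarrow>
    ('g, real ^ 'n) chart \<Rightarrow> bool" where
  "affine_chart A D c \<longleftrightarrow> c \<in> maximal_atlas A \<and>
     (\<forall>X Y. vector_field A X \<and> vector_field A Y \<longrightarrow>
        (\<forall>p\<in>fst c. \<forall>i. D X Y p (\<lambda>q. snd c q $ i) = X p (\<lambda>q. Y q (\<lambda>q'. snd c q' $ i))))"


section \<open>Lie groups\<close>

record ('g, 'n) lie_struct = "'g monoid" +
  atlas :: "('g, real ^ 'n) chart set"

text \<open>The underlying manifold is \<open>carrier G\<close>, an open subset of the (Hausdorff, second countable)
  topological space \<open>'g\<close>; the model space is \<open>real ^ 'n\<close>, of dimension \<open>CARD('n)\<close>.\<close>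

definition lie_group :: "('g::{t2_space, second_countable_topology}, 'n::finite) lie_struct \<Rightarrow> bool" where
  "lie_group G \<longleftrightarrow> group G \<and> smooth_atlas (carrier G) (atlas G) \<and>
     smooth_map (prod_atlas (atlas G) (atlas G)) (atlas G) (\<lambda>(a, b). a \<otimes>\<^bsub>G\<^esub> b) \<and>
     smooth_map (atlas G) (atlas G) (\<lambda>a. inv\<^bsub>G\<^esub> a)"

abbreviation tangent_at :: "('g::topological_space, 'n::finite) lie_struct \<Rightarrow> 'g \<Rightarrow> 'g tvec set" where
  "tangent_at G \<equiv> tangent_space (atlas G)"

definition lie_algebra :: "('g::topological_space, 'n::finite) lie_struct \<Rightarrow> 'g tvec set" where
  "lie_algebra G = tangent_at G \<one>\<^bsub>G\<^esub>"

definition ltrans :: "('g, 'n) lie_struct \<Rightarrow> 'g \<Rightarrow> 'g \<Rightarrow> 'g" where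
  "ltrans G a = (\<lambda>p. a \<otimes>\<^bsub>G\<^esub> p)"

definition rtrans :: "('g, 'n) lie_struct \<Rightarrow> 'g \<Rightarrow> 'g \<Rightarrow> 'g" where
  "rtrans G a = (\<lambda>p. p \<otimes>\<^bsub>G\<^esub> a)"

definition left_inv_field :: "('g, 'n) lie_struct \<Rightarrow> 'g tvec \<Rightarrow> 'g vfield" where
  "left_inv_field G x = (\<lambda>p. push (ltrans G p) x)"

definition push_field :: "('g, 'n) lie_struct \<Rightarrow> 'g \<Rightarrow> 'g vfield \<Rightarrow> 'g vfield" where
  "push_field G a X = (\<lambda>p. push (ltrans G a) (X (inv\<^bsub>G\<^esub> a \<otimes>\<^bsub>G\<^esub> p)))"

definition left_invariant_form :: "('g::topological_space, 'n::finite) lie_struct \<Rightarrow> 'g form2 \<Rightarrow> bool" where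
  "left_invariant_form G \<Omega> \<longleftrightarrow>
     (\<forall>a\<in>carrier G. \<forall>p\<in>carrier G. \<forall>v\<in>tangent_at G p. \<forall>w\<in>tangent_at G p.
        \<Omega> (a \<otimes>\<^bsub>G\<^esub> p) (push (ltrans G a) v) (push (ltrans G a) w) = \<Omega> p v w)"

definition left_invariant_connection :: "('g::topological_space, 'n::finite) lie_struct \<Rightarrow> 'g connection \<Rightarrow> bool" where
  "left_invariant_connection G D \<longleftrightarrow>
     (\<forall>a\<in>carrier G. \<forall>X Y. vector_field (atlas G) X \<and> vector_field (atlas G) Y \<longrightarrow>
        (\<forall>p\<in>carrier G. push_field G a (D X Y) p = D (push_field G a X) (push_field G a Y) p))"

definition symplectic_lie_group ::
  "('g::{t2_space, second_countable_topology}, 'n::finite) lie_struct \<Rightarrow> 'g form2 \<Rightarrow> bool" where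
  "symplectic_lie_group G \<Omega> \<longleftrightarrow>
     lie_group G \<and> symplectic_form (atlas G) \<Omega> \<and> left_invariant_form G \<Omega>"

text \<open>\<open>D\<close> is the left invariant affine structure defined by \<open>\<Omega>\<close>; the last condition determines
  it uniquely.\<close>

definition symplectic_affine_structure ::
  "('g::topological_space, 'n::finite) lie_struct \<Rightarrow> 'g form2 \<Rightarrow> 'g connection \<Rightarrow> bool" where
  "symplectic_affine_structure G \<Omega> D \<longleftrightarrow>
     affine_connection (atlas G) D \<and> left_invariant_connection G D \<and>
     flat (atlas G) D \<and> torsion_free (atlas G) D \<and>
     (\<forall>x\<in>lie_algebra G. \<forall>y\<in>lie_algebra G. \<forall>z\<in>lie_algebra G. \<forall>p\<in>carrier G.
        \<Omega> p (D (left_inv_field G x) (left_inv_field G y) p) (left_inv_field G z p) =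
        - \<Omega> p (left_inv_field G y p)
             (lie_bracket (atlas G) (left_inv_field G x) (left_inv_field G z) p))"


section \<open>The Poisson tensor\<close>

definition q_map :: "('g::topological_space, 'n::finite) lie_struct \<Rightarrow> 'g form2 \<Rightarrow>
    'g tvec \<Rightarrow> ('g tvec \<Rightarrow> real)" where
  "q_map G \<Omega> x = (\<lambda>y\<in>lie_algebra G. \<Omega> \<one>\<^bsub>G\<^esub> x y)"

definition r_map :: "('g::topological_space, 'n::finite) lie_struct \<Rightarrow> 'g form2 \<Rightarrow>
    ('g tvec \<Rightarrow> real) \<Rightarrow> 'g tvec" where
  "r_map G \<Omega> = the_inv_into (lie_algebra G) (q_map G \<Omega>)"

definition r_tensor :: "('g::topological_space, 'n::finite) lie_struct \<Rightarrow> 'g form2 \<Rightarrow>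
    ('g tvec \<Rightarrow> real) \<Rightarrow> ('g tvec \<Rightarrow> real) \<Rightarrow> real" where
  "r_tensor G \<Omega> \<alpha> \<beta> = \<beta> (r_map G \<Omega> \<alpha>)"

text \<open>Bivectors at \<open>p\<close> are evaluated on covectors at \<open>p\<close>; the value at \<open>p\<close> of an invariant
  bivector field is the image of its value at the unit, i.e. it is evaluated by pulling
  covectors back to the unit.\<close>

type_synonym 'g bivfield = "'g \<Rightarrow> ('g tvec \<Rightarrow> real) \<Rightarrow> ('g tvec \<Rightarrow> real) \<Rightarrow> real"

definition pull_to_unit :: "('g::topological_space, 'n::finite) lie_struct \<Rightarrow> ('g \<Rightarrow> 'g) \<Rightarrow>
    ('g tvec \<Rightarrow> real) \<Rightarrow> ('g tvec \<Rightarrow> real)" where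
  "pull_to_unit G F \<alpha> = (\<lambda>x\<in>lie_algebra G. \<alpha> (push F x))"

definition r_plus :: "('g::topological_space, 'n::finite) lie_struct \<Rightarrow> 'g form2 \<Rightarrow> 'g bivfield" where
  "r_plus G \<Omega> p \<alpha> \<beta> =
     r_tensor G \<Omega> (pull_to_unit G (ltrans G p) \<alpha>) (pull_to_unit G (ltrans G p) \<beta>)"

definition r_minus :: "('g::topological_space, 'n::finite) lie_struct \<Rightarrow> 'g form2 \<Rightarrow> 'g bivfield" where
  "r_minus G \<Omega> p \<alpha> \<beta> =
     r_tensor G \<Omega> (pull_to_unit G (rtrans G p) \<alpha>) (pull_to_unit G (rtrans G p) \<beta>)"

definition poisson_lie_tensor :: "('g::topological_space, 'n::finite) lie_struct \<Rightarrow> 'g form2 \<Rightarrow> 'g bivfield" where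
  "poisson_lie_tensor G \<Omega> p \<alpha> \<beta> = r_plus G \<Omega> p \<alpha> \<beta> - r_minus G \<Omega> p \<alpha> \<beta>"

definition poisson_bracket :: "('g::topological_space, 'n::finite) lie_struct \<Rightarrow> 'g bivfield \<Rightarrow>
    ('g \<Rightarrow> real) \<Rightarrow> ('g \<Rightarrow> real) \<Rightarrow> 'g \<Rightarrow> real" where
  "poisson_bracket G P f g p =
     P p (differential_at (atlas G) p f) (differential_at (atlas G) p g)"

end

theory Submission
  imports Defs
begin

text \<open>
  For \<open>z\<close> in the Lie algebra let \<open>z\<^sup>-\<close> be the right invariant field with value \<open>z\<close> at the unit. Its flow
  consists of left translations, so the one-form \<open>\<Omega>(z\<^sup>-, \<cdot>)\<close> is closed; it is also parallel for the affine
  structure. Hence local primitives \<open>x\<^sub>z\<close> of these forms, i.e. the components of a local momentum map of the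
  left action of the group on itself, are affine coordinates. In these coordinates \<open>\<Omega>(z\<^sup>-, y\<^sup>-)\<close> has the
  differential of the coordinate belonging to \<open>[z, y]\<close>, so it is affine; therefore the bracket of coordinates for
  the left invariant bivector is affine and the one for the right invariant bivector, which is a sum of products
  of two such functions, is quadratic. If the constants of integration are chosen so that
  \<open>\<Omega>(z\<^sup>-, y\<^sup>-) = \<omega>(z, y) + x\<^bsub>[z, y]\<^esub>\<close>, then the constant terms cancel. Near the unit this normalisation is
  obvious; elsewhere it says that \<open>\<omega>\<close> and its pullback by the adjoint action are cohomologous, which holds
  on a connected group.
\<close>

section \<open>Calculus of smooth functions\<close>

text \<open>One computation carries closedness, parallelism and the polynomial formula alike: along
  a left invariant field \<open>X x\<close> the components \<open>Ad q z\<close> of a right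
  invariant field in the left invariant frame change by \<open>- Br x (Ad q z)\<close>, because left
  and right invariant fields commute. The condition that defines the connection makes covariant
  differentiation along \<open>X x\<close> on left invariant fields minus the
  \<open>w\<close>-adjoint of \<open>Br x\<close>; comparing the two rates of change gives
  parallelism, while the cocycle identity of \<open>w\<close> gives closedness. The obstacle is one
  of domains. The connection, and the smoothness of the two-form, are specified on globally defined
  vector fields only, whereas coordinate fields live on a single chart. Instead of cutting off local
  objects, everything is expanded in the left invariant frame, which is global; local smoothness is
  then recovered by solving linear systems in that frame, and affinity is checked on the frame and
  extended by function-linearity.\<close>

abbreviation dirderiv :: "('a::real_normed_vector \<Rightarrow> 'b::real_normed_vector) \<Rightarrow> 'a \<Rightarrow> 'a \<Rightarrow> 'b" where
  "dirderiv f v \<equiv> (\<lambda>x. frechet_derivative f (at x) v)"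

section \<open>Closure properties of maps of class k\<close>

lemma Ck_on_continuous_on: "Ck_on k S f \<Longrightarrow> continuous_on S f"
  by (cases k) (auto intro!: continuous_at_imp_continuous_on differentiable_imp_continuous_within)

lemma Ck_on_SucD: "Ck_on (Suc k) S f \<Longrightarrow> Ck_on k S f"
proof (induction k arbitrary: f)
  case 0
  then show ?case using Ck_on_continuous_on[OF 0] by simp
next
  case (Suc k)
  then show ?case by (metis Ck_on.simps(2))
qed

lemma Ck_on_subset: "Ck_on k S f \<Longrightarrow> T \<subseteq> S \<Longrightarrow> Ck_on k T f"
  by (induction k arbitrary: f) (auto intro: continuous_on_subset)

lemma Ck_on_has_derivative:
  "Ck_on (Suc k) S f \<Longrightarrow> x \<in> S \<Longrightarrow> (f has_derivative frechet_derivative f (at x)) (at x)"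
  using frechet_derivative_works by auto

lemma Ck_on_cong:
  assumes "open S" "\<And>x. x \<in> S \<Longrightarrow> f x = g x" "Ck_on k S f"
  shows "Ck_on k S g"
  using assms(2,3)
proof (induction k arbitrary: f g)
  case 0
  then show ?case using continuous_on_cong[of S S f g] by simp
next
  case (Suc k)
  have d: "(g has_derivative frechet_derivative f (at x)) (at x)" if "x \<in> S" for x
    using has_derivative_transform_within_open[OF Ck_on_has_derivative[OF Suc.prems(2) that] assms(1) that] Suc.prems(1)
    by auto
  have "Ck_on k S (dirderiv g v)" for v
    using Suc.IH[of "dirderiv f v" "dirderiv g v"] Suc.prems(2) frechet_derivative_at[OF d] by auto
  then show ?case using d by (auto simp: differentiable_def)
qed

text \<open>The definition of the class speaks of the chosen derivative
  \<open>frechet_derivative\<close>. By uniqueness of the derivative an explicit formula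
  \<open>f' x\<close> serves as well, and all later verifications go through this rule.\<close>

lemma Ck_on_SucI:
  assumes "open S" and d: "\<And>x. x \<in> S \<Longrightarrow> (f has_derivative f' x) (at x)"
    and c: "\<And>v. Ck_on k S (\<lambda>x. f' x v)"
  shows "Ck_on (Suc k) S f"
proof -
  have "Ck_on k S (dirderiv f v)" for v
    by (rule Ck_on_cong[OF assms(1) _ c[of v]]) (use frechet_derivative_at[OF d] in auto)
  then show ?thesis using d by (auto simp: differentiable_def)
qed

lemma Ck_on_const: "Ck_on k S (\<lambda>x. c)"
  by (induction k arbitrary: c) auto

lemma Ck_on_compose_bounded_linear:
  assumes "open S" "bounded_linear L" "Ck_on k S f"
  shows "Ck_on k S (\<lambda>x. L (f x))"
  using assms(3)
proof (induction k arbitrary: f)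
  case 0
  then show ?case by (simp add: assms(2) bounded_linear.continuous_on)
next
  case (Suc k)
  show ?case
    by (rule Ck_on_SucI[OF assms(1) bounded_linear.has_derivative[OF assms(2) Ck_on_has_derivative[OF Suc.prems]]])
      (use Suc in auto)
qed

lemma Ck_on_bounded_linear:
  assumes "open S" "bounded_linear L"
  shows "Ck_on k S L"
proof (cases k)
  case 0
  then show ?thesis using assms(2) by (simp add: linear_continuous_on)
next
  case (Suc k)
  show ?thesis unfolding Suc
    by (rule Ck_on_SucI[OF assms(1) bounded_linear_imp_has_derivative[OF assms(2)] Ck_on_const])
qed

lemma Ck_on_ident: "open S \<Longrightarrow> Ck_on k S (\<lambda>x. x)"
  by (rule Ck_on_bounded_linear) auto

lemma Ck_on_add:
  assumes "open S" "Ck_on k S f" "Ck_on k S g"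
  shows "Ck_on k S (\<lambda>x. f x + g x)"
  using assms(2,3)
proof (induction k arbitrary: f g)
  case 0
  then show ?case by (simp add: continuous_on_add)
next
  case (Suc k)
  show ?case
    by (rule Ck_on_SucI[OF assms(1) has_derivative_add[OF Suc.prems[THEN Ck_on_has_derivative]]])
      (use Suc in auto)
qed

lemma Ck_on_sum:
  assumes "open S" "\<And>i. i \<in> I \<Longrightarrow> Ck_on k S (f i)"
  shows "Ck_on k S (\<lambda>x. \<Sum>i\<in>I. f i x)"
  using assms(2) by (induction I rule: infinite_finite_induct)
    (auto intro!: Ck_on_add Ck_on_const assms(1))

lemma Ck_on_scaleR:
  fixes f :: "'a::euclidean_space \<Rightarrow> real"
  assumes "open S" "Ck_on k S f" "Ck_on k S g"
  shows "Ck_on k S (\<lambda>x. f x *\<^sub>R g x)"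
  using assms(2,3)
proof (induction k arbitrary: f g)
  case 0
  then show ?case by (simp add: continuous_on_scaleR)
next
  case (Suc k)
  have *: "Ck_on k S f" "Ck_on k S g" using Suc.prems Ck_on_SucD by blast+
  show ?case
    by (rule Ck_on_SucI[OF assms(1) has_derivative_scaleR[OF Suc.prems[THEN Ck_on_has_derivative]]])
      (use Suc * in \<open>auto intro!: Ck_on_add assms(1)\<close>)
qed

lemma Ck_on_mult:
  fixes f g :: "'a::euclidean_space \<Rightarrow> real"
  assumes "open S" "Ck_on k S f" "Ck_on k S g"
  shows "Ck_on k S (\<lambda>x. f x * g x)"
  using Ck_on_scaleR[OF assms] by simp

lemma Ck_on_prod:
  fixes f :: "'i \<Rightarrow> 'a::euclidean_space \<Rightarrow> real"
  assumes "open S" "\<And>i. i \<in> I \<Longrightarrow> Ck_on k S (f i)"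
  shows "Ck_on k S (\<lambda>x. \<Prod>i\<in>I. f i x)"
  using assms(2) by (induction I rule: infinite_finite_induct)
    (auto intro!: Ck_on_mult Ck_on_const assms(1))

lemma Ck_on_inverse:
  fixes f :: "'a::euclidean_space \<Rightarrow> real"
  assumes "open S" "Ck_on k S f" "\<And>x. x \<in> S \<Longrightarrow> f x \<noteq> 0"
  shows "Ck_on k S (\<lambda>x. inverse (f x))"
  using assms(2)
proof (induction k)
  case 0
  then show ?case using assms(3) by (simp add: continuous_on_inverse)
next
  case (Suc k)
  have *: "Ck_on k S f" using Suc.prems Ck_on_SucD by blast
  \<comment> \<open>The derivative is written as a product containing \<open>inverse (f x)\<close>
    itself, so that the induction hypothesis applies to the factors.\<close>
  have d: "((\<lambda>x. inverse (f x)) has_derivative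
      (\<lambda>v. (-1) * ((inverse (f x) * inverse (f x)) * frechet_derivative f (at x) v))) (at x)"
    if "x \<in> S" for x
    by (rule has_derivative_eq_rhs[OF Deriv.has_derivative_inverse[OF assms(3)[OF that] Ck_on_has_derivative[OF Suc.prems that]]])
      (simp add: fun_eq_iff)
  show ?case
  proof (rule Ck_on_SucI[OF assms(1) d])
    fix v
    have "Ck_on k S (dirderiv f v)" using Suc.prems by simp
    then show "Ck_on k S (\<lambda>x. (-1) * ((inverse (f x) * inverse (f x)) * dirderiv f v x))"
      by (intro Ck_on_mult Ck_on_const assms(1) Suc.IH *)
  qed
qed

lemma Ck_on_compose:
  fixes g :: "'a::euclidean_space \<Rightarrow> 'b::euclidean_space"
  assumes "open S" "open T" "g ` S \<subseteq> T" "Ck_on k S g" "Ck_on k T f"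
  shows "Ck_on k S (f \<circ> g)"
  using assms(4,5)
proof (induction k arbitrary: f)
  case 0
  then show ?case using assms(3) unfolding Ck_on.simps
    by (meson continuous_on_compose continuous_on_subset)
next
  case (Suc k)
  have *: "Ck_on k S g" using Suc.prems Ck_on_SucD by blast
  \<comment> \<open>The chain rule is expanded over \<open>Basis\<close>: otherwise the direction in
    which \<open>f\<close> is differentiated would depend on \<open>x\<close>, and the induction
    hypothesis covers only \<open>dirderiv f b \<circ> g\<close> with a fixed
    \<open>b\<close>.\<close>
  have d: "((f \<circ> g) has_derivative
      (\<lambda>v. \<Sum>b\<in>Basis. (frechet_derivative g (at x) v \<bullet> b) *\<^sub>R (dirderiv f b \<circ> g) x)) (at x)"
    if "x \<in> S" for x
  proof (rule has_derivative_eq_rhs[OF diff_chain_at])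
    have gx: "g x \<in> T" using assms(3) that by auto
    show "(f has_derivative frechet_derivative f (at (g x))) (at (g x))"
      using Ck_on_has_derivative[OF Suc.prems(2) gx] .
    then have lin: "linear (frechet_derivative f (at (g x)))" by (rule has_derivative_linear)
    show "(g has_derivative frechet_derivative g (at x)) (at x)"
      using Ck_on_has_derivative[OF Suc.prems(1) that] .
    show "frechet_derivative f (at (g x)) \<circ> frechet_derivative g (at x) =
      (\<lambda>v. \<Sum>b\<in>Basis. (frechet_derivative g (at x) v \<bullet> b) *\<^sub>R (dirderiv f b \<circ> g) x)"
      by (simp add: fun_eq_iff linear_sum[OF lin, symmetric] linear_scale[OF lin, symmetric] euclidean_representation)
  qed
  show ?case
  proof (rule Ck_on_SucI[OF assms(1) d])
    fix v
    have "Ck_on k S (\<lambda>x. dirderiv g v x \<bullet> b)" for b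
      using Suc.prems(1) by (intro Ck_on_compose_bounded_linear[where L = "\<lambda>y. y \<bullet> b"] assms(1)
        bounded_linear_inner_left) simp
    moreover have "Ck_on k S (dirderiv f b \<circ> g)" for b
      by (rule Suc.IH[OF *]) (use Suc.prems(2) in simp)
    ultimately show "Ck_on k S (\<lambda>x. \<Sum>b\<in>Basis. (dirderiv g v x \<bullet> b) *\<^sub>R (dirderiv f b \<circ> g) x)"
      by (intro Ck_on_sum Ck_on_scaleR assms(1))
  qed
qed

lemma Ck_on_local:
  assumes "\<And>x. x \<in> S \<Longrightarrow> \<exists>T. open T \<and> x \<in> T \<and> Ck_on k T f"
  shows "Ck_on k S f"
  using assms
proof (induction k arbitrary: f)
  case 0
  then show ?case
    by (metis Ck_on.simps(1) continuous_at_imp_continuous_on continuous_on_eq_continuous_at)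
next
  case (Suc k)
  have "f differentiable (at x)" if "x \<in> S" for x
    using Suc.prems[OF that] by auto
  moreover have "Ck_on k S (dirderiv f v)" for v
    by (rule Suc.IH) (use Suc.prems in fastforce)
  ultimately show ?case by simp
qed

lemma Ck_on_vec_lambda_iff:
  fixes f :: "'a::euclidean_space \<Rightarrow> real ^ 'n::finite"
  assumes "open S"
  shows "Ck_on k S f \<longleftrightarrow> (\<forall>i. Ck_on k S (\<lambda>x. f x $ i))"
proof
  assume *: "\<forall>i. Ck_on k S (\<lambda>x. f x $ i)"
  have "Ck_on k S (\<lambda>x. \<Sum>i\<in>UNIV. (f x $ i) *\<^sub>R (axis i 1 :: real ^ 'n))"
    by (intro Ck_on_sum Ck_on_scaleR Ck_on_const assms) (use * in auto)
  then show "Ck_on k S f"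
    using basis_expansion[of "f _"] by (simp add: scalar_mult_eq_scaleR)
next
  assume "Ck_on k S f"
  then show "\<forall>i. Ck_on k S (\<lambda>x. f x $ i)"
    using Ck_on_compose_bounded_linear[OF assms bounded_linear_vec_nth] by blast
qed

lemma Ck_on_Pair:
  assumes "open S" "Ck_on k S f" "Ck_on k S g"
  shows "Ck_on k S (\<lambda>x. (f x, g x))"
proof -
  have "Ck_on k S (\<lambda>x. (f x, 0) + (0, g x))"
    by (intro Ck_on_add assms Ck_on_compose_bounded_linear[OF assms(1) _ assms(2), of "\<lambda>x. (x, 0)"] Ck_on_compose_bounded_linear[OF assms(1) _ assms(3), of "\<lambda>x. (0, x)"])
     (auto intro!: bounded_linear_Pair bounded_linear_ident bounded_linear_zero)
  then show ?thesis by simp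
qed

section \<open>Smooth maps\<close>

lemma smooth_on_dirderiv: "smooth_on S f \<Longrightarrow> smooth_on S (dirderiv f v)"
  unfolding smooth_on_def by (metis Ck_on.simps(2))

lemma smooth_on_has_derivative:
  "smooth_on S f \<Longrightarrow> x \<in> S \<Longrightarrow> (f has_derivative frechet_derivative f (at x)) (at x)"
  using Ck_on_has_derivative smooth_on_def by blast

lemma smooth_onI_derivative:
  assumes "open S" and d: "\<And>x. x \<in> S \<Longrightarrow> (f has_derivative f' x) (at x)"
    and c: "\<And>v. smooth_on S (\<lambda>x. f' x v)"
  shows "smooth_on S f"
  unfolding smooth_on_def
proof
  fix k
  have "Ck_on (Suc k) S f" using Ck_on_SucI[OF assms(1) d, of k] c by (simp add: smooth_on_def)
  then show "Ck_on k S f" by (rule Ck_on_SucD)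
qed

lemma smooth_on_continuous_on: "smooth_on S f \<Longrightarrow> continuous_on S f"
  using Ck_on_continuous_on smooth_on_def by blast

lemma smooth_on_subset: "smooth_on S f \<Longrightarrow> T \<subseteq> S \<Longrightarrow> smooth_on T f"
  unfolding smooth_on_def by (intro allI) (rule Ck_on_subset, auto)

lemma smooth_on_cong:
  "open S \<Longrightarrow> (\<And>x. x \<in> S \<Longrightarrow> f x = g x) \<Longrightarrow> smooth_on S f \<Longrightarrow> smooth_on S g"
  by (simp add: smooth_on_def Ck_on_cong[of S f g])

lemma smooth_on_local:
  "(\<And>x. x \<in> S \<Longrightarrow> \<exists>T. open T \<and> x \<in> T \<and> smooth_on T f) \<Longrightarrow> smooth_on S f"
  unfolding smooth_on_def by (intro allI Ck_on_local) blast

lemma smooth_on_const: "smooth_on S (\<lambda>x. c)"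
  by (simp add: smooth_on_def Ck_on_const)

lemma smooth_on_bounded_linear: "open S \<Longrightarrow> bounded_linear L \<Longrightarrow> smooth_on S L"
  by (simp add: smooth_on_def Ck_on_bounded_linear)

lemma smooth_on_ident: "open S \<Longrightarrow> smooth_on S (\<lambda>x. x)"
  by (simp add: smooth_on_def Ck_on_ident)

lemma smooth_on_add:
  "open S \<Longrightarrow> smooth_on S f \<Longrightarrow> smooth_on S g \<Longrightarrow> smooth_on S (\<lambda>x. f x + g x)"
  by (simp add: smooth_on_def Ck_on_add)

lemma smooth_on_sum:
  "open S \<Longrightarrow> (\<And>i. i \<in> I \<Longrightarrow> smooth_on S (f i)) \<Longrightarrow> smooth_on S (\<lambda>x. \<Sum>i\<in>I. f i x)"
  by (simp add: smooth_on_def Ck_on_sum)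

lemma smooth_on_mult:
  fixes f g :: "'a::euclidean_space \<Rightarrow> real"
  shows "open S \<Longrightarrow> smooth_on S f \<Longrightarrow> smooth_on S g \<Longrightarrow> smooth_on S (\<lambda>x. f x * g x)"
  by (simp add: smooth_on_def Ck_on_mult)

lemma smooth_on_compose:
  fixes g :: "'a::euclidean_space \<Rightarrow> 'b::euclidean_space"
  shows "open S \<Longrightarrow> open T \<Longrightarrow> g ` S \<subseteq> T \<Longrightarrow> smooth_on S g \<Longrightarrow> smooth_on T f \<Longrightarrow> smooth_on S (f \<circ> g)"
  by (simp add: smooth_on_def Ck_on_compose[of S T])

lemma smooth_on_vec_nth_iff:
  fixes f :: "'a::euclidean_space \<Rightarrow> real ^ 'n::finite"
  shows "open S \<Longrightarrow> smooth_on S f \<longleftrightarrow> (\<forall>i. smooth_on S (\<lambda>x. f x $ i))"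
  by (auto simp: smooth_on_def Ck_on_vec_lambda_iff)

lemma smooth_on_Pair:
  "open S \<Longrightarrow> smooth_on S f \<Longrightarrow> smooth_on S g \<Longrightarrow> smooth_on S (\<lambda>x. (f x, g x))"
  by (simp add: smooth_on_def Ck_on_Pair)

section \<open>Symmetry of second derivatives\<close>

lemma second_difference_eq_dirderiv:
  fixes f :: "'a::euclidean_space \<Rightarrow> real"
  assumes "Ck_on 2 S f" "ball x r \<subseteq> S" "h > 0" "h * (norm u + norm v) < r"
  shows "\<exists>y\<in>ball x r. f (x + h *\<^sub>R u + h *\<^sub>R v) - f (x + h *\<^sub>R u) - f (x + h *\<^sub>R v) + f x
    = h * h * dirderiv (dirderiv f u) v y"
proof -
  have in_ball: "x + s *\<^sub>R u + t *\<^sub>R v \<in> ball x r" if "0 \<le> s" "s \<le> h" "0 \<le> t" "t \<le> h" for s t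
  proof -
    have "norm (s *\<^sub>R u + t *\<^sub>R v) \<le> s * norm u + t * norm v"
      using norm_triangle_ineq[of "s *\<^sub>R u" "t *\<^sub>R v"] that by simp
    also have "\<dots> \<le> h * norm u + h * norm v"
      using that by (intro add_mono mult_right_mono) auto
    finally show ?thesis using assms(4)
      unfolding mem_ball dist_commute[of x] by (simp add: dist_norm distrib_left add.assoc)
  qed
  have C1: "Ck_on (Suc 0) S (dirderiv f w)" for w
    using assms(1) by (simp add: numeral_2_eq_2)
  have df: "(f has_derivative frechet_derivative f (at y)) (at y)" if "y \<in> ball x r" for y
    using assms(1,2) that Ck_on_has_derivative[of 1 S f y] by (auto simp: numeral_2_eq_2)
  have ddf: "(dirderiv f u has_derivative frechet_derivative (dirderiv f u) (at y)) (at y)" if "y \<in> ball x r" for y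
    using C1 assms(2) that Ck_on_has_derivative[of 0 S "dirderiv f u" y] by auto
  \<comment> \<open>\<open>g\<close> is the first difference in direction \<open>v\<close>. The mean
    value theorem for \<open>g\<close> yields a derivative in direction \<open>u\<close>; a second
    application, along \<open>v\<close>, yields the iterated derivative in exactly this
    order.\<close>
  define g where "g s = f (x + s *\<^sub>R u + h *\<^sub>R v) - f (x + s *\<^sub>R u)" for s
  define g' where "g' s = dirderiv f u (x + s *\<^sub>R u + h *\<^sub>R v) - dirderiv f u (x + s *\<^sub>R u)" for s
  have line: "((\<lambda>s. F (y + s *\<^sub>R w)) has_real_derivative F' w) (at s)"
    if "(F has_derivative F') (at (y + s *\<^sub>R w))" for F :: "'a \<Rightarrow> real" and F' y w and s :: real
  proof -
    have "((\<lambda>s. y + s *\<^sub>R w) has_derivative (\<lambda>s. s *\<^sub>R w)) (at s)"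
      by (auto intro!: derivative_eq_intros)
    from has_derivative_compose[OF this that]
    show ?thesis using linear_scale[OF has_derivative_linear[OF that]]
      by (simp add: has_field_derivative_def mult.commute[of _ "F' w"])
  qed
  have "(g has_real_derivative g' s) (at s)" if "0 \<le> s" "s \<le> h" for s
    unfolding g_def g'_def
    using line[of f "frechet_derivative f (at (x + h *\<^sub>R v + s *\<^sub>R u))" "x + h *\<^sub>R v" s u]
      line[of f "frechet_derivative f (at (x + s *\<^sub>R u))" x s u]
      df[OF in_ball[of s h]] df[OF in_ball[of s 0]] that assms(3)
    by (intro DERIV_diff) (simp_all add: add.assoc add.commute[of "h *\<^sub>R v"])
  from MVT2[OF assms(3) this]
  obtain s where s: "0 < s" "s < h" "g h - g 0 = h * g' s" by auto
  have "((\<lambda>t. dirderiv f u (x + s *\<^sub>R u + t *\<^sub>R v)) has_real_derivative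
      dirderiv (dirderiv f u) v (x + s *\<^sub>R u + t *\<^sub>R v)) (at t)" if "0 \<le> t" "t \<le> h" for t
    using line[OF ddf[OF in_ball[of s t]]] s that by auto
  from MVT2[OF assms(3) this]
  obtain t where t: "0 < t" "t < h" "g' s = h * dirderiv (dirderiv f u) v (x + s *\<^sub>R u + t *\<^sub>R v)"
    by (auto simp: g'_def)
  show ?thesis
    using in_ball[of s t] s t by (intro bexI[of _ "x + s *\<^sub>R u + t *\<^sub>R v"]) (auto simp: g_def)
qed

text \<open>The second difference is symmetric in \<open>u\<close> and \<open>v\<close>, and it
  equals \<open>h * h\<close> times either mixed derivative at some point near \<open>x\<close>.
  Continuity of both mixed derivatives then forces equality at \<open>x\<close>.\<close>

lemma dirderiv_commute:
  fixes f :: "'a::euclidean_space \<Rightarrow> real"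
  assumes "open S" "Ck_on 2 S f" "x \<in> S"
  shows "dirderiv (dirderiv f u) v x = dirderiv (dirderiv f v) u x"
proof -
  have cont: "continuous_on S (dirderiv (dirderiv f a) b)" for a b
    using assms(2) by (auto simp: numeral_2_eq_2)
  have "\<bar>dirderiv (dirderiv f u) v x - dirderiv (dirderiv f v) u x\<bar> < e" if "e > 0" for e
  proof -
    have "\<exists>d>0. ball x d \<subseteq> S \<and> (\<forall>y\<in>ball x d. \<bar>dirderiv (dirderiv f a) b y - dirderiv (dirderiv f a) b x\<bar> < e / 2)" for a b
    proof -
      obtain d1 where d1: "d1 > 0" "ball x d1 \<subseteq> S" using assms(1,3) openE by blast
      obtain d2 where d2: "d2 > 0" "\<And>y. y \<in> S \<Longrightarrow> dist y x < d2 \<Longrightarrow> dist (dirderiv (dirderiv f a) b y) (dirderiv (dirderiv f a) b x) < e / 2"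
        using cont[of a b, unfolded continuous_on_iff] assms(3) \<open>e > 0\<close> by (metis half_gt_zero)
      show ?thesis using d1 d2 by (intro exI[of _ "min d1 d2"]) (auto simp: dist_real_def dist_commute subset_eq)
    qed
    from this[of u v] this[of v u] obtain d1 d2 where
      d1: "d1 > 0" "ball x d1 \<subseteq> S" "\<And>y. y\<in>ball x d1 \<Longrightarrow> \<bar>dirderiv (dirderiv f u) v y - dirderiv (dirderiv f u) v x\<bar> < e / 2" and
      d2: "d2 > 0" "ball x d2 \<subseteq> S" "\<And>y. y\<in>ball x d2 \<Longrightarrow> \<bar>dirderiv (dirderiv f v) u y - dirderiv (dirderiv f v) u x\<bar> < e / 2"
      by blast
    \<comment> \<open>The summand 1 keeps the denominator positive when both directions vanish and
      makes the required bound strict.\<close>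
    define h where "h = min d1 d2 / (1 + (norm u + norm v))"
    have h: "h > 0" using d1 d2 by (simp add: h_def add_pos_nonneg)
    have "h * (norm u + norm v) < h * (1 + (norm u + norm v))" using h by simp
    also have "\<dots> = min d1 d2" unfolding h_def by (simp add: add_pos_nonneg less_imp_neq[symmetric])
    finally have hh: "h * (norm u + norm v) < d1" "h * (norm v + norm u) < d2" by (auto simp: add.commute)
    obtain y where y: "y \<in> ball x d1" "f (x + h *\<^sub>R u + h *\<^sub>R v) - f (x + h *\<^sub>R u) - f (x + h *\<^sub>R v) + f x = h * h * dirderiv (dirderiv f u) v y"
      using second_difference_eq_dirderiv[OF assms(2) d1(2) h hh(1)] by auto
    obtain z where z: "z \<in> ball x d2" "f (x + h *\<^sub>R u + h *\<^sub>R v) - f (x + h *\<^sub>R u) - f (x + h *\<^sub>R v) + f x = h * h * dirderiv (dirderiv f v) u z"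
      using second_difference_eq_dirderiv[OF assms(2) d2(2) h hh(2)] by (auto simp: algebra_simps)
    have "h * h * dirderiv (dirderiv f u) v y = h * h * dirderiv (dirderiv f v) u z"
      using y(2) z(2) by linarith
    then have "dirderiv (dirderiv f u) v y = dirderiv (dirderiv f v) u z" using h by simp
    then show ?thesis using d1(3)[OF y(1)] d2(3)[OF z(1)] by linarith
  qed
  from this[of "\<bar>dirderiv (dirderiv f u) v x - dirderiv (dirderiv f v) u x\<bar>"] show ?thesis by force
qed

section \<open>Integrals along rays from the centre of a ball\<close>

lemma ball_ray:
  fixes p :: "'a::real_normed_vector"
  assumes "y \<in> ball p r" "t \<in> {0..1}"
  shows "p + t *\<^sub>R (y - p) \<in> ball p r"
proof -
  have "t * norm (y - p) \<le> 1 * norm (y - p)" using assms by (intro mult_right_mono) auto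
  then show ?thesis using assms by (auto simp: dist_norm norm_minus_commute)
qed

text \<open>Differentiation under the integral sign brings out one factor \<open>t\<close> from the
  inner map. Allowing a power \<open>t ^ m\<close> makes this class of integrals stable under
  differentiation, as the induction for smoothness requires.\<close>

lemma has_derivative_ray_integral:
  fixes h :: "'a::euclidean_space \<Rightarrow> real"
  assumes "Ck_on 1 (ball p r) h" "x \<in> ball p r"
  shows "((\<lambda>x. integral {0..1} (\<lambda>t. t ^ m * h (p + t *\<^sub>R (x - p)))) has_derivative
      (\<lambda>v. integral {0..1} (\<lambda>t. t ^ Suc m * dirderiv h v (p + t *\<^sub>R (x - p))))) (at x)"
proof -
  have h': "(h has_derivative frechet_derivative h (at y)) (at y)" if "y \<in> ball p r" for y
    using assms(1) that by (simp flip: frechet_derivative_works)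
  have bl: "bounded_linear (frechet_derivative h (at y))" if "y \<in> ball p r" for y
    using h'[OF that] by (rule has_derivative_bounded_linear)
  \<comment> \<open>The Leibniz rule for integrals expects the derivative of the integrand as a
    bounded linear function; \<open>L\<close> packages it so, with the intended value for
    \<open>y\<close> in the ball and \<open>t\<close> in the unit interval.\<close>
  define L where "L y t = Blinfun (\<lambda>v. t ^ Suc m * dirderiv h v (p + t *\<^sub>R (y - p)))" for y t
  have L: "blinfun_apply (L y t) v = t ^ Suc m * dirderiv h v (p + t *\<^sub>R (y - p))"
    if "y \<in> ball p r" "t \<in> {0..1}" for y t v
    unfolding L_def by (subst bounded_linear_Blinfun_apply)
      (auto intro!: bounded_linear_const_mult bl ball_ray that)
  have ray: "continuous_on (ball p r \<times> {0..1}) (\<lambda>(y, t). F (p + t *\<^sub>R (y - p)))"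
    if "continuous_on (ball p r) F" for F :: "'a \<Rightarrow> real"
    unfolding case_prod_beta
    by (rule continuous_on_compose2[OF that]) (auto intro!: continuous_intros ball_ray simp del: mem_ball)
  have "((\<lambda>y. integral (cbox 0 1) (\<lambda>t. t ^ m * h (p + t *\<^sub>R (y - p)))) has_derivative
      integral (cbox 0 1) (L x)) (at x within ball p r)"
  proof (rule leibniz_rule)
    fix y and t :: real assume y: "y \<in> ball p r" and t: "t \<in> cbox 0 1"
    have "((\<lambda>y. p + t *\<^sub>R (y - p)) has_derivative (\<lambda>v. t *\<^sub>R v)) (at y)"
      by (auto intro!: derivative_eq_intros)
    moreover have t': "t \<in> {0..1}" using t by simp
    ultimately have D: "((\<lambda>y. h (p + t *\<^sub>R (y - p))) has_derivative (\<lambda>v. dirderiv h (t *\<^sub>R v) (p + t *\<^sub>R (y - p)))) (at y)"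
      using has_derivative_compose h'[OF ball_ray[OF y t']] by fast
    have "dirderiv h (t *\<^sub>R v) (p + t *\<^sub>R (y - p)) = t * dirderiv h v (p + t *\<^sub>R (y - p))" for v
      using linear_scale[OF has_derivative_linear[OF h'[OF ball_ray[OF y t']]], of t] by simp
    then have "((\<lambda>y. t ^ m * h (p + t *\<^sub>R (y - p))) has_derivative blinfun_apply (L y t)) (at y)"
      by (intro has_derivative_eq_rhs[OF has_derivative_mult_right[OF D, of "t ^ m"]])
        (simp add: L[OF y t'] fun_eq_iff)
    then show "((\<lambda>y. t ^ m * h (p + t *\<^sub>R (y - p))) has_derivative blinfun_apply (L y t)) (at y within ball p r)"
      by (rule has_derivative_at_withinI)
  next
    fix y assume y: "y \<in> ball p r"
    have "continuous_on {0..1} (\<lambda>t. h (p + t *\<^sub>R (y - p)))"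
      by (rule continuous_on_compose2[OF Ck_on_continuous_on[OF assms(1)]])
        (auto intro!: continuous_intros ball_ray y simp del: mem_ball)
    then show "(\<lambda>t. t ^ m * h (p + t *\<^sub>R (y - p))) integrable_on cbox 0 1"
      by (auto intro!: integrable_continuous_real continuous_intros)
  next
    have "continuous_on (ball p r \<times> {0..1}) (\<lambda>z. snd z ^ Suc m * (case z of (y, t) \<Rightarrow> dirderiv h i (p + t *\<^sub>R (y - p))))" for i
      using assms(1) by (intro continuous_on_mult ray continuous_intros) auto
    then have "continuous_on (ball p r \<times> {0..1}) (\<lambda>z. blinfun_apply (case z of (y, t) \<Rightarrow> L y t) i)" for i
      by (rule continuous_on_eq) (auto simp: L simp del: mem_ball)
    then show "continuous_on (ball p r \<times> cbox 0 1) (\<lambda>(y, t). L y t)"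
      by (auto intro!: continuous_on_blinfun_componentwise)
  qed (use assms in auto)
  then have *: "((\<lambda>y. integral {0..1} (\<lambda>t. t ^ m * h (p + t *\<^sub>R (y - p)))) has_derivative
      integral {0..1} (L x)) (at x)"
    using at_within_open[OF assms(2)] by simp
  have contL: "continuous_on {0..1} (L x)"
  proof (rule continuous_on_blinfun_componentwise)
    fix i
    have "continuous_on {0..1} (\<lambda>t. dirderiv h i (p + t *\<^sub>R (x - p)))"
      by (rule continuous_on_compose2[of "ball p r"])
        (use assms in \<open>auto intro!: continuous_intros ball_ray simp del: mem_ball\<close>)
    then have "continuous_on {0..1} (\<lambda>t. t ^ Suc m * dirderiv h i (p + t *\<^sub>R (x - p)))"
      by (intro continuous_intros)
    then show "continuous_on {0..1} (\<lambda>t. blinfun_apply (L x t) i)"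
      by (rule continuous_on_eq) (use assms in \<open>auto simp: L simp del: mem_ball\<close>)
  qed
  have "blinfun_apply (integral {0..1} (L x)) v = integral {0..1} (\<lambda>t. t ^ Suc m * dirderiv h v (p + t *\<^sub>R (x - p)))" for v
  proof -
    have "blinfun_apply (integral {0..1} (L x)) v = integral {0..1} (\<lambda>t. blinfun_apply (L x t) v)"
      using integral_linear[OF integrable_continuous_real[OF contL], of "\<lambda>A. blinfun_apply A v"]
      by (simp add: o_def blinfun.bounded_linear_left)
    also have "\<dots> = integral {0..1} (\<lambda>t. t ^ Suc m * dirderiv h v (p + t *\<^sub>R (x - p)))"
      using L[OF assms(2)] by (intro integral_cong) auto
    finally show ?thesis .
  qed
  then show ?thesis using has_derivative_eq_rhs[OF *] by (auto simp: fun_eq_iff)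
qed

lemma smooth_on_ray_integral:
  fixes h :: "'a::euclidean_space \<Rightarrow> real"
  assumes "smooth_on (ball p r) h"
  shows "smooth_on (ball p r) (\<lambda>x. integral {0..1} (\<lambda>t. t ^ m * h (p + t *\<^sub>R (x - p))))"
  unfolding smooth_on_def
proof
  fix k
  \<comment> \<open>The induction runs over all \<open>h\<close> and \<open>m\<close>, because
    differentiation replaces them by \<open>dirderiv h v\<close> and \<open>Suc m\<close>.\<close>
  have "Ck_on (Suc k) (ball p r) (\<lambda>x. integral {0..1} (\<lambda>t. t ^ m * h (p + t *\<^sub>R (x - p))))"
    using assms
  proof (induction k arbitrary: h m)
    case 0
    have "Ck_on 1 (ball p r) h" if "smooth_on (ball p r) h" for h :: "'a \<Rightarrow> real"
      using that unfolding smooth_on_def by blast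
    note C1 = this
    have "continuous_on (ball p r) (\<lambda>x. integral {0..1} (\<lambda>t. t ^ Suc m * dirderiv h v (p + t *\<^sub>R (x - p))))" for v
      using has_derivative_continuous[OF has_derivative_ray_integral[OF C1[OF smooth_on_dirderiv[OF 0]]]]
      by (intro continuous_at_imp_continuous_on) blast
    then show ?case
      by (intro Ck_on_SucI[OF _ has_derivative_ray_integral[OF C1[OF 0]]]) simp_all
  next
    case (Suc k)
    have "Ck_on 1 (ball p r) h"
      using Suc.prems unfolding smooth_on_def by blast
    then show ?case
      by (rule Ck_on_SucI[OF open_ball has_derivative_ray_integral Suc.IH[OF smooth_on_dirderiv[OF Suc.prems]]])
  qed
  then show "Ck_on k (ball p r) (\<lambda>x. integral {0..1} (\<lambda>t. t ^ m * h (p + t *\<^sub>R (x - p))))"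
    by (rule Ck_on_SucD)
qed

section \<open>Hadamard's lemma and the Poincare lemma for one-forms\<close>

lemma vec_axis_expansion: "(\<Sum>i\<in>UNIV. (v $ i) *\<^sub>R axis i 1) = (v :: real ^ 'n::finite)"
  using basis_expansion[of v] by (simp add: scalar_mult_eq_scaleR)

lemma linear_axis_expansion:
  fixes L :: "real ^ 'n::finite \<Rightarrow> 'b::real_vector"
  assumes "linear L"
  shows "L v = (\<Sum>i\<in>UNIV. (v $ i) *\<^sub>R L (axis i 1))"
  using linear_sum[OF assms, of "\<lambda>i. (v $ i) *\<^sub>R axis i 1" UNIV]
  by (simp add: vec_axis_expansion linear_scale[OF assms])

lemma has_vector_derivative_along_ray:
  fixes f :: "'a::real_normed_vector \<Rightarrow> real"
  assumes "f differentiable (at (p + t *\<^sub>R w))"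
  shows "((\<lambda>t. f (p + t *\<^sub>R w)) has_vector_derivative dirderiv f w (p + t *\<^sub>R w)) (at t within T)"
proof -
  have d: "(f has_derivative frechet_derivative f (at (p + t *\<^sub>R w))) (at (p + t *\<^sub>R w))"
    using assms frechet_derivative_works by blast
  have "((\<lambda>s. p + s *\<^sub>R w) has_derivative (\<lambda>s. s *\<^sub>R w)) (at t)"
    by (auto intro!: derivative_eq_intros)
  from has_derivative_compose[OF this d]
  show ?thesis using linear_scale[OF has_derivative_linear[OF d]]
    by (auto simp: has_vector_derivative_def intro: has_derivative_at_withinI)
qed

lemma has_integral_ray:
  fixes f :: "'a::real_normed_vector \<Rightarrow> real"
  assumes "continuous_on (ball p r) f" "x \<in> ball p r"
  shows "((\<lambda>t. t ^ m * f (p + t *\<^sub>R (x - p))) has_integral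
    integral {0..1} (\<lambda>t. t ^ m * f (p + t *\<^sub>R (x - p)))) {0..1}"
proof -
  have "continuous_on {0..1} (\<lambda>t. f (p + t *\<^sub>R (x - p)))"
    by (rule continuous_on_compose2[OF assms(1)])
      (auto intro!: continuous_intros ball_ray assms(2) simp del: mem_ball)
  then show ?thesis
    by (intro integrable_integral integrable_continuous_real continuous_intros)
qed

lemma smooth_on_differentiable: "smooth_on S f \<Longrightarrow> x \<in> S \<Longrightarrow> f differentiable (at x)"
  using smooth_on_has_derivative differentiable_def by blast

text \<open>The coefficient \<open>g i\<close> is the average of the partial derivative number
  \<open>i\<close> over the segment from \<open>p\<close> to \<open>x\<close>; the expansion is the
  fundamental theorem of calculus on that segment.\<close>

lemma Hadamard:
  fixes f :: "real ^ 'n::finite \<Rightarrow> real"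
  assumes "smooth_on (ball p r) f" "r > 0"
  obtains g where "\<And>i. smooth_on (ball p r) (g i)"
    "\<And>x. x \<in> ball p r \<Longrightarrow> f x = f p + (\<Sum>i\<in>UNIV. (x - p) $ i * g i x)"
    "\<And>i. g i p = dirderiv f (axis i 1) p"
proof
  let ?g = "\<lambda>i x. integral {0..1} (\<lambda>t. t ^ 0 * dirderiv f (axis i 1) (p + t *\<^sub>R (x - p)))"
  show "smooth_on (ball p r) (?g i)" for i
    by (intro smooth_on_ray_integral smooth_on_dirderiv assms)
  show "?g i p = dirderiv f (axis i 1) p" for i by simp
  fix x assume x: "x \<in> ball p r"
  have "((\<lambda>t. dirderiv f (x - p) (p + t *\<^sub>R (x - p))) has_integral
     f (p + 1 *\<^sub>R (x - p)) - f (p + 0 *\<^sub>R (x - p))) {0..1}"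
    by (rule fundamental_theorem_of_calculus)
      (auto intro!: has_vector_derivative_along_ray smooth_on_differentiable[OF assms(1)] ball_ray[OF x] simp del: mem_ball)
  moreover have "((\<lambda>t. \<Sum>i\<in>UNIV. (x - p) $ i * (t ^ 0 * dirderiv f (axis i 1) (p + t *\<^sub>R (x - p)))) has_integral
    (\<Sum>i\<in>UNIV. (x - p) $ i * ?g i x)) {0..1}"
    by (intro has_integral_sum has_integral_mult_right has_integral_ray[OF _ x] finite smooth_on_continuous_on smooth_on_dirderiv assms)
  moreover have "dirderiv f (x - p) (p + t *\<^sub>R (x - p)) =
     (\<Sum>i\<in>UNIV. (x - p) $ i * (t ^ 0 * dirderiv f (axis i 1) (p + t *\<^sub>R (x - p))))" if "t \<in> {0..1}" for t
    using linear_axis_expansion[OF linear_frechet_derivative[OF smooth_on_differentiable[OF assms(1) ball_ray[OF x that]]], of "x - p"]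
    by simp
  ultimately have "((\<lambda>t. dirderiv f (x - p) (p + t *\<^sub>R (x - p))) has_integral
      (\<Sum>i\<in>UNIV. (x - p) $ i * ?g i x)) {0..1}"
    by (subst has_integral_cong) auto
  then have "f (p + 1 *\<^sub>R (x - p)) - f (p + 0 *\<^sub>R (x - p)) = (\<Sum>i\<in>UNIV. (x - p) $ i * ?g i x)"
    using \<open>((\<lambda>t. dirderiv f (x - p) (p + t *\<^sub>R (x - p))) has_integral
     f (p + 1 *\<^sub>R (x - p)) - f (p + 0 *\<^sub>R (x - p))) {0..1}\<close> has_integral_unique by blast
  then show "f x = f p + (\<Sum>i\<in>UNIV. (x - p) $ i * ?g i x)" by simp
qed

text \<open>\<open>F\<close> integrates the form along the segment from \<open>p\<close> to
  \<open>x\<close>. Its derivative involves the derivatives of the coefficients in direction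
  \<open>v\<close>; closedness exchanges \<open>v\<close> with the direction of the ray, and the
  integrand becomes the derivative of \<open>t\<close> times the coefficients along the ray.\<close>

lemma Poincare_one_form:
  fixes \<beta> :: "'n::finite \<Rightarrow> real ^ 'n \<Rightarrow> real"
  assumes smooth: "\<And>i. smooth_on (ball p r) (\<beta> i)"
    and closed: "\<And>i j x. x \<in> ball p r \<Longrightarrow> dirderiv (\<beta> i) (axis j 1) x = dirderiv (\<beta> j) (axis i 1) x"
  obtains F where "F p = 0"
    "\<And>x. x \<in> ball p r \<Longrightarrow> (F has_derivative (\<lambda>v. \<Sum>i\<in>UNIV. \<beta> i x * v $ i)) (at x)"
proof -
  define A where "A i x = integral {0..1} (\<lambda>t. t ^ 0 * \<beta> i (p + t *\<^sub>R (x - p)))" for i x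
  define C where "C i x v = integral {0..1} (\<lambda>t. t ^ Suc 0 * dirderiv (\<beta> i) v (p + t *\<^sub>R (x - p)))" for i x v
  define F where "F x = (\<Sum>i\<in>UNIV. (x - p) $ i * A i x)" for x
  have "(F has_derivative (\<lambda>v. \<Sum>i\<in>UNIV. \<beta> i x * v $ i)) (at x)" if x: "x \<in> ball p r" for x
  proof -
  have dA: "(A i has_derivative C i x) (at x)" for i
    unfolding A_def C_def
    using smooth x by (intro has_derivative_ray_integral[where r = r]) (simp_all add: smooth_on_def del: Ck_on.simps)
  have lin: "((\<lambda>x. (x - p) $ i) has_derivative (\<lambda>v. v $ i)) (at x)" for i
    by (auto intro!: derivative_eq_intros bounded_linear.has_derivative[OF bounded_linear_vec_nth])
  have dF: "(F has_derivative (\<lambda>v. \<Sum>i\<in>UNIV. (x - p) $ i * C i x v + v $ i * A i x)) (at x)"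
    unfolding F_def by (intro has_derivative_sum has_derivative_mult dA lin)
  have "(\<Sum>i\<in>UNIV. (x - p) $ i * C i x v + v $ i * A i x) = (\<Sum>i\<in>UNIV. \<beta> i x * v $ i)" for v
  proof -
    let ?\<gamma> = "\<lambda>t. p + t *\<^sub>R (x - p)"
    have diff: "\<beta> i differentiable (at (?\<gamma> t))" if "t \<in> {0..1}" for i t
      using smooth_on_differentiable[OF smooth ball_ray[OF x that]] .
    have expand: "dirderiv (\<beta> i) w (?\<gamma> t) = (\<Sum>j\<in>UNIV. w $ j * dirderiv (\<beta> i) (axis j 1) (?\<gamma> t))"
      if "t \<in> {0..1}" for i w t
      using linear_axis_expansion[OF linear_frechet_derivative[OF diff[OF that]], of _ w] by simp
    have swap: "(\<Sum>i\<in>UNIV. w $ i * dirderiv (\<beta> i) v (?\<gamma> t)) = (\<Sum>i\<in>UNIV. v $ i * dirderiv (\<beta> i) w (?\<gamma> t))"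
      if "t \<in> {0..1}" for w t
    proof -
      have "(\<Sum>i\<in>UNIV. w $ i * dirderiv (\<beta> i) v (?\<gamma> t)) =
        (\<Sum>i\<in>UNIV. \<Sum>j\<in>UNIV. w $ i * (v $ j * dirderiv (\<beta> j) (axis i 1) (?\<gamma> t)))"
        using closed[OF ball_ray[OF x that]] by (simp add: expand[OF that, of _ v] sum_distrib_left)
      also have "\<dots> = (\<Sum>j\<in>UNIV. v $ j * dirderiv (\<beta> j) w (?\<gamma> t))"
        by (subst sum.swap) (simp add: expand[OF that, of _ w] sum_distrib_left mult_ac)
      finally show ?thesis .
    qed
    have "((\<lambda>t. \<Sum>i\<in>UNIV. (x - p) $ i * (t ^ Suc 0 * dirderiv (\<beta> i) v (?\<gamma> t)) + v $ i * (t ^ 0 * \<beta> i (?\<gamma> t)))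
      has_integral (\<Sum>i\<in>UNIV. (x - p) $ i * C i x v + v $ i * A i x)) {0..1}"
      unfolding A_def C_def
      by (intro has_integral_sum has_integral_add has_integral_mult_right has_integral_ray[OF _ x] finite
        smooth_on_continuous_on smooth_on_dirderiv smooth)
    moreover have "((\<lambda>t. \<Sum>i\<in>UNIV. v $ i * (t * dirderiv (\<beta> i) (x - p) (?\<gamma> t) + \<beta> i (?\<gamma> t)))
      has_integral (\<Sum>i\<in>UNIV. v $ i * (1 * \<beta> i (?\<gamma> 1) - 0 * \<beta> i (?\<gamma> 0)))) {0..1}"
    proof (intro has_integral_sum has_integral_mult_right finite fundamental_theorem_of_calculus)
      fix i and t :: real assume t: "t \<in> {0..1}"
      have "((\<lambda>t. t) has_vector_derivative 1) (at t within {0..1})"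
        by (auto intro!: derivative_eq_intros)
      from has_vector_derivative_mult[OF this has_vector_derivative_along_ray[OF diff[OF t]]]
      show "((\<lambda>t. t * \<beta> i (?\<gamma> t)) has_vector_derivative t * dirderiv (\<beta> i) (x - p) (?\<gamma> t) + \<beta> i (?\<gamma> t)) (at t within {0..1})"
        by simp
    qed simp
    moreover have "(\<Sum>i\<in>UNIV. (x - p) $ i * (t ^ Suc 0 * dirderiv (\<beta> i) v (?\<gamma> t)) + v $ i * (t ^ 0 * \<beta> i (?\<gamma> t)))
      = (\<Sum>i\<in>UNIV. v $ i * (t * dirderiv (\<beta> i) (x - p) (?\<gamma> t) + \<beta> i (?\<gamma> t)))" if "t \<in> {0..1}" for t
    proof -
      have "(\<Sum>i\<in>UNIV. (x - p) $ i * (t ^ Suc 0 * dirderiv (\<beta> i) v (?\<gamma> t)) + v $ i * (t ^ 0 * \<beta> i (?\<gamma> t)))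
        = t * (\<Sum>i\<in>UNIV. (x - p) $ i * dirderiv (\<beta> i) v (?\<gamma> t)) + (\<Sum>i\<in>UNIV. v $ i * \<beta> i (?\<gamma> t))"
        by (simp add: sum.distrib sum_distrib_left mult_ac del: vector_minus_component)
      then show ?thesis unfolding swap[OF that]
        by (simp add: sum.distrib sum_distrib_left ring_distribs mult_ac)
    qed
    ultimately show ?thesis
      by (subst (asm) has_integral_cong) (auto dest: has_integral_unique simp: mult.commute)
  qed
    then show ?thesis using dF by simp
  qed
  moreover have "F p = 0" by (simp add: F_def)
  ultimately show ?thesis using that by blast
qed

section \<open>Cramer's rule and the smooth inverse function theorem\<close>

lemma Ck_on_det:
  fixes M :: "'a::euclidean_space \<Rightarrow> real ^ 'n::finite ^ 'n"
  assumes "open S" "\<And>i j. Ck_on k S (\<lambda>y. M y $ i $ j)"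
  shows "Ck_on k S (\<lambda>y. det (M y))"
  unfolding det_def
  by (intro Ck_on_sum Ck_on_mult Ck_on_prod Ck_on_const assms)

text \<open>By Cramer's rule the solution is a quotient of determinants. Regularity thus passes from
  the coefficients to a solution about which nothing was known; this serves the derivative of an
  inverse map and, later, the coefficients of a one-form.\<close>

lemma Ck_on_linear_solution:
  fixes M :: "'a::euclidean_space \<Rightarrow> real ^ 'n::finite ^ 'n"
  assumes S: "open S" and M: "\<And>i j. Ck_on k S (\<lambda>y. M y $ i $ j)" and b: "\<And>i. Ck_on k S (\<lambda>y. b y $ i)"
    and eq: "\<And>y. y \<in> S \<Longrightarrow> M y *v x y = b y" and inv: "\<And>y. y \<in> S \<Longrightarrow> det (M y) \<noteq> 0"
  shows "Ck_on k S (\<lambda>y. x y $ l)"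
proof (rule Ck_on_cong[OF S])
  let ?N = "\<lambda>y. \<chi> i j. if j = l then b y $ i else M y $ i $ j"
  show "Ck_on k S (\<lambda>y. det (?N y) * inverse (det (M y)))"
  proof (intro Ck_on_mult Ck_on_inverse Ck_on_det S M inv)
    show "Ck_on k S (\<lambda>y. ?N y $ i $ j)" for i j
      using M b by (cases "j = l") auto
  qed
  fix y assume "y \<in> S"
  then show "det (?N y) * inverse (det (M y)) = x y $ l"
    using cramer[OF inv, of y "x y" "b y"] eq by (simp add: divide_inverse)
qed

text \<open>The derivative of the inverse \<open>g\<close> solves a linear system whose matrix is
  the derivative of \<open>f\<close> at \<open>g y\<close>. If \<open>g\<close> is of class
  \<open>k\<close>, so is this matrix, hence so is the derivative of \<open>g\<close>, and
  \<open>g\<close> gains one order.\<close>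

lemma smooth_inverse_function:
  fixes f :: "real ^ 'n::finite \<Rightarrow> real ^ 'n"
  assumes "open S" "smooth_on S f" "p \<in> S"
    and inj: "\<And>x v. x \<in> S \<Longrightarrow> dirderiv f v x = 0 \<Longrightarrow> v = 0"
  obtains U g where "open U" "U \<subseteq> S" "p \<in> U" "open (f ` U)" "homeomorphism U (f ` U) f g" "smooth_on (f ` U) g"
proof -
  have df: "(f has_derivative frechet_derivative f (at x)) (at x)" if "x \<in> S" for x
    using smooth_on_has_derivative[OF assms(2) that] .
  define f' where "f' x = Blinfun (frechet_derivative f (at x))" for x
  have f': "blinfun_apply (f' x) = frechet_derivative f (at x)" if "x \<in> S" for x
    unfolding f'_def using has_derivative_bounded_linear[OF df[OF that]] by (rule bounded_linear_Blinfun_apply)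
  have "continuous_on S (\<lambda>x. blinfun_apply (f' x) i)" for i
    by (rule continuous_on_eq[OF smooth_on_continuous_on[OF smooth_on_dirderiv[OF assms(2), of i]]]) (simp add: f')
  then have cont: "continuous_on S f'" by (intro continuous_on_blinfun_componentwise)
  have lin: "linear (frechet_derivative f (at x))" if "x \<in> S" for x using has_derivative_linear[OF df[OF that]] .
  have injD: "inj (frechet_derivative f (at x))" if "x \<in> S" for x
    using inj[OF that] linear_injective_0[OF lin[OF that]] by blast
  obtain L where L: "linear L" "L \<circ> frechet_derivative f (at p) = id"
    using linear_injective_left_inverse[OF lin injD] assms(3) by blast
  have bL: "bounded_linear L" using L(1) by (simp add: linear_conv_bounded_linear)
  have Lf: "Blinfun L o\<^sub>L f' p = id_blinfun"
    using fun_cong[OF L(2)] by (intro blinfun_eqI) (simp add: bounded_linear_Blinfun_apply[OF bL] f'[OF assms(3)])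
  have der: "(f has_derivative blinfun_apply (f' x)) (at x)" if "x \<in> S" for x
    using df[OF that] f'[OF that] by simp
  obtain U V g g' where U: "open U" "U \<subseteq> S" "p \<in> U" "open V" and "f p \<in> V" and hom: "homeomorphism U V f g"
    and dg: "\<And>y. y \<in> V \<Longrightarrow> (g has_derivative g' y) (at y)"
    and g': "\<And>y. y \<in> V \<Longrightarrow> g' y = inv_into UNIV (blinfun_apply (f' (g y)))"
      "\<And>y. y \<in> V \<Longrightarrow> bij (blinfun_apply (f' (g y)))"
    by (rule inverse_function_theorem[OF assms(1) der cont assms(3) Lf]) (assumption, rule that)
  have V: "f ` U = V" and gV: "g ` V = U" using hom by (auto simp: homeomorphism_def)
  have gS: "g y \<in> S" if "y \<in> V" for y using gV U(2) that by blast
  have "Ck_on k V g" for k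
  proof (induction k)
    case 0
    then show ?case using hom by (simp add: homeomorphism_def)
  next
    case (Suc k)
    show ?case
    proof (rule Ck_on_SucI[OF U(4) dg])
      fix v
      let ?M = "\<lambda>y. matrix (frechet_derivative f (at (g y)))"
      have "Ck_on k V (\<lambda>y. g' y v $ l)" for l
      proof (rule Ck_on_linear_solution[OF U(4)])
        have "Ck_on k V (dirderiv f (axis j 1) \<circ> g)" for j
          using smooth_on_dirderiv[OF assms(2)] U(1,2) gV Suc
          by (intro Ck_on_compose[OF U(4) assms(1)]) (auto simp: smooth_on_def)
        then show "Ck_on k V (\<lambda>y. ?M y $ i $ j)" for i j
          using Ck_on_vec_lambda_iff[OF U(4), of k "\<lambda>y. dirderiv f (axis j 1) (g y)"]
          by (simp add: matrix_def o_def)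
        fix y assume y: "y \<in> V"
        show "?M y *v g' y v = v"
          using g'[OF y] f'[OF gS[OF y]] by (simp add: matrix_works lin gS y bij_is_surj surj_f_inv_f)
        show "det (?M y) \<noteq> 0"
          using injD[OF gS[OF y]] lin[OF gS[OF y]] det_nz_iff_inj matrix_vector_mul_linear
          by (metis matrix_vector_mul)
      qed (rule Ck_on_const)
      then show "Ck_on k V (\<lambda>y. g' y v)" using Ck_on_vec_lambda_iff[OF U(4)] by blast
    qed
  qed
  then show ?thesis using that[OF U(1-3)] hom U(4) V by (simp add: smooth_on_def)
qed

section \<open>Slices and partial derivatives on a product\<close>

lemma smooth_on_slice:
  fixes F :: "'a::euclidean_space \<times> 'b::euclidean_space \<Rightarrow> real"
  assumes "open S" "smooth_on S F"
  shows "open {x. (x, y) \<in> S}" "smooth_on {x. (x, y) \<in> S} (\<lambda>x. F (x, y))"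
    "open {y. (x, y) \<in> S}" "smooth_on {y. (x, y) \<in> S} (\<lambda>y. F (x, y))"
proof -
  show o: "open {x. (x, y) \<in> S}" "open {y. (x, y) \<in> S}"
    using open_vimage[OF assms(1), of "\<lambda>x. (x, y)"] open_vimage[OF assms(1), of "Pair x"]
    by (simp_all add: vimage_def continuous_on_Pair)
  show "smooth_on {x. (x, y) \<in> S} (\<lambda>x. F (x, y))"
    using smooth_on_compose[OF o(1) assms(1) _ smooth_on_Pair[OF o(1) smooth_on_ident[OF o(1)] smooth_on_const[of _ y]] assms(2)]
    by (auto simp: o_def)
  show "smooth_on {y. (x, y) \<in> S} (\<lambda>y. F (x, y))"
    using smooth_on_compose[OF o(2) assms(1) _ smooth_on_Pair[OF o(2) smooth_on_const[of _ x] smooth_on_ident[OF o(2)]] assms(2)]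
    by (auto simp: o_def)
qed

lemma dirderiv_slice:
  fixes F :: "'a::euclidean_space \<times> 'b::euclidean_space \<Rightarrow> real"
  assumes "F differentiable (at (x, y))"
  shows "dirderiv (\<lambda>x. F (x, y)) u x = dirderiv F (u, 0) (x, y)"
    "dirderiv (\<lambda>y. F (x, y)) w y = dirderiv F (0, w) (x, y)"
proof -
  have d: "(F has_derivative frechet_derivative F (at (x, y))) (at (x, y))"
    using assms frechet_derivative_works by blast
  have "((\<lambda>x. (x, y)) has_derivative (\<lambda>u. (u, 0))) (at x)" "((\<lambda>y. (x, y)) has_derivative (\<lambda>w. (0, w))) (at y)"
    by (auto intro!: derivative_eq_intros)
  from this[THEN has_derivative_compose, OF d, THEN frechet_derivative_at]
  show "dirderiv (\<lambda>x. F (x, y)) u x = dirderiv F (u, 0) (x, y)"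
    "dirderiv (\<lambda>y. F (x, y)) w y = dirderiv F (0, w) (x, y)" by (metis)+
qed


section \<open>Derivations on a manifold\<close>

abbreviation chart_inv :: "('g, 'e) chart \<Rightarrow> 'e \<Rightarrow> 'g" where
  "chart_inv c \<equiv> inv_into (fst c) (snd c)"

lemma is_chartD:
  assumes "is_chart c"
  shows "open (fst c)" "open (snd c ` fst c)" "inj_on (snd c) (fst c)"
    "continuous_on (fst c) (snd c)" "continuous_on (snd c ` fst c) (chart_inv c)"
    "\<And>q. q \<in> fst c \<Longrightarrow> chart_inv c (snd c q) = q"
    "\<And>y. y \<in> snd c ` fst c \<Longrightarrow> chart_inv c y \<in> fst c"
    "\<And>y. y \<in> snd c ` fst c \<Longrightarrow> snd c (chart_inv c y) = y"
proof -
  show "inj_on (snd c) (fst c)"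
    using assms by (auto simp: is_chart_def homeomorphism_def intro: inj_on_inverseI)
qed (use assms in \<open>auto simp: is_chart_def homeomorphism_def inv_into_into f_inv_into_f\<close>)

lemma chart_image_eq:
  assumes "is_chart c"
  shows "snd c ` (fst c \<inter> S) = snd c ` fst c \<inter> chart_inv c -` S"
  using is_chartD[OF assms] by (auto simp: inv_into_into f_inv_into_f)

lemma open_chart_image:
  assumes "is_chart c" "open S"
  shows "open (snd c ` (fst c \<inter> S))"
  unfolding chart_image_eq[OF assms(1)]
  using is_chartD[OF assms(1)] assms(2) by (intro continuous_open_preimage)

lemma chart_inv_image:
  assumes "is_chart c" "V \<subseteq> snd c ` fst c"
  shows "chart_inv c ` V = fst c \<inter> snd c -` V" "snd c ` chart_inv c ` V = V"
proof -
  show "chart_inv c ` V = fst c \<inter> snd c -` V"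
    using is_chartD(6-8)[OF assms(1)] assms(2) by force
  show "snd c ` chart_inv c ` V = V"
    using is_chartD(8)[OF assms(1)] assms(2) by force
qed

lemma open_chart_inv_image:
  assumes "is_chart c" "V \<subseteq> snd c ` fst c" "open V"
  shows "open (chart_inv c ` V)"
  unfolding chart_inv_image(1)[OF assms(1,2)]
  using is_chartD[OF assms(1)] assms(3) by (intro continuous_open_preimage)

locale smooth_manifold =
  fixes M :: "'g::topological_space set" and A :: "('g, real ^ 'n::finite) chart set"
  assumes smooth_atlas: "smooth_atlas M A"
begin

lemma is_chart: "c \<in> A \<Longrightarrow> is_chart c"
  using smooth_atlas by (simp add: smooth_atlas_def)

lemma Union_charts [simp]: "(\<Union>c\<in>A. fst c) = M"
  using smooth_atlas by (simp add: smooth_atlas_def)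

lemma chart_at:
  assumes "p \<in> M"
  obtains c where "c \<in> A" "p \<in> fst c"
  using assms Union_charts by blast

lemma chart_subset: "c \<in> A \<Longrightarrow> fst c \<subseteq> M"
  using Union_charts by blast

lemma open_M: "open M"
  using is_chartD(1)[OF is_chart] by (subst Union_charts[symmetric]) blast

section \<open>Smooth functions and smooth germs\<close>

lemma smooth_fun_on_subset: "smooth_fun_on A S f \<Longrightarrow> T \<subseteq> S \<Longrightarrow> smooth_fun_on A T f"
  unfolding smooth_fun_on_def by (meson Int_mono image_mono order_refl smooth_on_subset)

text \<open>Charts see only points of \<open>M\<close>, so agreement there is enough. This matters
  because functions obtained from forms and fields are uncontrolled outside
  \<open>M\<close>.\<close>

lemma smooth_fun_on_cong:
  assumes "open S" "\<And>q. q \<in> S \<Longrightarrow> q \<in> M \<Longrightarrow> f q = g q" "smooth_fun_on A S f"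
  shows "smooth_fun_on A S g"
  unfolding smooth_fun_on_def
proof
  fix c assume c: "c \<in> A"
  show "smooth_on (snd c ` (fst c \<inter> S)) (g \<circ> chart_inv c)"
    by (rule smooth_on_cong[OF open_chart_image[OF is_chart[OF c] assms(1)], of "f \<circ> chart_inv c"])
      (use c assms is_chartD[OF is_chart[OF c]] chart_subset[OF c] in \<open>auto simp: smooth_fun_on_def\<close>)
qed

lemma smooth_fun_on_const: "smooth_fun_on A S (\<lambda>q. k)"
  by (simp add: smooth_fun_on_def o_def smooth_on_const)

lemma smooth_fun_on_add:
  "open S \<Longrightarrow> smooth_fun_on A S f \<Longrightarrow> smooth_fun_on A S g \<Longrightarrow> smooth_fun_on A S (\<lambda>q. f q + g q)"
  unfolding smooth_fun_on_def o_def by (auto intro!: smooth_on_add open_chart_image is_chart)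

lemma smooth_fun_on_mult:
  "open S \<Longrightarrow> smooth_fun_on A S f \<Longrightarrow> smooth_fun_on A S g \<Longrightarrow> smooth_fun_on A S (\<lambda>q. f q * g q)"
  unfolding smooth_fun_on_def o_def by (auto intro!: smooth_on_mult open_chart_image is_chart)

lemma smooth_fun_on_sum:
  "open S \<Longrightarrow> (\<And>i. i \<in> I \<Longrightarrow> smooth_fun_on A S (f i)) \<Longrightarrow> smooth_fun_on A S (\<lambda>q. \<Sum>i\<in>I. f i q)"
  by (induction I rule: infinite_finite_induct) (auto intro!: smooth_fun_on_add smooth_fun_on_const)

lemma smooth_fun_onI_chart:
  assumes d: "d \<in> A" and S: "open S" "S \<subseteq> fst d" and f: "smooth_on (snd d ` S) (f \<circ> chart_inv d)"
  shows "smooth_fun_on A S f"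
  unfolding smooth_fun_on_def
proof
  fix c assume c: "c \<in> A"
  note C = is_chartD[OF is_chart[OF c]] and D = is_chartD[OF is_chart[OF d]]
  have oc: "open (snd c ` (fst c \<inter> S))" using open_chart_image[OF is_chart[OF c] S(1)] .
  have od: "open (snd d ` S)" using open_chart_image[OF is_chart[OF d] S(1)] S(2) by (simp add: Int_absorb1)
  have "smooth_on (snd c ` (fst c \<inter> fst d)) (snd d \<circ> chart_inv c)"
    using smooth_atlas c d by (simp add: smooth_atlas_def smooth_transition_def)
  then have tr: "smooth_on (snd c ` (fst c \<inter> S)) (snd d \<circ> chart_inv c)"
    using S(2) by (elim smooth_on_subset) auto
  have "smooth_on (snd c ` (fst c \<inter> S)) ((f \<circ> chart_inv d) \<circ> (snd d \<circ> chart_inv c))"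
    by (rule smooth_on_compose[OF oc od _ tr f]) (use C(6) in force)
  then show "smooth_on (snd c ` (fst c \<inter> S)) (f \<circ> chart_inv c)"
    by (rule smooth_on_cong[OF oc, rotated]) (use C(6) D(6) S(2) in force)
qed

lemma smooth_fun_on_coord:
  assumes "d \<in> A"
  shows "smooth_fun_on A (fst d) (\<lambda>q. snd d q $ i)"
proof (rule smooth_fun_onI_chart[OF assms])
  note D = is_chartD[OF is_chart[OF assms]]
  show "smooth_on (snd d ` fst d) ((\<lambda>q. snd d q $ i) \<circ> chart_inv d)"
    by (rule smooth_on_cong[OF D(2) _ smooth_on_bounded_linear[OF D(2) bounded_linear_vec_nth[of i]]])
      (use D in auto)
  show "open (fst d)" by (rule D(1))
qed simp

lemma smooth_fun_on_in_chart:
  assumes "d \<in> A" "V \<subseteq> snd d ` fst d" "smooth_fun_on A (chart_inv d ` V) f"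
  shows "smooth_on V (f \<circ> chart_inv d)"
proof -
  have "chart_inv d ` V \<subseteq> fst d" using chart_inv_image(1)[OF is_chart[OF assms(1)] assms(2)] by auto
  then have "snd d ` (fst d \<inter> chart_inv d ` V) = V"
    using chart_inv_image(2)[OF is_chart[OF assms(1)] assms(2)] by (simp add: Int_absorb1)
  then show ?thesis using assms(1,3) unfolding smooth_fun_on_def by metis
qed

lemma smooth_nearI: "open S \<Longrightarrow> p \<in> S \<Longrightarrow> smooth_fun_on A S f \<Longrightarrow> smooth_near A p f"
  unfolding smooth_near_def by blast

lemma smooth_near_cong:
  assumes "smooth_near A p f" "open S" "p \<in> S" "\<And>q. q \<in> S \<Longrightarrow> q \<in> M \<Longrightarrow> f q = g q"
  shows "smooth_near A p g"
proof -
  obtain T where T: "open T" "p \<in> T" "smooth_fun_on A T f" using assms(1) unfolding smooth_near_def by blast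
  have "smooth_fun_on A (S \<inter> T) g"
    by (rule smooth_fun_on_cong[OF _ _ smooth_fun_on_subset[OF T(3) Int_lower2]])
      (use assms(2,4) T(1) in auto)
  then show ?thesis using smooth_nearI[of "S \<inter> T"] assms(2,3) T by blast
qed

lemma smooth_near_const: "smooth_near A p (\<lambda>q. k)"
  by (rule smooth_nearI[of UNIV]) (auto simp: smooth_fun_on_const)

lemma smooth_near_both:
  assumes "smooth_near A p f" "smooth_near A p g"
  obtains S where "open S" "p \<in> S" "smooth_fun_on A S f" "smooth_fun_on A S g"
proof -
  obtain S T where ST: "open S" "p \<in> S" "smooth_fun_on A S f" "open T" "p \<in> T" "smooth_fun_on A T g"
    using assms unfolding smooth_near_def by blast
  show ?thesis
    using that[OF _ _ smooth_fun_on_subset[OF ST(3) Int_lower1] smooth_fun_on_subset[OF ST(6) Int_lower2]] ST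
    by auto
qed

lemma smooth_near_add:
  assumes "smooth_near A p f" "smooth_near A p g"
  shows "smooth_near A p (\<lambda>q. f q + g q)"
  using smooth_near_both[OF assms] by (metis smooth_nearI smooth_fun_on_add)

lemma smooth_near_mult:
  assumes "smooth_near A p f" "smooth_near A p g"
  shows "smooth_near A p (\<lambda>q. f q * g q)"
  using smooth_near_both[OF assms] by (metis smooth_nearI smooth_fun_on_mult)

lemma smooth_near_sum:
  "(\<And>i. i \<in> I \<Longrightarrow> smooth_near A p (f i)) \<Longrightarrow> smooth_near A p (\<lambda>q. \<Sum>i\<in>I. f i q)"
  by (induction I rule: infinite_finite_induct) (auto intro!: smooth_near_add smooth_near_const)

lemma smooth_near_coord: "d \<in> A \<Longrightarrow> p \<in> fst d \<Longrightarrow> smooth_near A p (\<lambda>q. snd d q $ i)"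
  using smooth_nearI[OF is_chartD(1)[OF is_chart] _ smooth_fun_on_coord] by blast

lemma smooth_near_ball:
  assumes "d \<in> A" "p \<in> fst d" "smooth_near A p f"
  obtains r where "r > 0" "ball (snd d p) r \<subseteq> snd d ` fst d" "smooth_on (ball (snd d p) r) (f \<circ> chart_inv d)"
proof -
  obtain S where S: "open S" "p \<in> S" "smooth_fun_on A S f" using assms(3) unfolding smooth_near_def by blast
  have "open (snd d ` (fst d \<inter> S))" by (rule open_chart_image[OF is_chart[OF assms(1)] S(1)])
  then obtain r where r: "r > 0" "ball (snd d p) r \<subseteq> snd d ` (fst d \<inter> S)"
    using assms(2) S(2) openE by (metis IntI image_eqI)
  then show ?thesis
    using S(3) assms(1) by (intro that[of r]) (auto simp: smooth_fun_on_def intro: smooth_on_subset)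
qed

lemma smooth_near_has_derivative:
  assumes "d \<in> A" "p \<in> fst d" "smooth_near A p f"
  shows "((f \<circ> chart_inv d) has_derivative frechet_derivative (f \<circ> chart_inv d) (at (snd d p))) (at (snd d p))"
  using smooth_near_ball[OF assms] smooth_on_has_derivative by (metis centre_in_ball)

section \<open>Tangent vectors as derivations\<close>

lemma tangent_add:
  "v \<in> tangent_space A p \<Longrightarrow> smooth_near A p f \<Longrightarrow> smooth_near A p g \<Longrightarrow> v (\<lambda>q. f q + g q) = v f + v g"
  by (simp add: tangent_space_def)

lemma tangent_mult:
  "v \<in> tangent_space A p \<Longrightarrow> smooth_near A p f \<Longrightarrow> smooth_near A p g \<Longrightarrow>
    v (\<lambda>q. f q * g q) = f p * v g + g p * v f"
  by (simp add: tangent_space_def)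

lemma tangent_scale:
  "v \<in> tangent_space A p \<Longrightarrow> smooth_near A p f \<Longrightarrow> v (\<lambda>q. c * f q) = c * v f"
  by (simp add: tangent_space_def)

lemma tangent_not_smooth: "v \<in> tangent_space A p \<Longrightarrow> \<not> smooth_near A p f \<Longrightarrow> v f = 0"
  by (simp add: tangent_space_def)

lemma tangent_const:
  assumes "v \<in> tangent_space A p"
  shows "v (\<lambda>q. k) = 0"
  using tangent_mult[OF assms smooth_near_const[of p 1] smooth_near_const[of p 1]]
    tangent_scale[OF assms smooth_near_const[of p 1], of k] by simp

lemma tangent_sum:
  assumes "v \<in> tangent_space A p" "\<And>i. i \<in> I \<Longrightarrow> smooth_near A p (f i)"
  shows "v (\<lambda>q. \<Sum>i\<in>I. f i q) = (\<Sum>i\<in>I. v (f i))"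
  using assms(2)
  by (induction I rule: infinite_finite_induct)
    (auto simp: tangent_const[OF assms(1)] tangent_add[OF assms(1)] smooth_near_sum)

text \<open>Multiplying by the indicator function of the complement of a neighbourhood replaces bump functions.\<close>

lemma tangent_cong:
  assumes v: "v \<in> tangent_space A p" and "p \<in> M" and S: "open S" "p \<in> S" "\<And>q. q \<in> S \<Longrightarrow> q \<in> M \<Longrightarrow> f q = g q"
  shows "v f = v g"
proof (cases "smooth_near A p f")
  case True
  then have g: "smooth_near A p g" by (rule smooth_near_cong[OF _ S])
  define h where "h q = f q + (-1) * g q" for q
  define u :: "'g \<Rightarrow> real" where "u = indicator (- (S \<inter> M))"
  have h: "smooth_near A p h"
    unfolding h_def by (intro smooth_near_add smooth_near_mult smooth_near_const True g)
  have u: "smooth_near A p u"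
    by (rule smooth_near_cong[OF smooth_near_const[of p 0], of "S \<inter> M"])
      (use S \<open>p \<in> M\<close> open_M in \<open>auto simp: u_def\<close>)
  \<comment> \<open>The difference \<open>h\<close> vanishes where \<open>u\<close> is not 1, so
    \<open>h\<close> absorbs \<open>u\<close> everywhere; at \<open>p\<close> both factors vanish,
    and the Leibniz rule gives 0.\<close>
  have "h = (\<lambda>q. u q * h q)" by (auto simp: fun_eq_iff u_def h_def indicator_def S(3))
  then have "v h = v (\<lambda>q. u q * h q)" by simp
  also have "\<dots> = 0"
    using tangent_mult[OF v u h] S \<open>p \<in> M\<close> by (simp add: u_def h_def)
  finally have "v f + (-1) * v g = 0"
    unfolding h_def using tangent_add[OF v True smooth_near_mult[OF smooth_near_const[of p "-1"] g]]
      tangent_scale[OF v g, of "-1"] by simp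
  then show ?thesis by simp
next
  case False
  then have "\<not> smooth_near A p g" using smooth_near_cong[of p g S f] S by fastforce
  with False show ?thesis by (simp add: tangent_not_smooth[OF v])
qed

lemma tangent_eqI:
  assumes "v \<in> tangent_space A p" "w \<in> tangent_space A p" "\<And>f. smooth_near A p f \<Longrightarrow> v f = w f"
  shows "v = w"
  using assms tangent_not_smooth by (metis ext)

lemma tangent_lincomb:
  assumes "v \<in> tangent_space A p" "w \<in> tangent_space A p"
  shows "(\<lambda>f. a * v f + b * w f) \<in> tangent_space A p"
  using assms by (auto simp: tangent_space_def algebra_simps)

lemma tangent_plus:
  "v \<in> tangent_space A p \<Longrightarrow> w \<in> tangent_space A p \<Longrightarrow> (\<lambda>f. v f + w f) \<in> tangent_space A p"
  using tangent_lincomb[of v p w 1 1] by simp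

lemma tangent_times: "v \<in> tangent_space A p \<Longrightarrow> (\<lambda>f. a * v f) \<in> tangent_space A p"
  using tangent_lincomb[of v p v a 0] by simp

lemma tangent_zero: "(\<lambda>f. 0) \<in> tangent_space A p"
  by (auto simp: tangent_space_def)

definition coords :: "('g, real ^ 'n) chart \<Rightarrow> 'g tvec \<Rightarrow> real ^ 'n" where
  "coords d v = (\<chi> i. v (\<lambda>q. snd d q $ i))"

text \<open>The coefficient functions in Hadamard's lemma are smooth, so a derivation can be applied to them.\<close>

lemma tangent_eq_dirderiv:
  assumes v: "v \<in> tangent_space A p" and d: "d \<in> A" "p \<in> fst d" and f: "smooth_near A p f"
  shows "v f = dirderiv (f \<circ> chart_inv d) (coords d v) (snd d p)"
proof -
  note D = is_chartD[OF is_chart[OF d(1)]]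
  obtain r where r: "r > 0" "ball (snd d p) r \<subseteq> snd d ` fst d" "smooth_on (ball (snd d p) r) (f \<circ> chart_inv d)"
    using smooth_near_ball[OF d f] .
  let ?B = "ball (snd d p) r"
  obtain g where g: "\<And>i. smooth_on ?B (g i)"
    "\<And>x. x \<in> ?B \<Longrightarrow> (f \<circ> chart_inv d) x = (f \<circ> chart_inv d) (snd d p) + (\<Sum>i\<in>UNIV. (x - snd d p) $ i * g i x)"
    "\<And>i. g i (snd d p) = dirderiv (f \<circ> chart_inv d) (axis i 1) (snd d p)"
    using Hadamard[OF r(3,1)] by blast
  let ?T = "chart_inv d ` ?B"
  have T: "open ?T" "?T \<subseteq> fst d" "p \<in> ?T"
    using open_chart_inv_image[OF is_chart[OF d(1)] r(2)] chart_inv_image[OF is_chart[OF d(1)] r(2)] r(1) d(2) by auto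
  have inB: "snd d q \<in> ?B" if "q \<in> ?T" for q
    using that chart_inv_image(1)[OF is_chart[OF d(1)] r(2)] by auto
  have G: "smooth_near A p (\<lambda>q. g i (snd d q))" for i
  proof (rule smooth_nearI[OF T(1,3)], rule smooth_fun_onI_chart[OF d(1) T(1,2)])
    show "smooth_on (snd d ` ?T) ((\<lambda>q. g i (snd d q)) \<circ> chart_inv d)"
      unfolding chart_inv_image(2)[OF is_chart[OF d(1)] r(2)]
      by (rule smooth_on_cong[OF open_ball _ g(1)[of i]]) (use r(2) D(8) in \<open>auto simp: subset_eq simp del: mem_ball\<close>)
  qed
  \<comment> \<open>The coordinates are centred at \<open>p\<close>, so that the Leibniz rule leaves
    only the terms in which \<open>v\<close> differentiates \<open>X i\<close>.\<close>
  define X where "X i q = snd d q $ i + (- (snd d p $ i))" for i q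
  have X: "smooth_near A p (X i)" for i
    unfolding X_def by (intro smooth_near_add smooth_near_coord d smooth_near_const)
  have vX: "v (X i) = v (\<lambda>q. snd d q $ i)" for i
    unfolding X_def using tangent_add[OF v smooth_near_coord[OF d] smooth_near_const, of i "- (snd d p $ i)"]
      tangent_const[OF v, of "- (snd d p $ i)"] by linarith
  have "v f = v (\<lambda>q. f p + (\<Sum>i\<in>UNIV. X i q * g i (snd d q)))"
  proof (rule tangent_cong[OF v _ T(1,3)])
    fix q assume q: "q \<in> ?T"
    then have "chart_inv d (snd d q) = q" using T(2) D(6) by blast
    then show "f q = f p + (\<Sum>i\<in>UNIV. X i q * g i (snd d q))"
      using g(2)[OF inB[OF q]] D(6)[OF d(2)] by (simp add: X_def)
  qed (use chart_subset[OF d(1)] d(2) in blast)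
  also have "\<dots> = (\<Sum>i\<in>UNIV. v (\<lambda>q. X i q * g i (snd d q)))"
    using tangent_add[OF v smooth_near_const smooth_near_sum[OF smooth_near_mult[OF X G]]]
    by (simp add: tangent_const[OF v] tangent_sum[OF v smooth_near_mult[OF X G]])
  also have "\<dots> = (\<Sum>i\<in>UNIV. g i (snd d p) * v (\<lambda>q. snd d q $ i))"
    by (simp add: tangent_mult[OF v X G] vX) (simp add: X_def)
  also have "\<dots> = dirderiv (f \<circ> chart_inv d) (coords d v) (snd d p)"
    using linear_axis_expansion[OF has_derivative_linear[OF smooth_near_has_derivative[OF d f]], of "coords d v"]
    by (simp add: g(3) coords_def mult.commute)
  finally show ?thesis .
qed

text \<open>For \<open>\<xi> = axis l 1\<close> this is the coordinate vector number
  \<open>l\<close> of the chart at \<open>p\<close>; in general it inverts \<open>coords d\<close>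
  on the tangent space.\<close>

definition chart_vector :: "('g, real ^ 'n) chart \<Rightarrow> 'g \<Rightarrow> real ^ 'n \<Rightarrow> 'g tvec" where
  "chart_vector d p \<xi> = (\<lambda>f. if smooth_near A p f then dirderiv (f \<circ> chart_inv d) \<xi> (snd d p) else 0)"

lemma chart_vector_tangent:
  assumes d: "d \<in> A" "p \<in> fst d"
  shows "chart_vector d p \<xi> \<in> tangent_space A p"
proof -
  note D = smooth_near_has_derivative[OF d]
  have p: "chart_inv d (snd d p) = p" using is_chartD(6)[OF is_chart[OF d(1)] d(2)] .
  have "dirderiv ((\<lambda>q. f q + g q) \<circ> chart_inv d) \<xi> (snd d p) =
      dirderiv (f \<circ> chart_inv d) \<xi> (snd d p) + dirderiv (g \<circ> chart_inv d) \<xi> (snd d p)"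
    if "smooth_near A p f" "smooth_near A p g" for f g
    using frechet_derivative_at[OF has_derivative_add[OF D[OF that(1)] D[OF that(2)]]]
    by (simp add: o_def fun_eq_iff)
  moreover have "dirderiv ((\<lambda>q. f q * g q) \<circ> chart_inv d) \<xi> (snd d p) =
      f p * dirderiv (g \<circ> chart_inv d) \<xi> (snd d p) + g p * dirderiv (f \<circ> chart_inv d) \<xi> (snd d p)"
    if "smooth_near A p f" "smooth_near A p g" for f g
    using frechet_derivative_at[OF has_derivative_mult[OF D[OF that(1)] D[OF that(2)]]]
    by (simp add: o_def fun_eq_iff p mult.commute)
  moreover have "dirderiv ((\<lambda>q. c * f q) \<circ> chart_inv d) \<xi> (snd d p) = c * dirderiv (f \<circ> chart_inv d) \<xi> (snd d p)"
    if "smooth_near A p f" for f c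
    using frechet_derivative_at[OF has_derivative_mult_right[OF D[OF that], of c]]
    by (simp add: o_def fun_eq_iff)
  moreover have "smooth_near A p (\<lambda>q. c * f q)" if "smooth_near A p f" for f c
    using smooth_near_mult[OF smooth_near_const that] .
  ultimately show ?thesis
    by (auto simp: tangent_space_def chart_vector_def smooth_near_add smooth_near_mult)
qed

lemma coords_chart_vector:
  assumes d: "d \<in> A" "p \<in> fst d"
  shows "coords d (chart_vector d p \<xi>) = \<xi>"
proof -
  note D = is_chartD[OF is_chart[OF d(1)]]
  have "((\<lambda>q. snd d q $ i) \<circ> chart_inv d has_derivative (\<lambda>v. v $ i)) (at (snd d p))" for i
    by (rule has_derivative_transform_within_open[OF bounded_linear_imp_has_derivative[OF bounded_linear_vec_nth] D(2)])
      (use D(8) d in auto)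
  from frechet_derivative_at[OF this, symmetric] show ?thesis
    by (simp add: coords_def chart_vector_def smooth_near_coord[OF d])
qed

lemma tangent_eq_chart_vector:
  assumes v: "v \<in> tangent_space A p" and d: "d \<in> A" "p \<in> fst d"
  shows "v = chart_vector d p (coords d v)"
  using tangent_eq_dirderiv[OF v d] tangent_not_smooth[OF v] by (auto simp: chart_vector_def)

lemma chart_vector_linear:
  assumes d: "d \<in> A" "p \<in> fst d"
  shows "chart_vector d p (a *\<^sub>R \<xi> + b *\<^sub>R \<eta>) f = a * chart_vector d p \<xi> f + b * chart_vector d p \<eta> f"
  using has_derivative_linear[OF smooth_near_has_derivative[OF d]]
  by (auto simp: chart_vector_def linear_add linear_scale)

lemma constant_if_derivations_vanish:
  assumes d: "d \<in> A" and V: "V \<subseteq> snd d ` fst d" "open V" "convex V"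
    and f: "smooth_fun_on A (chart_inv d ` V) f"
    and zero: "\<And>q v. q \<in> chart_inv d ` V \<Longrightarrow> v \<in> tangent_space A q \<Longrightarrow> v f = 0"
    and pq: "p \<in> chart_inv d ` V" "q \<in> chart_inv d ` V"
  shows "f p = f q"
proof -
  note D = is_chartD[OF is_chart[OF d]]
  have "((f \<circ> chart_inv d) has_derivative (\<lambda>v. 0)) (at y within V)" if y: "y \<in> V" for y
  proof -
    let ?q = "chart_inv d y"
    have q: "?q \<in> fst d" "snd d ?q = y" "?q \<in> chart_inv d ` V" using y V(1) D(7,8) by auto
    have n: "smooth_near A ?q f"
      by (rule smooth_nearI[OF open_chart_inv_image[OF is_chart[OF d] V(1,2)] q(3) f])
    have "frechet_derivative (f \<circ> chart_inv d) (at y) = (\<lambda>v. 0)"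
      using zero[OF q(3) chart_vector_tangent[OF d q(1)]] n q(2) by (simp add: chart_vector_def fun_eq_iff)
    then show ?thesis using smooth_near_has_derivative[OF d q(1) n] q(2) by (simp add: has_derivative_at_withinI)
  qed
  from has_derivative_zero_constant[OF V(3) this]
  obtain c where "\<And>y. y \<in> V \<Longrightarrow> (f \<circ> chart_inv d) y = c" by blast
  then show ?thesis using pq by auto
qed

section \<open>Vector fields and their brackets\<close>

lemma vector_field_tangent: "vector_field A X \<Longrightarrow> p \<in> M \<Longrightarrow> X p \<in> tangent_space A p"
  by (simp add: vector_field_def)

lemma vector_field_smooth_near:
  assumes "vector_field A X" "p \<in> M" "smooth_near A p f"
  shows "smooth_near A p (\<lambda>q. X q f)"
proof -
  obtain S where S: "open S" "p \<in> S" "smooth_fun_on A S f" using assms(3) unfolding smooth_near_def by blast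
  then have "smooth_fun_on A (S \<inter> M) (\<lambda>q. X q f)"
    using assms(1) smooth_fun_on_subset[OF S(3) Int_lower1[of S M]] open_M by (simp add: vector_field_def open_Int)
  then show ?thesis using S assms(2) open_M by (intro smooth_nearI[of "S \<inter> M"]) auto
qed

text \<open>In the second derivative of a product the mixed terms, one first derivative of each
  factor, are symmetric in the two fields and cancel in the commutator.\<close>

lemma lie_bracket_tangent:
  assumes X: "vector_field A X" and Y: "vector_field A Y" and p: "p \<in> M"
  shows "lie_bracket A X Y p \<in> tangent_space A p"
proof -
  \<comment> \<open>Additivity of \<open>Y q\<close> is available only near \<open>p\<close>, where
    both functions are smooth; hence the passage through \<open>tangent_cong\<close>.\<close>
  have add: "X p (\<lambda>q. Y q (\<lambda>r. f r + g r)) = X p (\<lambda>q. Y q f) + X p (\<lambda>q. Y q g)"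
    if X: "vector_field A X" and Y: "vector_field A Y" and f: "smooth_near A p f" and g: "smooth_near A p g" for X Y f g
  proof -
    obtain S where S: "open S" "p \<in> S" "smooth_fun_on A S f" "smooth_fun_on A S g" using smooth_near_both[OF f g] .
    have "X p (\<lambda>q. Y q (\<lambda>r. f r + g r)) = X p (\<lambda>q. Y q f + Y q g)"
      by (rule tangent_cong[OF vector_field_tangent[OF X p] p S(1,2)])
        (intro tangent_add[OF vector_field_tangent[OF Y]] smooth_nearI[OF S(1) _ S(3)] smooth_nearI[OF S(1) _ S(4)]; assumption)
    then show ?thesis
      using tangent_add[OF vector_field_tangent[OF X p] vector_field_smooth_near[OF Y p f] vector_field_smooth_near[OF Y p g]]
      by simp
  qed
  have mult: "X p (\<lambda>q. Y q (\<lambda>r. f r * g r)) =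
      f p * X p (\<lambda>q. Y q g) + Y p g * X p f + (g p * X p (\<lambda>q. Y q f) + Y p f * X p g)"
    if X: "vector_field A X" and Y: "vector_field A Y" and f: "smooth_near A p f" and g: "smooth_near A p g" for X Y f g
  proof -
    obtain S where S: "open S" "p \<in> S" "smooth_fun_on A S f" "smooth_fun_on A S g" using smooth_near_both[OF f g] .
    have "X p (\<lambda>q. Y q (\<lambda>r. f r * g r)) = X p (\<lambda>q. f q * Y q g + g q * Y q f)"
      by (rule tangent_cong[OF vector_field_tangent[OF X p] p S(1,2)])
        (intro tangent_mult[OF vector_field_tangent[OF Y]] smooth_nearI[OF S(1) _ S(3)] smooth_nearI[OF S(1) _ S(4)]; assumption)
    also have "\<dots> = X p (\<lambda>q. f q * Y q g) + X p (\<lambda>q. g q * Y q f)"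
      by (intro tangent_add[OF vector_field_tangent[OF X p]] smooth_near_mult f g vector_field_smooth_near[OF Y p])
    finally show ?thesis
      using tangent_mult[OF vector_field_tangent[OF X p] f vector_field_smooth_near[OF Y p g]]
        tangent_mult[OF vector_field_tangent[OF X p] g vector_field_smooth_near[OF Y p f]] by simp
  qed
  have scale: "X p (\<lambda>q. Y q (\<lambda>r. c * f r)) = c * X p (\<lambda>q. Y q f)"
    if X: "vector_field A X" and Y: "vector_field A Y" and f: "smooth_near A p f" for X Y f c
    using mult[OF X Y smooth_near_const[of p c] f] tangent_const[OF vector_field_tangent[OF X p]]
      tangent_const[OF vector_field_tangent[OF Y p]]
      tangent_cong[OF vector_field_tangent[OF X p] p open_M p, of "\<lambda>q. Y q (\<lambda>r. c)" "\<lambda>q. 0"]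
      tangent_const[OF vector_field_tangent[OF Y]] by simp
  show ?thesis
    unfolding tangent_space_def lie_bracket_def
    by (auto simp: add[OF X Y] add[OF Y X] mult[OF X Y] mult[OF Y X] scale[OF X Y] scale[OF Y X]
        smooth_near_add smooth_near_mult smooth_near_mult[OF smooth_near_const] algebra_simps)
qed

lemma vector_field_add:
  assumes "vector_field A V" "vector_field A W"
  shows "vector_field A (\<lambda>q f. V q f + W q f)"
  using assms by (auto simp: vector_field_def intro!: tangent_plus smooth_fun_on_add)

lemma vector_field_mult:
  assumes "smooth_fun_on A M h" "vector_field A V"
  shows "vector_field A (\<lambda>q f. h q * V q f)"
  using assms smooth_fun_on_subset[OF assms(1)]
  by (auto simp: vector_field_def intro!: tangent_times smooth_fun_on_mult)

lemma vector_field_zero: "vector_field A (\<lambda>q f. 0)"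
  by (simp add: vector_field_def tangent_zero smooth_fun_on_const)

lemma vector_field_sum:
  "(\<And>i. i \<in> I \<Longrightarrow> vector_field A (V i)) \<Longrightarrow> vector_field A (\<lambda>q f. \<Sum>i\<in>I. V i q f)"
  by (induction I rule: infinite_finite_induct) (simp_all add: vector_field_zero vector_field_add)

end


section \<open>Invariant vector fields on a Lie group\<close>

locale real_lie_group =
  fixes G :: "('g::{t2_space, second_countable_topology}, 'n::finite) lie_struct" (structure)
  assumes lie_group: "lie_group G"
begin

sublocale group G
  using lie_group by (simp add: lie_group_def)

sublocale smooth_manifold "carrier G" "atlas G"
  using lie_group by unfold_locales (simp add: lie_group_def)

section \<open>The multiplication in charts\<close>

lemma smooth_mult: "smooth_map (prod_atlas (atlas G) (atlas G)) (atlas G) (\<lambda>(a, b). a \<otimes> b)"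
  using lie_group by (simp add: lie_group_def)

lemma prod_atlasI:
  "c \<in> \<C> \<Longrightarrow> d \<in> \<D> \<Longrightarrow> (fst c \<times> fst d, map_prod (snd c) (snd d)) \<in> prod_atlas \<C> \<D>"
  unfolding prod_atlas_def by blast

lemma continuous_mult: "continuous_on (carrier G \<times> carrier G) (\<lambda>(a, b). a \<otimes> b)"
proof -
  have "(\<Union>c\<in>prod_atlas (atlas G) (atlas G). fst c) = carrier G \<times> carrier G"
  proof (intro equalityI subsetI)
    fix z assume "z \<in> carrier G \<times> carrier G"
    then have "fst z \<in> carrier G" "snd z \<in> carrier G" by auto
    then obtain c d where "c \<in> atlas G" "fst z \<in> fst c" "d \<in> atlas G" "snd z \<in> fst d"
      using chart_at by metis
    then show "z \<in> (\<Union>c\<in>prod_atlas (atlas G) (atlas G). fst c)"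
      by (intro UN_I[OF prod_atlasI]) (auto simp: mem_Times_iff)
  next
    fix z assume "z \<in> (\<Union>c\<in>prod_atlas (atlas G) (atlas G). fst c)"
    then obtain c d where "c \<in> atlas G" "d \<in> atlas G" "z \<in> fst c \<times> fst d"
      unfolding prod_atlas_def by fastforce
    then show "z \<in> carrier G \<times> carrier G" using chart_subset by blast
  qed
  then show ?thesis using smooth_mult by (simp add: smooth_map_def)
qed

definition mult_dom :: "('g, real ^ 'n) chart \<Rightarrow> ('g, real ^ 'n) chart \<Rightarrow> 'g set \<Rightarrow> ((real ^ 'n) \<times> (real ^ 'n)) set" where
  "mult_dom c d S = {z \<in> snd c ` fst c \<times> snd d ` fst d. chart_inv c (fst z) \<otimes> chart_inv d (snd z) \<in> S}"

text \<open>This is \<open>f\<close> composed with the product, read in one chart for each factor.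
  Translations are slices of it and invariant fields are its partial derivatives along a slice, so
  the smoothness of all of them follows from that of this one function.\<close>

definition mult_rep :: "('g, real ^ 'n) chart \<Rightarrow> ('g, real ^ 'n) chart \<Rightarrow> ('g \<Rightarrow> real) \<Rightarrow> (real ^ 'n) \<times> (real ^ 'n) \<Rightarrow> real" where
  "mult_rep c d f z = f (chart_inv c (fst z) \<otimes> chart_inv d (snd z))"

lemma open_mult_dom:
  assumes "c \<in> atlas G" "d \<in> atlas G" "open S"
  shows "open (mult_dom c d S)"
proof -
  note C = is_chartD[OF is_chart[OF assms(1)]] and D = is_chartD[OF is_chart[OF assms(2)]]
  let ?P = "snd c ` fst c \<times> snd d ` fst d"
  have "continuous_on ?P (\<lambda>z. (chart_inv c (fst z), chart_inv d (snd z)))"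
    by (intro continuous_on_Pair continuous_on_compose2[OF C(5)] continuous_on_compose2[OF D(5)] continuous_intros) auto
  moreover have "(\<lambda>z. (chart_inv c (fst z), chart_inv d (snd z))) ` ?P \<subseteq> carrier G \<times> carrier G"
    using C(7) D(7) chart_subset[OF assms(1)] chart_subset[OF assms(2)] by (auto simp del: inv_into_into)
  ultimately have "continuous_on ?P (\<lambda>z. case (chart_inv c (fst z), chart_inv d (snd z)) of (a, b) \<Rightarrow> a \<otimes> b)"
    by (rule continuous_on_compose2[OF continuous_mult])
  from continuous_open_preimage[OF this open_Times[OF C(2) D(2)] assms(3)]
  have "open (?P \<inter> (\<lambda>z. chart_inv c (fst z) \<otimes> chart_inv d (snd z)) -` S)" by (simp only: prod.case)
  also have "?P \<inter> (\<lambda>z. chart_inv c (fst z) \<otimes> chart_inv d (snd z)) -` S = mult_dom c d S"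
    unfolding mult_dom_def by blast
  finally show ?thesis .
qed

lemma mult_domD:
  assumes "c \<in> atlas G" "d \<in> atlas G" "z \<in> mult_dom c d S"
  shows "fst z \<in> snd c ` fst c" "snd z \<in> snd d ` fst d"
    "chart_inv c (fst z) \<in> fst c" "chart_inv d (snd z) \<in> fst d"
    "chart_inv c (fst z) \<in> carrier G" "chart_inv d (snd z) \<in> carrier G"
    "chart_inv c (fst z) \<otimes> chart_inv d (snd z) \<in> S"
    "snd c (chart_inv c (fst z)) = fst z" "snd d (chart_inv d (snd z)) = snd z"
proof -
  show 1: "fst z \<in> snd c ` fst c" "snd z \<in> snd d ` fst d" "chart_inv c (fst z) \<otimes> chart_inv d (snd z) \<in> S"
    using assms(3) by (simp_all add: mult_dom_def mem_Times_iff)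
  show 2: "chart_inv c (fst z) \<in> fst c" "chart_inv d (snd z) \<in> fst d"
    using 1 is_chartD(7)[OF is_chart] assms by blast+
  show "chart_inv c (fst z) \<in> carrier G" "chart_inv d (snd z) \<in> carrier G"
    using 2 chart_subset assms by blast+
  show "snd c (chart_inv c (fst z)) = fst z" "snd d (chart_inv d (snd z)) = snd z"
    using 1 by (simp_all only: f_inv_into_f)
qed

lemma smooth_mult_rep:
  assumes c: "c \<in> atlas G" and d: "d \<in> atlas G" and S: "open S" and f: "smooth_fun_on (atlas G) S f"
  shows "smooth_on (mult_dom c d S) (mult_rep c d f)"
proof (rule smooth_on_local)
  fix z assume z: "z \<in> mult_dom c d S"
  note C = is_chartD[OF is_chart[OF c]] and D = is_chartD[OF is_chart[OF d]]
  let ?\<mu> = "\<lambda>(a, b). a \<otimes> b"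
  let ?P = "map_prod (snd c) (snd d)" and ?Q = "fst c \<times> fst d"
  have "chart_inv c (fst z) \<otimes> chart_inv d (snd z) \<in> carrier G"
    using mult_domD[OF c d z] by simp
  \<comment> \<open>The products need not all lie in one chart domain, so the target chart is chosen
    for the given point and smoothness is shown near that point only.\<close>
  then obtain e where e: "e \<in> atlas G" "chart_inv c (fst z) \<otimes> chart_inv d (snd z) \<in> fst e" by (rule chart_at)
  note E = is_chartD[OF is_chart[OF e(1)]]
  let ?T = "mult_dom c d (S \<inter> fst e)"
  have oT: "open ?T" using open_mult_dom c d S E(1) by blast
  have inj: "inj_on ?P ?Q" by (rule map_prod_inj_on[OF C(3) D(3)])
  have inv: "inv_into ?Q ?P (x, y) = (chart_inv c x, chart_inv d y)" if "x \<in> snd c ` fst c" "y \<in> snd d ` fst d" for x y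
    using C(7,8) D(7,8) that by (intro inv_into_f_eq[OF inj]) auto
  have "(?Q, ?P) \<in> prod_atlas (atlas G) (atlas G)" by (rule prod_atlasI[OF c d])
  then have "smooth_on (?P ` (?Q \<inter> ?\<mu> -` fst e)) (snd e \<circ> ?\<mu> \<circ> inv_into ?Q ?P)"
    using smooth_mult e(1) unfolding smooth_map_def by fastforce
  moreover have "?T \<subseteq> ?P ` (?Q \<inter> ?\<mu> -` fst e)"
  proof
    fix w assume w: "w \<in> ?T"
    then have "w = ?P (chart_inv c (fst w), chart_inv d (snd w))"
      using mult_domD[OF c d w] by (simp add: prod_eq_iff)
    moreover have "(chart_inv c (fst w), chart_inv d (snd w)) \<in> ?Q \<inter> ?\<mu> -` fst e"
      using mult_domD[OF c d w] by simp
    ultimately show "w \<in> ?P ` (?Q \<inter> ?\<mu> -` fst e)" by blast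
  qed
  ultimately have 1: "smooth_on ?T (snd e \<circ> ?\<mu> \<circ> inv_into ?Q ?P)" by (rule smooth_on_subset)
  have 2: "(snd e \<circ> ?\<mu> \<circ> inv_into ?Q ?P) ` ?T \<subseteq> snd e ` (fst e \<inter> S)"
  proof (rule image_subsetI)
    fix w assume "w \<in> ?T"
    note w = mult_domD[OF c d this]
    show "(snd e \<circ> ?\<mu> \<circ> inv_into ?Q ?P) w \<in> snd e ` (fst e \<inter> S)"
      using inv[OF w(1,2)] w(7) by simp
  qed
  have "smooth_on ?T ((f \<circ> chart_inv e) \<circ> (snd e \<circ> ?\<mu> \<circ> inv_into ?Q ?P))"
    using f e(1) unfolding smooth_fun_on_def
    by (intro smooth_on_compose[OF oT open_chart_image[OF is_chart[OF e(1)] S] 2 1]) blast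
  then have "smooth_on ?T (mult_rep c d f)"
  proof (rule smooth_on_cong[OF oT, rotated])
    fix w assume "w \<in> ?T"
    note w = mult_domD[OF c d this]
    show "((f \<circ> chart_inv e) \<circ> (snd e \<circ> ?\<mu> \<circ> inv_into ?Q ?P)) w = mult_rep c d f w"
      using inv[OF w(1,2)] w(7) E(6) by (simp add: mult_rep_def)
  qed
  moreover have "z \<in> ?T" using z e by (auto simp: mult_dom_def)
  ultimately show "\<exists>T. open T \<and> z \<in> T \<and> smooth_on T (mult_rep c d f)" using oT by blast
qed

section \<open>Translations and push-forward of tangent vectors\<close>

lemma smooth_fun_on_ltrans:
  assumes a: "a \<in> carrier G" and S: "open S" and f: "smooth_fun_on (atlas G) S f"
  shows "smooth_fun_on (atlas G) {q \<in> carrier G. a \<otimes> q \<in> S} (f \<circ> ltrans G a)"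
  unfolding smooth_fun_on_def
proof
  fix d assume d: "d \<in> atlas G"
  obtain c where c: "c \<in> atlas G" "a \<in> fst c" using chart_at[OF a] .
  note C = is_chartD[OF is_chart[OF c(1)]] and D = is_chartD[OF is_chart[OF d]]
  have "smooth_on {y. (snd c a, y) \<in> mult_dom c d S} (\<lambda>y. mult_rep c d f (snd c a, y))"
    by (rule smooth_on_slice(4)[OF open_mult_dom[OF c(1) d S] smooth_mult_rep[OF c(1) d S f]])
  moreover have "{y. (snd c a, y) \<in> mult_dom c d S} = snd d ` (fst d \<inter> {q \<in> carrier G. a \<otimes> q \<in> S})"
    unfolding chart_image_eq[OF is_chart[OF d]] using C(6)[OF c(2)] c(2) D(7) chart_subset[OF d]
    by (auto simp: mult_dom_def)
  moreover have "(\<lambda>y. mult_rep c d f (snd c a, y)) = f \<circ> ltrans G a \<circ> chart_inv d"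
    using C(6)[OF c(2)] by (simp add: mult_rep_def ltrans_def fun_eq_iff)
  ultimately show "smooth_on (snd d ` (fst d \<inter> {q \<in> carrier G. a \<otimes> q \<in> S})) (f \<circ> ltrans G a \<circ> chart_inv d)"
    by simp
qed

lemma smooth_fun_on_rtrans:
  assumes a: "a \<in> carrier G" and S: "open S" and f: "smooth_fun_on (atlas G) S f"
  shows "smooth_fun_on (atlas G) {q \<in> carrier G. q \<otimes> a \<in> S} (f \<circ> rtrans G a)"
  unfolding smooth_fun_on_def
proof
  fix c assume c: "c \<in> atlas G"
  obtain d where d: "d \<in> atlas G" "a \<in> fst d" using chart_at[OF a] .
  note C = is_chartD[OF is_chart[OF c]] and D = is_chartD[OF is_chart[OF d(1)]]
  have "smooth_on {x. (x, snd d a) \<in> mult_dom c d S} (\<lambda>x. mult_rep c d f (x, snd d a))"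
    by (rule smooth_on_slice(2)[OF open_mult_dom[OF c d(1) S] smooth_mult_rep[OF c d(1) S f]])
  moreover have "{x. (x, snd d a) \<in> mult_dom c d S} = snd c ` (fst c \<inter> {q \<in> carrier G. q \<otimes> a \<in> S})"
    unfolding chart_image_eq[OF is_chart[OF c]] using D(6)[OF d(2)] d(2) C(7) chart_subset[OF c]
    by (auto simp: mult_dom_def)
  moreover have "(\<lambda>x. mult_rep c d f (x, snd d a)) = f \<circ> rtrans G a \<circ> chart_inv c"
    using D(6)[OF d(2)] by (simp add: mult_rep_def rtrans_def fun_eq_iff)
  ultimately show "smooth_on (snd c ` (fst c \<inter> {q \<in> carrier G. q \<otimes> a \<in> S})) (f \<circ> rtrans G a \<circ> chart_inv c)"
    by simp
qed

lemma open_translates: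
  assumes a: "a \<in> carrier G" and S: "open S"
  shows "open {q \<in> carrier G. a \<otimes> q \<in> S}" "open {q \<in> carrier G. q \<otimes> a \<in> S}"
proof -
  have "continuous_on (carrier G) (\<lambda>q. (a, q))" "continuous_on (carrier G) (\<lambda>q. (q, a))"
    by (intro continuous_on_Pair continuous_on_const continuous_on_id)+
  note pair = this
  have "continuous_on (carrier G) (\<lambda>q. case (a, q) of (x, y) \<Rightarrow> x \<otimes> y)"
    by (rule continuous_on_compose2[OF continuous_mult pair(1)]) (use a in blast)
  moreover have "continuous_on (carrier G) (\<lambda>q. case (q, a) of (x, y) \<Rightarrow> x \<otimes> y)"
    by (rule continuous_on_compose2[OF continuous_mult pair(2)]) (use a in blast)
  ultimately have "continuous_on (carrier G) (\<lambda>q. a \<otimes> q)" "continuous_on (carrier G) (\<lambda>q. q \<otimes> a)"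
    by simp_all
  from this[THEN continuous_open_preimage, OF open_M S]
  show "open {q \<in> carrier G. a \<otimes> q \<in> S}" "open {q \<in> carrier G. q \<otimes> a \<in> S}"
    by (simp_all add: Int_def vimage_def)
qed

lemma smooth_near_ltrans:
  assumes "a \<in> carrier G" "p \<in> carrier G" "smooth_near (atlas G) (a \<otimes> p) f"
  shows "smooth_near (atlas G) p (f \<circ> ltrans G a)"
proof -
  obtain S where S: "open S" "a \<otimes> p \<in> S" "smooth_fun_on (atlas G) S f" using assms(3) unfolding smooth_near_def by blast
  show ?thesis by (rule smooth_nearI[OF open_translates(1) _ smooth_fun_on_ltrans]) (use S assms in auto)
qed

lemma smooth_near_rtrans:
  assumes "a \<in> carrier G" "p \<in> carrier G" "smooth_near (atlas G) (p \<otimes> a) f"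
  shows "smooth_near (atlas G) p (f \<circ> rtrans G a)"
proof -
  obtain S where S: "open S" "p \<otimes> a \<in> S" "smooth_fun_on (atlas G) S f" using assms(3) unfolding smooth_near_def by blast
  show ?thesis by (rule smooth_nearI[OF open_translates(2) _ smooth_fun_on_rtrans]) (use S assms in auto)
qed

text \<open>The equivalence is needed, not just one implication: a pushed vector must vanish on
  every function that is not smooth at the image point. The converse direction is translation by the
  inverse.\<close>

lemma smooth_near_ltrans_iff:
  assumes "a \<in> carrier G" "p \<in> carrier G"
  shows "smooth_near (atlas G) p (f \<circ> ltrans G a) \<longleftrightarrow> smooth_near (atlas G) (a \<otimes> p) f"
proof
  assume *: "smooth_near (atlas G) p (f \<circ> ltrans G a)"
  have "smooth_near (atlas G) (a \<otimes> p) ((f \<circ> ltrans G a) \<circ> ltrans G (inv a))"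
    by (rule smooth_near_ltrans) (use * assms in \<open>auto simp: m_assoc[symmetric]\<close>)
  then show "smooth_near (atlas G) (a \<otimes> p) f"
    by (rule smooth_near_cong[OF _ open_M]) (use assms in \<open>auto simp: ltrans_def m_assoc[symmetric]\<close>)
qed (rule smooth_near_ltrans[OF assms])

lemma smooth_near_rtrans_iff:
  assumes "a \<in> carrier G" "p \<in> carrier G"
  shows "smooth_near (atlas G) p (f \<circ> rtrans G a) \<longleftrightarrow> smooth_near (atlas G) (p \<otimes> a) f"
proof
  assume *: "smooth_near (atlas G) p (f \<circ> rtrans G a)"
  have "smooth_near (atlas G) (p \<otimes> a) ((f \<circ> rtrans G a) \<circ> rtrans G (inv a))"
    by (rule smooth_near_rtrans) (use * assms in \<open>auto simp: m_assoc\<close>)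
  then show "smooth_near (atlas G) (p \<otimes> a) f"
    by (rule smooth_near_cong[OF _ open_M]) (use assms in \<open>auto simp: rtrans_def m_assoc\<close>)
qed (rule smooth_near_rtrans[OF assms])

lemma push_tangent:
  assumes v: "v \<in> tangent_at G p" and F: "\<And>f. smooth_near (atlas G) p (f \<circ> F) \<longleftrightarrow> smooth_near (atlas G) (F p) f"
  shows "push F v \<in> tangent_at G (F p)"
  using tangent_add[OF v, of "_ \<circ> F" "_ \<circ> F"] tangent_mult[OF v, of "_ \<circ> F" "_ \<circ> F"]
    tangent_scale[OF v, of "_ \<circ> F"] tangent_not_smooth[OF v] F
  by (simp add: tangent_space_def push_def o_def)

lemma push_ltrans_tangent:
  "a \<in> carrier G \<Longrightarrow> p \<in> carrier G \<Longrightarrow> v \<in> tangent_at G p \<Longrightarrow> push (ltrans G a) v \<in> tangent_at G (a \<otimes> p)"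
  using push_tangent[of v p "ltrans G a"] smooth_near_ltrans_iff by (simp add: ltrans_def)

lemma push_rtrans_tangent:
  "a \<in> carrier G \<Longrightarrow> p \<in> carrier G \<Longrightarrow> v \<in> tangent_at G p \<Longrightarrow> push (rtrans G a) v \<in> tangent_at G (p \<otimes> a)"
  using push_tangent[of v p "rtrans G a"] smooth_near_rtrans_iff by (simp add: rtrans_def)

lemma push_cong:
  assumes "v \<in> tangent_at G p" "p \<in> carrier G" "\<And>q. q \<in> carrier G \<Longrightarrow> F q = F' q"
  shows "push F v = push F' v"
  unfolding push_def by (intro ext tangent_cong[OF assms(1,2) open_M assms(2)]) (simp add: assms(3))

lemma push_push: "push F (push F' v) = push (F \<circ> F') v"
  by (simp add: push_def o_assoc)

lemma push_ident:
  assumes "v \<in> tangent_at G p" "p \<in> carrier G" "\<And>q. q \<in> carrier G \<Longrightarrow> F q = q"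
  shows "push F v = v"
  using push_cong[OF assms(1,2), of F "\<lambda>q. q"] assms(3) by (simp add: push_def o_def)

section \<open>Left and right invariant fields\<close>

lemma tangent_oneD: "v \<in> lie_algebra G \<Longrightarrow> v \<in> tangent_at G \<one>"
  by (simp add: lie_algebra_def)

definition right_inv_field :: "'g tvec \<Rightarrow> 'g vfield" where
  "right_inv_field z = (\<lambda>p. push (rtrans G p) z)"

lemma left_inv_field_tangent: "v \<in> lie_algebra G \<Longrightarrow> p \<in> carrier G \<Longrightarrow> left_inv_field G v p \<in> tangent_at G p"
  using push_ltrans_tangent[OF _ one_closed tangent_oneD, of p v] by (simp add: left_inv_field_def)

lemma right_inv_field_tangent: "v \<in> lie_algebra G \<Longrightarrow> p \<in> carrier G \<Longrightarrow> right_inv_field v p \<in> tangent_at G p"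
  using push_rtrans_tangent[OF _ one_closed tangent_oneD, of p v] by (simp add: right_inv_field_def)

lemma mult_rep_in_dom:
  "c \<in> atlas G \<Longrightarrow> d \<in> atlas G \<Longrightarrow> a \<in> fst c \<Longrightarrow> b \<in> fst d \<Longrightarrow> (snd c a, snd d b) \<in> mult_dom c d S \<longleftrightarrow> a \<otimes> b \<in> S"
  using is_chartD(6)[OF is_chart] by (auto simp: mult_dom_def)

text \<open>Left translation by \<open>a\<close> moves only the second factor, so the derivation
  becomes a partial derivative in which \<open>a\<close> is a parameter of a jointly smooth
  function. With \<open>b\<close> the unit, this is why a left invariant field depends smoothly on
  its base point.\<close>

lemma tangent_ltrans_eq_dirderiv:
  assumes c: "c \<in> atlas G" "a \<in> fst c" and d: "d \<in> atlas G" "b \<in> fst d"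
    and S: "open S" "smooth_fun_on (atlas G) S f" "a \<otimes> b \<in> S" and v: "v \<in> tangent_at G b"
  shows "v (f \<circ> ltrans G a) = dirderiv (mult_rep c d f) (0, coords d v) (snd c a, snd d b)"
proof -
  have ab: "a \<in> carrier G" "b \<in> carrier G" using chart_subset[OF c(1)] chart_subset[OF d(1)] c(2) d(2) by blast+
  have m: "(snd c a, snd d b) \<in> mult_dom c d S" using mult_rep_in_dom[OF c(1) d(1) c(2) d(2)] S(3) by simp
  have "v (f \<circ> ltrans G a) = dirderiv (f \<circ> ltrans G a \<circ> chart_inv d) (coords d v) (snd d b)"
    by (rule tangent_eq_dirderiv[OF v d smooth_near_ltrans[OF ab smooth_nearI[OF S(1,3,2)]]])
  also have "f \<circ> ltrans G a \<circ> chart_inv d = (\<lambda>y. mult_rep c d f (snd c a, y))"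
    using is_chartD(6)[OF is_chart[OF c(1)] c(2)] by (simp add: mult_rep_def ltrans_def fun_eq_iff)
  also have "dirderiv \<dots> (coords d v) (snd d b) = dirderiv (mult_rep c d f) (0, coords d v) (snd c a, snd d b)"
    by (rule dirderiv_slice(2)[OF smooth_on_differentiable[OF smooth_mult_rep[OF c(1) d(1) S(1,2)] m]])
  finally show ?thesis .
qed

lemma tangent_rtrans_eq_dirderiv:
  assumes c: "c \<in> atlas G" "a \<in> fst c" and d: "d \<in> atlas G" "b \<in> fst d"
    and S: "open S" "smooth_fun_on (atlas G) S f" "a \<otimes> b \<in> S" and v: "v \<in> tangent_at G a"
  shows "v (f \<circ> rtrans G b) = dirderiv (mult_rep c d f) (coords c v, 0) (snd c a, snd d b)"
proof -
  have ab: "a \<in> carrier G" "b \<in> carrier G" using chart_subset[OF c(1)] chart_subset[OF d(1)] c(2) d(2) by blast+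
  have m: "(snd c a, snd d b) \<in> mult_dom c d S" using mult_rep_in_dom[OF c(1) d(1) c(2) d(2)] S(3) by simp
  have "v (f \<circ> rtrans G b) = dirderiv (f \<circ> rtrans G b \<circ> chart_inv c) (coords c v) (snd c a)"
    by (rule tangent_eq_dirderiv[OF v c smooth_near_rtrans[OF ab(2,1) smooth_nearI[OF S(1,3,2)]]])
  also have "f \<circ> rtrans G b \<circ> chart_inv c = (\<lambda>x. mult_rep c d f (x, snd d b))"
    using is_chartD(6)[OF is_chart[OF d(1)] d(2)] by (simp add: mult_rep_def rtrans_def fun_eq_iff)
  also have "dirderiv \<dots> (coords c v) (snd c a) = dirderiv (mult_rep c d f) (coords c v, 0) (snd c a, snd d b)"
    by (rule dirderiv_slice(1)[OF smooth_on_differentiable[OF smooth_mult_rep[OF c(1) d(1) S(1,2)] m]])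
  finally show ?thesis .
qed

lemma vector_field_left:
  assumes v: "v \<in> lie_algebra G"
  shows "vector_field (atlas G) (left_inv_field G v)"
  unfolding vector_field_def Union_charts
proof (intro conjI allI impI ballI left_inv_field_tangent v)
  fix S f assume "open S \<and> S \<subseteq> carrier G \<and> smooth_fun_on (atlas G) S f"
  then have S: "open S" "S \<subseteq> carrier G" "smooth_fun_on (atlas G) S f" by auto
  obtain d where d: "d \<in> atlas G" "\<one> \<in> fst d" using chart_at[OF one_closed] .
  show "smooth_fun_on (atlas G) S (\<lambda>p. left_inv_field G v p f)"
    unfolding smooth_fun_on_def
  proof
    fix c assume c: "c \<in> atlas G"
    note C = is_chartD[OF is_chart[OF c]] and D = is_chartD[OF is_chart[OF d(1)]]
    have "smooth_on {x. (x, snd d \<one>) \<in> mult_dom c d S} (\<lambda>x. dirderiv (mult_rep c d f) (0, coords d v) (x, snd d \<one>))"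
      by (rule smooth_on_slice(2)[OF open_mult_dom[OF c d(1) S(1)] smooth_on_dirderiv[OF smooth_mult_rep[OF c d(1) S(1,3)]]])
    then have 1: "smooth_on (snd c ` (fst c \<inter> S)) (\<lambda>x. dirderiv (mult_rep c d f) (0, coords d v) (x, snd d \<one>))"
      using mult_rep_in_dom[OF c d(1) _ d(2)] S(2) by (elim smooth_on_subset) auto
    show "smooth_on (snd c ` (fst c \<inter> S)) ((\<lambda>p. left_inv_field G v p f) \<circ> chart_inv c)"
    proof (rule smooth_on_cong[OF open_chart_image[OF is_chart[OF c] S(1)] _ 1])
      fix x assume "x \<in> snd c ` (fst c \<inter> S)"
      then obtain q where "q \<in> fst c" "q \<in> S" "x = snd c q" by auto
      then show "dirderiv (mult_rep c d f) (0, coords d v) (x, snd d \<one>) = ((\<lambda>p. left_inv_field G v p f) \<circ> chart_inv c) x"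
        using tangent_ltrans_eq_dirderiv[OF c _ d S(1,3) _ tangent_oneD[OF v]] C(6) S(2)
        by (auto simp: left_inv_field_def push_def)
    qed
  qed
qed

lemma vector_field_right:
  assumes v: "v \<in> lie_algebra G"
  shows "vector_field (atlas G) (right_inv_field v)"
  unfolding vector_field_def Union_charts
proof (intro conjI allI impI ballI right_inv_field_tangent v)
  fix S f assume "open S \<and> S \<subseteq> carrier G \<and> smooth_fun_on (atlas G) S f"
  then have S: "open S" "S \<subseteq> carrier G" "smooth_fun_on (atlas G) S f" by auto
  obtain c where c: "c \<in> atlas G" "\<one> \<in> fst c" using chart_at[OF one_closed] .
  show "smooth_fun_on (atlas G) S (\<lambda>p. right_inv_field v p f)"
    unfolding smooth_fun_on_def
  proof
    fix d assume d: "d \<in> atlas G"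
    note C = is_chartD[OF is_chart[OF c(1)]] and D = is_chartD[OF is_chart[OF d]]
    have "smooth_on {y. (snd c \<one>, y) \<in> mult_dom c d S} (\<lambda>y. dirderiv (mult_rep c d f) (coords c v, 0) (snd c \<one>, y))"
      by (rule smooth_on_slice(4)[OF open_mult_dom[OF c(1) d S(1)] smooth_on_dirderiv[OF smooth_mult_rep[OF c(1) d S(1,3)]]])
    then have 1: "smooth_on (snd d ` (fst d \<inter> S)) (\<lambda>y. dirderiv (mult_rep c d f) (coords c v, 0) (snd c \<one>, y))"
      using mult_rep_in_dom[OF c(1) d c(2)] S(2) by (elim smooth_on_subset) auto
    show "smooth_on (snd d ` (fst d \<inter> S)) ((\<lambda>p. right_inv_field v p f) \<circ> chart_inv d)"
    proof (rule smooth_on_cong[OF open_chart_image[OF is_chart[OF d] S(1)] _ 1])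
      fix x assume "x \<in> snd d ` (fst d \<inter> S)"
      then obtain q where "q \<in> fst d" "q \<in> S" "x = snd d q" by auto
      then show "dirderiv (mult_rep c d f) (coords c v, 0) (snd c \<one>, x) = ((\<lambda>p. right_inv_field v p f) \<circ> chart_inv d) x"
        using tangent_rtrans_eq_dirderiv[OF c d _ S(1,3) _ tangent_oneD[OF v]] D(6) S(2)
        by (auto simp: right_inv_field_def push_def)
    qed
  qed
qed

text \<open>In charts this is the symmetry of the second derivative of \<open>(t, s) \<mapsto> f (t a s)\<close>.\<close>

lemma left_right_commute:
  assumes v: "v \<in> lie_algebra G" and z: "z \<in> lie_algebra G" and a: "a \<in> carrier G" and f: "smooth_near (atlas G) a f"
  shows "left_inv_field G v a (\<lambda>q. right_inv_field z q f) = right_inv_field z a (\<lambda>q. left_inv_field G v q f)"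
proof -
  obtain S where S: "open S" "a \<in> S" "smooth_fun_on (atlas G) S f" using f unfolding smooth_near_def by blast
  obtain c where c: "c \<in> atlas G" "a \<in> fst c" using chart_at[OF a] .
  obtain d where d: "d \<in> atlas G" "\<one> \<in> fst d" using chart_at[OF one_closed] .
  note C = is_chartD[OF is_chart[OF c(1)]] and D = is_chartD[OF is_chart[OF d(1)]]
  let ?F = "mult_rep c d f" and ?O = "mult_dom c d S"
  let ?x = "snd c a" and ?y = "snd d \<one>"
  have oO: "open ?O" using open_mult_dom[OF c(1) d(1) S(1)] .
  have F: "smooth_on ?O ?F" using smooth_mult_rep[OF c(1) d(1) S(1,3)] .
  have mem: "(?x, ?y) \<in> ?O" using mult_rep_in_dom[OF c(1) d(1) c(2) d(2)] S(2) a by simp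
  \<comment> \<open>By associativity \<open>t \<otimes> (a \<otimes> s)\<close> is
    \<open>(t \<otimes> a) \<otimes> s\<close>, so \<open>z\<close> may be transported to
    \<open>a\<close>. Then the chart \<open>c\<close> at \<open>a\<close> and the chart
    \<open>d\<close> at the unit describe both differentiations.\<close>
  define w where "w = right_inv_field z a"
  have w: "w \<in> tangent_at G a" unfolding w_def using right_inv_field_tangent[OF z a] .
  note tv = tangent_oneD[OF v] and tz = tangent_oneD[OF z]
  have dF: "dirderiv ?F u differentiable (at (?x, ?y))" for u
    using smooth_on_differentiable[OF smooth_on_dirderiv[OF F] mem] .
  have "left_inv_field G v a (\<lambda>q. right_inv_field z q f) = v (\<lambda>s. z (f \<circ> rtrans G (a \<otimes> s)))"
    by (simp add: left_inv_field_def right_inv_field_def push_def o_def ltrans_def)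
  also have "\<dots> = v (\<lambda>s. dirderiv ?F (coords c w, 0) (?x, snd d s))"
  proof (rule tangent_cong[OF tv one_closed])
    let ?T = "fst d \<inter> {s \<in> carrier G. a \<otimes> s \<in> S}"
    show "open ?T" using D(1) open_translates(1)[OF a S(1)] by (rule open_Int)
    show "\<one> \<in> ?T" using d a S by simp
    fix s assume s: "s \<in> ?T"
    have "z (f \<circ> rtrans G (a \<otimes> s)) = z (f \<circ> rtrans G s \<circ> rtrans G a)"
      by (rule tangent_cong[OF tz one_closed open_M one_closed]) (use s a in \<open>simp add: rtrans_def m_assoc\<close>)
    also have "\<dots> = w (f \<circ> rtrans G s)" by (simp add: w_def right_inv_field_def push_def)
    also have "\<dots> = dirderiv ?F (coords c w, 0) (?x, snd d s)"
      using tangent_rtrans_eq_dirderiv[OF c d(1) _ S(1,3) _ w, of s] s by simp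
    finally show "z (f \<circ> rtrans G (a \<otimes> s)) = dirderiv ?F (coords c w, 0) (?x, snd d s)" .
  qed
  also have "\<dots> = dirderiv (\<lambda>y. dirderiv ?F (coords c w, 0) (?x, y)) (coords d v) ?y"
  proof -
    let ?V = "{y. (?x, y) \<in> ?O}"
    have V: "open ?V" "smooth_on ?V (\<lambda>y. dirderiv ?F (coords c w, 0) (?x, y))"
      using smooth_on_slice(3,4)[OF oO smooth_on_dirderiv[OF F]] by auto
    have sub: "?V \<subseteq> snd d ` fst d" by (auto simp: mult_dom_def)
    let ?T = "chart_inv d ` ?V"
    have T: "?T \<subseteq> fst d" "open ?T" "\<one> \<in> ?T"
      using chart_inv_image(1)[OF is_chart[OF d(1)] sub] open_chart_inv_image[OF is_chart[OF d(1)] sub V(1)] mem d(2) by auto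
    have eq: "dirderiv ?F (coords c w, 0) (?x, y) = ((\<lambda>s. dirderiv ?F (coords c w, 0) (?x, snd d s)) \<circ> chart_inv d) y"
      if "y \<in> ?V" for y using D(8) that sub by auto
    have "smooth_on (snd d ` ?T) ((\<lambda>s. dirderiv ?F (coords c w, 0) (?x, snd d s)) \<circ> chart_inv d)"
      unfolding chart_inv_image(2)[OF is_chart[OF d(1)] sub]
      by (rule smooth_on_cong[OF V(1) eq V(2)])
    then have sn: "smooth_near (atlas G) \<one> (\<lambda>s. dirderiv ?F (coords c w, 0) (?x, snd d s))"
      by (intro smooth_nearI[OF T(2,3)] smooth_fun_onI_chart[OF d(1) T(2,1)])
    have yV: "?y \<in> ?V" using mem by simp
    have "v (\<lambda>s. dirderiv ?F (coords c w, 0) (?x, snd d s)) =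
        dirderiv ((\<lambda>s. dirderiv ?F (coords c w, 0) (?x, snd d s)) \<circ> chart_inv d) (coords d v) ?y"
      by (rule tangent_eq_dirderiv[OF tv d sn])
    also have "frechet_derivative ((\<lambda>s. dirderiv ?F (coords c w, 0) (?x, snd d s)) \<circ> chart_inv d) (at ?y) =
       frechet_derivative (\<lambda>y. dirderiv ?F (coords c w, 0) (?x, y)) (at ?y)"
      by (rule frechet_derivative_transform_within_open[OF smooth_on_differentiable[OF V(2) yV] V(1) yV eq, symmetric])
    finally show ?thesis .
  qed
  also have "\<dots> = dirderiv (dirderiv ?F (coords c w, 0)) (0, coords d v) (?x, ?y)"
    by (rule dirderiv_slice(2)[OF dF])
  also have "\<dots> = dirderiv (dirderiv ?F (0, coords d v)) (coords c w, 0) (?x, ?y)"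
    using F by (intro dirderiv_commute[OF oO _ mem]) (simp add: smooth_on_def del: Ck_on.simps)
  also have "\<dots> = dirderiv (\<lambda>x. dirderiv ?F (0, coords d v) (x, ?y)) (coords c w) ?x"
    by (rule dirderiv_slice(1)[OF dF, symmetric])
  also have "\<dots> = w (\<lambda>q. left_inv_field G v q f)"
  proof -
    have sn: "smooth_near (atlas G) a (\<lambda>q. left_inv_field G v q f)"
      by (rule vector_field_smooth_near[OF vector_field_left[OF v] a f])
    let ?V = "{x. (x, ?y) \<in> ?O}"
    have V: "open ?V" "smooth_on ?V (\<lambda>x. dirderiv ?F (0, coords d v) (x, ?y))"
      using smooth_on_slice(1,2)[OF oO smooth_on_dirderiv[OF F]] by auto
    have xV: "?x \<in> ?V" using mem by simp
    have eq: "dirderiv ?F (0, coords d v) (x, ?y) = ((\<lambda>q. left_inv_field G v q f) \<circ> chart_inv c) x" if "x \<in> ?V" for x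
    proof -
      have x: "chart_inv c x \<in> fst c" "snd c (chart_inv c x) = x" "chart_inv c x \<otimes> \<one> \<in> S"
        using that C(7,8) D(6)[OF d(2)] by (auto simp: mult_dom_def)
      show ?thesis using tangent_ltrans_eq_dirderiv[OF c(1) x(1) d S(1,3) x(3) tv] x(2)
        by (simp add: left_inv_field_def push_def)
    qed
    have "w (\<lambda>q. left_inv_field G v q f) = dirderiv ((\<lambda>q. left_inv_field G v q f) \<circ> chart_inv c) (coords c w) ?x"
      by (rule tangent_eq_dirderiv[OF w c sn])
    also have "frechet_derivative ((\<lambda>q. left_inv_field G v q f) \<circ> chart_inv c) (at ?x) =
      frechet_derivative (\<lambda>x. dirderiv ?F (0, coords d v) (x, ?y)) (at ?x)"
      by (rule frechet_derivative_transform_within_open[OF smooth_on_differentiable[OF V(2) xV] V(1) xV eq, symmetric])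
    finally show ?thesis by simp
  qed
  finally show ?thesis by (simp add: w_def)
qed

section \<open>The Lie bracket and the adjoint action\<close>

definition bracket :: "'g tvec \<Rightarrow> 'g tvec \<Rightarrow> 'g tvec" where
  "bracket v w = lie_bracket (atlas G) (left_inv_field G v) (left_inv_field G w) \<one>"

lemma bracket_in: "v \<in> lie_algebra G \<Longrightarrow> w \<in> lie_algebra G \<Longrightarrow> bracket v w \<in> lie_algebra G"
  unfolding bracket_def lie_algebra_def
  by (rule lie_bracket_tangent) (auto simp: vector_field_left lie_algebra_def)

text \<open>Associativity moves the base point \<open>p\<close> into the function, so that second
  derivatives at \<open>p\<close> become second derivatives at the unit. Left invariance of the
  bracket follows from this.\<close>

lemma left_inv_field_apply:
  assumes "v \<in> lie_algebra G" "w \<in> lie_algebra G" "p \<in> carrier G"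
  shows "left_inv_field G v p (\<lambda>q. left_inv_field G w q f) = v (\<lambda>s. w ((f \<circ> ltrans G p) \<circ> ltrans G s))"
  unfolding left_inv_field_def push_def
proof (rule tangent_cong[OF tangent_oneD[OF assms(1)] one_closed open_M one_closed])
  fix s assume s: "s \<in> carrier G"
  show "((\<lambda>q. w (f \<circ> ltrans G q)) \<circ> ltrans G p) s = w (f \<circ> ltrans G p \<circ> ltrans G s)"
    unfolding o_def[of "\<lambda>q. w (f \<circ> ltrans G q)"]
    by (rule tangent_cong[OF tangent_oneD[OF assms(2)] one_closed open_M one_closed])
      (use s assms(3) in \<open>simp add: ltrans_def m_assoc\<close>)
qed

lemma bracket_apply:
  assumes "v \<in> lie_algebra G" "w \<in> lie_algebra G" "smooth_near (atlas G) \<one> f"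
  shows "bracket v w f = v (\<lambda>s. w (f \<circ> ltrans G s)) - w (\<lambda>s. v (f \<circ> ltrans G s))"
proof -
  have step: "v (\<lambda>s. w (f \<circ> ltrans G \<one> \<circ> ltrans G s)) = v (\<lambda>s. w (f \<circ> ltrans G s))"
    if v: "v \<in> lie_algebra G" and w: "w \<in> lie_algebra G" for v w
    by (intro tangent_cong[OF tangent_oneD[OF v] one_closed open_M one_closed]
        tangent_cong[OF tangent_oneD[OF w] one_closed open_M one_closed]) (simp add: ltrans_def)
  then show ?thesis
    using assms(3) by (simp add: bracket_def lie_bracket_def left_inv_field_apply assms(1,2)
        step[OF assms(1,2)] step[OF assms(2,1)])
qed

lemma lie_bracket_left:
  assumes v: "v \<in> lie_algebra G" and w: "w \<in> lie_algebra G" and p: "p \<in> carrier G"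
  shows "lie_bracket (atlas G) (left_inv_field G v) (left_inv_field G w) p = left_inv_field G (bracket v w) p"
proof (rule tangent_eqI)
  show "lie_bracket (atlas G) (left_inv_field G v) (left_inv_field G w) p \<in> tangent_at G p"
    by (intro lie_bracket_tangent vector_field_left v w p)
  show "left_inv_field G (bracket v w) p \<in> tangent_at G p"
    by (intro left_inv_field_tangent bracket_in v w p)
  fix f assume f: "smooth_near (atlas G) p f"
  then have "smooth_near (atlas G) \<one> (f \<circ> ltrans G p)" using smooth_near_ltrans[OF p one_closed] p by simp
  then show "lie_bracket (atlas G) (left_inv_field G v) (left_inv_field G w) p f = left_inv_field G (bracket v w) p f"
    using f by (simp add: lie_bracket_def left_inv_field_apply[OF v w p] left_inv_field_apply[OF w v p])
      (simp add: left_inv_field_def[of G "bracket v w"] push_def bracket_apply v w)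
qed

text \<open>The adjoint action of the inverse of \<open>a\<close>, that is, the differential at the
  unit of the conjugation \<open>s \<mapsto> inv a \<otimes> s \<otimes> a\<close>.\<close>

definition Ad_inv :: "'g \<Rightarrow> 'g tvec \<Rightarrow> 'g tvec" where
  "Ad_inv a z = push (ltrans G (inv a)) (right_inv_field z a)"

lemma Ad_inv_in: "z \<in> lie_algebra G \<Longrightarrow> a \<in> carrier G \<Longrightarrow> Ad_inv a z \<in> lie_algebra G"
  using push_ltrans_tangent[OF inv_closed _ right_inv_field_tangent, of a a z] by (simp add: Ad_inv_def lie_algebra_def)

lemma left_Ad_inv:
  assumes z: "z \<in> lie_algebra G" and a: "a \<in> carrier G"
  shows "left_inv_field G (Ad_inv a z) a = right_inv_field z a"
  unfolding left_inv_field_def Ad_inv_def push_push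
  by (rule push_ident[OF right_inv_field_tangent[OF z a] a]) (use a in \<open>simp add: ltrans_def m_assoc[symmetric]\<close>)

text \<open>Conjugation is a homomorphism, and \<open>bracket_apply\<close> expresses the bracket
  through the multiplication alone.\<close>

lemma bracket_Ad_inv:
  assumes v: "v \<in> lie_algebra G" and w: "w \<in> lie_algebra G" and a: "a \<in> carrier G"
  shows "bracket (Ad_inv a v) (Ad_inv a w) = Ad_inv a (bracket v w)"
proof -
  define C where "C = ltrans G (inv a) \<circ> rtrans G a"
  have Ad: "Ad_inv a u f = u (f \<circ> C)" for u f
    by (simp add: Ad_inv_def right_inv_field_def push_def C_def o_assoc)
  have C: "C s \<in> carrier G" "C (s \<otimes> t) = C s \<otimes> C t" if "s \<in> carrier G" "t \<in> carrier G" for s t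
  proof -
    have "inv a \<otimes> (s \<otimes> (t \<otimes> a)) = inv a \<otimes> (s \<otimes> (a \<otimes> (inv a \<otimes> (t \<otimes> a))))"
      using that a by (simp add: m_assoc[symmetric] r_inv)
    then show "C s \<in> carrier G" "C (s \<otimes> t) = C s \<otimes> C t"
      using that a by (simp_all add: C_def ltrans_def rtrans_def m_assoc)
  qed
  have step: "v (\<lambda>s. w (f \<circ> C \<circ> ltrans G s)) = Ad_inv a v (\<lambda>s. Ad_inv a w (f \<circ> ltrans G s))"
    if v: "v \<in> lie_algebra G" and w: "w \<in> lie_algebra G" for v w f
    unfolding Ad o_def[of _ C]
    by (intro tangent_cong[OF tangent_oneD[OF v] one_closed open_M one_closed]
        tangent_cong[OF tangent_oneD[OF w] one_closed open_M one_closed]) (simp add: ltrans_def C)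
  show ?thesis
  proof (rule tangent_eqI)
    show "bracket (Ad_inv a v) (Ad_inv a w) \<in> tangent_at G \<one>"
      by (intro tangent_oneD bracket_in Ad_inv_in v w a)
    show Ab: "Ad_inv a (bracket v w) \<in> tangent_at G \<one>"
      by (intro tangent_oneD bracket_in Ad_inv_in v w a)
    fix f assume f: "smooth_near (atlas G) \<one> f"
    have "smooth_near (atlas G) a (f \<circ> ltrans G (inv a))"
      using smooth_near_ltrans[OF inv_closed[OF a] a] f a by simp
    then have "smooth_near (atlas G) \<one> (f \<circ> C)"
      using smooth_near_rtrans[OF a one_closed, of "f \<circ> ltrans G (inv a)"] a by (simp add: C_def o_assoc)
    then show "bracket (Ad_inv a v) (Ad_inv a w) f = Ad_inv a (bracket v w) f"
      by (simp add: Ad[of "bracket v w"] bracket_apply v w Ad_inv_in a f step[OF v w] step[OF w v])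
  qed
qed

section \<open>Linear coordinates on the Lie algebra\<close>

definition unit_chart :: "('g, real ^ 'n) chart" where
  "unit_chart = (SOME d. d \<in> atlas G \<and> \<one> \<in> fst d)"

lemma unit_chart: "unit_chart \<in> atlas G" "\<one> \<in> fst unit_chart"
  using someI_ex[of "\<lambda>d. d \<in> atlas G \<and> \<one> \<in> fst d"] chart_at[OF one_closed]
  unfolding unit_chart_def by blast+

text \<open>The Lie algebra is a set of functionals. \<open>E\<close> carries it over to
  \<open>real ^ 'n\<close>, where matrices, determinants and the surjectivity of injective
  endomorphisms can be used.\<close>

definition E :: "real ^ 'n \<Rightarrow> 'g tvec" where
  "E = chart_vector unit_chart \<one>"

definition E_inv :: "'g tvec \<Rightarrow> real ^ 'n" where
  "E_inv = coords unit_chart"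

lemma E_in: "E \<xi> \<in> lie_algebra G"
  by (simp add: E_def lie_algebra_def chart_vector_tangent[OF unit_chart])

lemma E_inv_E [simp]: "E_inv (E \<xi>) = \<xi>"
  by (simp add: E_def E_inv_def coords_chart_vector[OF unit_chart])

lemma E_E_inv: "v \<in> lie_algebra G \<Longrightarrow> E (E_inv v) = v"
  using tangent_eq_chart_vector[OF tangent_oneD unit_chart] by (simp add: E_def E_inv_def)

lemma E_linear: "E (a *\<^sub>R \<xi> + b *\<^sub>R \<eta>) f = a * E \<xi> f + b * E \<eta> f"
  by (simp add: E_def chart_vector_linear[OF unit_chart])

definition X :: "real ^ 'n \<Rightarrow> 'g vfield" where "X \<xi> = left_inv_field G (E \<xi>)"
definition Y :: "real ^ 'n \<Rightarrow> 'g vfield" where "Y \<xi> = right_inv_field (E \<xi>)"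

lemma vector_field_X: "vector_field (atlas G) (X \<xi>)"
  by (simp add: X_def vector_field_left E_in)

lemma vector_field_Y: "vector_field (atlas G) (Y \<xi>)"
  by (simp add: Y_def vector_field_right E_in)

lemma X_tangent: "p \<in> carrier G \<Longrightarrow> X \<xi> p \<in> tangent_at G p"
  by (rule vector_field_tangent[OF vector_field_X])

lemma Y_tangent: "p \<in> carrier G \<Longrightarrow> Y \<xi> p \<in> tangent_at G p"
  by (rule vector_field_tangent[OF vector_field_Y])

lemma X_linear: "X (a *\<^sub>R \<xi> + b *\<^sub>R \<eta>) p = (\<lambda>f. a * X \<xi> p f + b * X \<eta> p f)"
  by (simp add: X_def left_inv_field_def push_def E_linear)

lemma Y_linear: "Y (a *\<^sub>R \<xi> + b *\<^sub>R \<eta>) p = (\<lambda>f. a * Y \<xi> p f + b * Y \<eta> p f)"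
  by (simp add: Y_def right_inv_field_def push_def E_linear)

lemma linear_X: "linear (\<lambda>\<xi>. X \<xi> p f)"
  using X_linear[of 1 _ 1] X_linear[of _ _ 0 0] by (intro linearI) (simp_all add: fun_eq_iff)

lemma X_expand: "X \<xi> p f = (\<Sum>i\<in>UNIV. \<xi> $ i * X (axis i 1) p f)"
  using linear_axis_expansion[OF linear_X, of \<xi>] by simp

lemma push_ltrans_inv:
  assumes "p \<in> carrier G" "v \<in> tangent_at G p"
  shows "push (ltrans G p) (push (ltrans G (inv p)) v) = v"
  unfolding push_push by (rule push_ident[OF assms(2,1)]) (use assms(1) in \<open>simp add: ltrans_def m_assoc[symmetric]\<close>)

text \<open>Translation back to the unit shows that the left invariant fields span every tangent
  space. Together with \<open>X_inject\<close> this makes them a frame on the whole group, which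
  takes the place of the merely local coordinate fields.\<close>

lemma X_surj:
  assumes p: "p \<in> carrier G" and v: "v \<in> tangent_at G p"
  obtains \<xi> where "v = X \<xi> p"
proof -
  have "push (ltrans G (inv p)) v \<in> lie_algebra G"
    using push_ltrans_tangent[OF inv_closed[OF p] p v] p by (simp add: lie_algebra_def)
  then have "X (E_inv (push (ltrans G (inv p)) v)) p = v"
    unfolding X_def left_inv_field_def by (subst E_E_inv) (simp_all add: push_ltrans_inv[OF p v])
  then show ?thesis using that by metis
qed

lemma X_inject:
  assumes p: "p \<in> carrier G" and "X \<xi> p = X \<eta> p"
  shows "\<xi> = \<eta>"
proof -
  have "push (ltrans G (inv p)) (X \<zeta> p) = E \<zeta>" for \<zeta>
    unfolding X_def left_inv_field_def push_push
    by (rule push_ident[OF tangent_oneD[OF E_in] one_closed]) (use p in \<open>simp add: ltrans_def m_assoc[symmetric]\<close>)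
  then have "E \<xi> = E \<eta>" using assms(2) by metis
  then show ?thesis by (metis E_inv_E)
qed

lemma Y_inject:
  assumes p: "p \<in> carrier G" and "Y \<xi> p = Y \<eta> p"
  shows "\<xi> = \<eta>"
proof -
  have "push (rtrans G (inv p)) (Y \<zeta> p) = E \<zeta>" for \<zeta>
    unfolding Y_def right_inv_field_def push_push
    by (rule push_ident[OF tangent_oneD[OF E_in] one_closed]) (use p in \<open>simp add: rtrans_def m_assoc\<close>)
  then have "E \<xi> = E \<eta>" using assms(2) by metis
  then show ?thesis by (metis E_inv_E)
qed

text \<open>\<open>Ad\<close> is the adjoint action of the inverse: \<open>Ad a z\<close> are the left invariant coordinates at \<open>a\<close> of
  the right invariant field given by \<open>z\<close>.\<close>

definition Ad :: "'g \<Rightarrow> real ^ 'n \<Rightarrow> real ^ 'n" where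
  "Ad a z = E_inv (Ad_inv a (E z))"

definition Br :: "real ^ 'n \<Rightarrow> real ^ 'n \<Rightarrow> real ^ 'n" where
  "Br x y = E_inv (bracket (E x) (E y))"

lemma E_Ad: "a \<in> carrier G \<Longrightarrow> E (Ad a z) = Ad_inv a (E z)"
  by (simp add: Ad_def E_E_inv Ad_inv_in E_in)

lemma E_Br: "E (Br x y) = bracket (E x) (E y)"
  by (simp add: Br_def E_E_inv bracket_in E_in)

lemma X_Ad: "a \<in> carrier G \<Longrightarrow> X (Ad a z) a = Y z a"
  by (simp add: X_def Y_def E_Ad left_Ad_inv E_in)

lemma Br_Ad: "a \<in> carrier G \<Longrightarrow> Br (Ad a x) (Ad a y) = Ad a (Br x y)"
  by (simp add: Br_def E_Ad bracket_Ad_inv E_in) (simp add: Ad_def E_Br[unfolded Br_def])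

lemma lie_bracket_X: "p \<in> carrier G \<Longrightarrow> lie_bracket (atlas G) (X x) (X y) p = X (Br x y) p"
  by (simp add: X_def lie_bracket_left E_in E_Br)

lemma linear_Ad:
  assumes a: "a \<in> carrier G"
  shows "linear (Ad a)"
proof -
  have "Ad a (s *\<^sub>R x + t *\<^sub>R y) = s *\<^sub>R Ad a x + t *\<^sub>R Ad a y" for s t x y
    by (rule X_inject[OF a]) (simp add: X_Ad[OF a] Y_linear X_linear)
  from this[of 1 _ 1] this[of _ _ 0 0] show ?thesis by (intro linearI) simp_all
qed

lemma inj_Ad: "a \<in> carrier G \<Longrightarrow> inj (Ad a)"
  by (rule injI) (metis X_Ad Y_inject)

lemma Ad_one: "Ad \<one> z = z"
proof (rule X_inject[OF one_closed])
  have "push (ltrans G \<one>) (E z) = push (rtrans G \<one>) (E z)"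
    by (rule push_cong[OF tangent_oneD[OF E_in] one_closed]) (simp add: ltrans_def rtrans_def)
  then show "X (Ad \<one> z) \<one> = X z \<one>"
    unfolding X_Ad[OF one_closed] by (simp add: X_def Y_def left_inv_field_def right_inv_field_def)
qed

lemma Br_skew: "Br x y = - Br y x"
proof (rule X_inject[OF one_closed])
  have "X (- Br y x) \<one> = (\<lambda>f. - X (Br y x) \<one> f)"
    using X_linear[of "-1" "Br y x" 0 0] by (simp add: fun_eq_iff)
  then show "X (Br x y) \<one> = X (- Br y x) \<one>"
    by (simp add: lie_bracket_X[OF one_closed, symmetric] lie_bracket_def fun_eq_iff)
qed

lemma linear_X_apply:
  assumes p: "p \<in> carrier G" and v: "v \<in> tangent_at G p" and f: "smooth_near (atlas G) p f"
  shows "linear (\<lambda>\<eta>. v (\<lambda>q. X \<eta> q f))"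
proof -
  have sn: "smooth_near (atlas G) p (\<lambda>q. X \<eta> q f)" for \<eta>
    by (rule vector_field_smooth_near[OF vector_field_X p f])
  have "v (\<lambda>q. X (a *\<^sub>R x + b *\<^sub>R y) q f) = a * v (\<lambda>q. X x q f) + b * v (\<lambda>q. X y q f)" for a b x y
    unfolding X_linear
      tangent_add[OF v smooth_near_mult[OF smooth_near_const sn] smooth_near_mult[OF smooth_near_const sn]]
      tangent_scale[OF v sn] ..
  from this[of 1 _ 1] this[of _ _ 0 0] show ?thesis by (intro linearI) simp_all
qed

lemma X_apply_expand:
  assumes "p \<in> carrier G" "v \<in> tangent_at G p" "smooth_near (atlas G) p f"
  shows "v (\<lambda>q. X \<eta> q f) = (\<Sum>i\<in>UNIV. \<eta> $ i * v (\<lambda>q. X (axis i 1) q f))"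
  using linear_axis_expansion[OF linear_X_apply[OF assms], of \<eta>] by simp

end


section \<open>Symplectic Lie groups and momentum maps\<close>

locale symplectic_group =
  fixes G :: "('g::{t2_space, second_countable_topology}, 'n::finite) lie_struct" (structure)
    and \<Omega> :: "'g form2"
  assumes symplectic: "symplectic_lie_group G \<Omega>"
begin

sublocale real_lie_group G
  using symplectic by unfold_locales (simp add: symplectic_lie_group_def)

section \<open>The symplectic form on the Lie algebra\<close>

lemma two_form: "two_form (atlas G) \<Omega>"
  using symplectic by (simp add: symplectic_lie_group_def symplectic_form_def)

definition w :: "real ^ 'n \<Rightarrow> real ^ 'n \<Rightarrow> real" where
  "w \<xi> \<eta> = \<Omega> \<one> (E \<xi>) (E \<eta>)"

lemma form_skew: "p \<in> carrier G \<Longrightarrow> u \<in> tangent_at G p \<Longrightarrow> v \<in> tangent_at G p \<Longrightarrow> \<Omega> p u v = - \<Omega> p v u"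
  using two_form unfolding two_form_def Union_charts by blast

lemma form_linear_right:
  assumes p: "p \<in> carrier G" and u: "u \<in> tangent_at G p" "v \<in> tangent_at G p" "v' \<in> tangent_at G p"
  shows "\<Omega> p u (\<lambda>f. a * v f + b * v' f) = a * \<Omega> p u v + b * \<Omega> p u v'"
proof -
  have l: "linear_on_space (tangent_at G p) (\<Omega> p u)"
    using two_form p u unfolding two_form_def Union_charts by blast
  have "\<Omega> p u (\<lambda>f. (\<lambda>f. a * v f) f + (\<lambda>f. b * v' f) f) = \<Omega> p u (\<lambda>f. a * v f) + \<Omega> p u (\<lambda>f. b * v' f)"
    by (rule l[unfolded linear_on_space_def, THEN conjunct1, rule_format, OF tangent_times[OF u(2)] tangent_times[OF u(3)]])
  then show ?thesis using l u unfolding linear_on_space_def by simp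
qed

lemma form_X: "p \<in> carrier G \<Longrightarrow> \<Omega> p (X \<xi> p) (X \<eta> p) = w \<xi> \<eta>"
proof -
  assume p: "p \<in> carrier G"
  have "left_invariant_form G \<Omega>" using symplectic by (simp add: symplectic_lie_group_def)
  then have "\<Omega> (p \<otimes> \<one>) (push (ltrans G p) (E \<xi>)) (push (ltrans G p) (E \<eta>)) = \<Omega> \<one> (E \<xi>) (E \<eta>)"
    using p tangent_oneD[OF E_in] unfolding left_invariant_form_def by blast
  then show ?thesis using p by (simp add: w_def X_def left_inv_field_def)
qed

lemma X_one: "X \<xi> \<one> = E \<xi>"
  unfolding X_def left_inv_field_def
  by (rule push_ident[OF tangent_oneD[OF E_in] one_closed]) (simp add: ltrans_def)

lemma w_skew: "w \<xi> \<eta> = - w \<eta> \<xi>"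
  unfolding w_def by (rule form_skew) (simp_all add: tangent_oneD E_in)

lemma linear_w: "linear (w \<xi>)"
proof -
  have "w \<xi> (a *\<^sub>R x + b *\<^sub>R y) = a * w \<xi> x + b * w \<xi> y" for a b x y
    using form_linear_right[OF one_closed X_tangent X_tangent X_tangent, of \<xi> a x b y]
    by (simp add: form_X flip: X_linear)
  from this[of 1 _ 1] this[of _ _ 0 0] show ?thesis by (intro linearI) simp_all
qed

lemma linear_w_left: "linear (\<lambda>\<xi>. w \<xi> \<eta>)"
  using linear_add[OF linear_w, of \<eta>] linear_scale[OF linear_w, of \<eta>] w_skew[of _ \<eta>]
  by (intro linearI) simp_all

lemma w_nondegenerate:
  assumes "\<And>\<eta>. w \<xi> \<eta> = 0"
  shows "\<xi> = 0"
proof (rule X_inject[OF one_closed])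
  have "\<Omega> \<one> (E \<xi>) u = 0" if "u \<in> tangent_at G \<one>" for u
    using assms[of "E_inv u"] that E_E_inv[of u] by (simp add: w_def lie_algebra_def)
  then have "E \<xi> = (\<lambda>f. 0)"
    using symplectic tangent_oneD[OF E_in, of \<xi>]
    unfolding symplectic_lie_group_def symplectic_form_def Union_charts by blast
  moreover have "X 0 \<one> = (\<lambda>f. 0)" using X_linear[of 0 0 0 0] by simp
  ultimately show "X \<xi> \<one> = X 0 \<one>" by (simp add: X_one)
qed

text \<open>This is closedness of the form on left invariant fields: their pairings are constant, so
  only the bracket terms of the exterior derivative survive.\<close>

lemma cocycle: "w (Br x y) z - w (Br x z) y + w (Br y z) x = 0"
proof -
  have "exterior_derivative2 (atlas G) \<Omega> (X x) (X y) (X z) \<one> = 0"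
    using symplectic vector_field_X one_closed
    unfolding symplectic_lie_group_def symplectic_form_def Union_charts by blast
  moreover have "X a \<one> (\<lambda>q. \<Omega> q (X b q) (X c q)) = 0" for a b c
  proof -
    have "X a \<one> (\<lambda>q. \<Omega> q (X b q) (X c q)) = X a \<one> (\<lambda>q. w b c)"
      by (rule tangent_cong[OF X_tangent[OF one_closed] one_closed open_M one_closed]) (simp add: form_X)
    then show ?thesis by (simp add: tangent_const[OF X_tangent[OF one_closed]])
  qed
  ultimately show ?thesis
    by (simp add: exterior_derivative2_def lie_bracket_X form_X)
qed

lemma w_represent:
  assumes "linear \<phi>"
  obtains \<xi> where "\<And>\<eta>. w \<xi> \<eta> = \<phi> \<eta>"
proof -
  define T where "T \<xi> = (\<chi> k. w \<xi> (axis k 1))" for \<xi>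
  have lin: "linear T"
    using linear_add[OF linear_w_left] linear_scale[OF linear_w_left]
    by (intro linearI) (simp_all add: T_def vec_eq_iff)
  have "inj T"
    unfolding linear_injective_0[OF lin]
  proof (intro allI impI w_nondegenerate)
    fix \<xi> \<eta> assume "T \<xi> = 0"
    then have "w \<xi> (axis k 1) = 0" for k by (simp add: T_def vec_eq_iff)
    then show "w \<xi> \<eta> = 0" using linear_axis_expansion[OF linear_w, of \<xi> \<eta>] by simp
  qed
  then have "surj T" using linear_injective_imp_surjective[OF lin] by simp
  then obtain \<xi> where \<xi>: "T \<xi> = (\<chi> k. \<phi> (axis k 1))" by (metis surjD)
  have "w \<xi> \<eta> = \<phi> \<eta>" for \<eta>
    using \<xi> linear_axis_expansion[OF linear_w, of \<xi> \<eta>] linear_axis_expansion[OF assms, of \<eta>]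
    by (simp add: T_def vec_eq_iff)
  then show ?thesis using that by blast
qed

text \<open>\<open>dual i\<close> represents the image under \<open>r\<close> of the coordinate
  functional number \<open>i\<close>. Pairing with it extracts components, and the family of these
  vectors expresses \<open>r\<close> in the standard basis.\<close>

definition dual :: "'n \<Rightarrow> real ^ 'n" where
  "dual i = (SOME \<xi>. \<forall>\<eta>. w \<xi> \<eta> = \<eta> $ i)"

lemma w_dual: "w (dual i) \<eta> = \<eta> $ i"
proof -
  have "linear (\<lambda>\<eta> :: real ^ 'n. \<eta> $ i)" by (intro linearI) simp_all
  then have "\<exists>\<xi>. \<forall>\<eta>. w \<xi> \<eta> = \<eta> $ i" using w_represent by metis
  from someI_ex[OF this] show ?thesis by (simp add: dual_def)
qed

section \<open>Derivatives of the adjoint action\<close>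

lemma form_Y_X: "q \<in> carrier G \<Longrightarrow> \<Omega> q (Y z q) (X y q) = w (Ad q z) y"
  by (simp add: form_X flip: X_Ad)

lemma smooth_form: "vector_field (atlas G) V \<Longrightarrow> vector_field (atlas G) W \<Longrightarrow>
    smooth_fun_on (atlas G) (carrier G) (\<lambda>q. \<Omega> q (V q) (W q))"
  using two_form unfolding two_form_def Union_charts by blast

lemma smooth_w_Ad: "smooth_fun_on (atlas G) (carrier G) (\<lambda>q. w (Ad q z) y)"
  by (rule smooth_fun_on_cong[OF open_M _ smooth_form[OF vector_field_Y vector_field_X]]) (simp add: form_Y_X)

text \<open>Components are obtained by pairing with \<open>dual i\<close>, so smoothness is
  inherited from that of the form on invariant fields and conjugation need not be examined in
  charts. The factor -1 is skew-symmetry.\<close>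

lemma smooth_Ad: "smooth_fun_on (atlas G) (carrier G) (\<lambda>q. Ad q z $ i)"
  by (rule smooth_fun_on_cong[OF open_M _ smooth_fun_on_mult[OF open_M smooth_fun_on_const[of _ "-1"] smooth_w_Ad[of z "dual i"]]])
    (use w_skew[of _ "dual i"] w_dual in simp)

lemma X_of_Ad:
  assumes a: "a \<in> carrier G"
  shows "X x a (\<lambda>q. Ad q z $ i) = - Br x (Ad a z) $ i"
proof -
  define \<nu> where "\<nu> = (\<chi> i. X x a (\<lambda>q. Ad q z $ i))"
  have \<nu>_nth: "\<nu> $ i = X x a (\<lambda>q. Ad q z $ i)" for i by (simp add: \<nu>_def)
  let ?e = "\<lambda>i. axis i 1 :: real ^ 'n"
  have snAd: "smooth_near (atlas G) a (\<lambda>q. Ad q z $ i)" for i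
    by (rule smooth_nearI[OF open_M a smooth_Ad])
  have zero: "X (1 *\<^sub>R \<nu> + 1 *\<^sub>R Br x (Ad a z)) a f = 0" if f: "smooth_near (atlas G) a f" for f
  proof -
    have sn: "smooth_near (atlas G) a (\<lambda>q. X \<eta> q f)" for \<eta>
      by (rule vector_field_smooth_near[OF vector_field_X a f])
    have "X x a (\<lambda>q. Y z q f) = X x a (\<lambda>q. \<Sum>i\<in>UNIV. Ad q z $ i * X (?e i) q f)"
      by (rule tangent_cong[OF X_tangent[OF a] a open_M a]) (simp add: X_expand[symmetric] X_Ad)
    also have "\<dots> = (\<Sum>i\<in>UNIV. Ad a z $ i * X x a (\<lambda>q. X (?e i) q f) + X (?e i) a f * X x a (\<lambda>q. Ad q z $ i))"
      by (simp only: tangent_sum[OF X_tangent[OF a] smooth_near_mult[OF snAd sn]] tangent_mult[OF X_tangent[OF a] snAd sn])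
    also have "\<dots> = X x a (\<lambda>q. X (Ad a z) q f) + X \<nu> a f"
      unfolding X_expand[of \<nu>] X_apply_expand[OF a X_tangent[OF a, of x] f, of "Ad a z"] \<nu>_nth
      by (simp add: sum.distrib mult.commute)
    finally have "X x a (\<lambda>q. Y z q f) = X x a (\<lambda>q. X (Ad a z) q f) + X \<nu> a f" .
    moreover have "X x a (\<lambda>q. Y z q f) = X (Ad a z) a (\<lambda>q. X x q f)"
      unfolding X_Ad[OF a] unfolding X_def Y_def by (rule left_right_commute[OF E_in E_in a f])
    moreover have "X (Br x (Ad a z)) a f = X x a (\<lambda>q. X (Ad a z) q f) - X (Ad a z) a (\<lambda>q. X x q f)"
      using f by (simp add: lie_bracket_X[OF a, symmetric] lie_bracket_def)
    ultimately show ?thesis unfolding X_linear by simp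
  qed
  have "X (1 *\<^sub>R \<nu> + 1 *\<^sub>R Br x (Ad a z)) a = X 0 a"
    by (rule tangent_eqI[OF X_tangent[OF a] X_tangent[OF a]]) (use zero X_linear[of 0 0 0 0] in simp)
  from X_inject[OF a this] have "\<nu> = - Br x (Ad a z)" by (simp add: eq_neg_iff_add_eq_0)
  then show ?thesis by (simp add: \<nu>_def vec_eq_iff)
qed

lemma X_of_w_Ad:
  assumes a: "a \<in> carrier G"
  shows "X x a (\<lambda>q. w (Ad q z) y) = - w (Br x (Ad a z)) y"
proof -
  have sn: "smooth_near (atlas G) a (\<lambda>q. Ad q z $ i)" for i
    by (rule smooth_nearI[OF open_M a smooth_Ad])
  have exp: "w \<xi> y = (\<Sum>i\<in>UNIV. w (axis i 1) y * \<xi> $ i)" for \<xi>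
    using linear_axis_expansion[OF linear_w_left, of \<xi> y] by (simp add: mult.commute)
  have "X x a (\<lambda>q. w (Ad q z) y) = X x a (\<lambda>q. \<Sum>i\<in>UNIV. w (axis i 1) y * Ad q z $ i)"
    by (subst exp) simp
  also have "\<dots> = (\<Sum>i\<in>UNIV. w (axis i 1) y * X x a (\<lambda>q. Ad q z $ i))"
    by (subst tangent_sum[OF X_tangent[OF a]])
      (simp_all add: tangent_scale[OF X_tangent[OF a]] smooth_near_mult smooth_near_const sn)
  finally show ?thesis using exp[of "Br x (Ad a z)"] by (simp add: X_of_Ad[OF a] sum_negf)
qed

text \<open>For \<open>v = X x a\<close> the Leibniz rule gives two terms, with \<open>Br x\<close>
  applied to either argument. The cocycle identity merges them into
  \<open>w (Br (Ad a z) (Ad a y)) x\<close>, and \<open>Ad a\<close> respects the bracket.\<close>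

lemma X_of_w_Ad_Ad:
  assumes a: "a \<in> carrier G" and v: "v \<in> tangent_at G a"
  shows "v (\<lambda>q. w (Ad q z) (Ad q y)) = \<Omega> a (Y (Br z y) a) v"
proof -
  obtain x where x: "v = X x a" using X_surj[OF a v] .
  have sn: "smooth_near (atlas G) a (\<lambda>q. Ad q z $ i)" for i z
    by (rule smooth_nearI[OF open_M a smooth_Ad])
  have snw: "smooth_near (atlas G) a (\<lambda>q. w (Ad q z) y)" for y
    by (rule smooth_nearI[OF open_M a smooth_w_Ad])
  have exp: "w \<xi> \<eta> = (\<Sum>i\<in>UNIV. \<eta> $ i * w \<xi> (axis i 1))" for \<xi> \<eta>
    using linear_axis_expansion[OF linear_w, of \<xi> \<eta>] by simp
  let ?e = "\<lambda>i. axis i 1 :: real ^ 'n"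
  have "X x a (\<lambda>q. w (Ad q z) (Ad q y)) = X x a (\<lambda>q. \<Sum>i\<in>UNIV. Ad q y $ i * w (Ad q z) (?e i))"
    by (subst exp) simp
  also have "\<dots> = (\<Sum>i\<in>UNIV. Ad a y $ i * X x a (\<lambda>q. w (Ad q z) (?e i)) + w (Ad a z) (?e i) * X x a (\<lambda>q. Ad q y $ i))"
    by (simp only: tangent_sum[OF X_tangent[OF a] smooth_near_mult[OF sn snw]] tangent_mult[OF X_tangent[OF a] sn snw])
  also have "\<dots> = - w (Br x (Ad a z)) (Ad a y) - w (Ad a z) (Br x (Ad a y))"
    using exp[of "Br x (Ad a z)" "Ad a y"] exp[of "Ad a z" "Br x (Ad a y)"]
    by (simp add: X_of_w_Ad[OF a] X_of_Ad[OF a] sum.distrib sum_negf sum_subtractf mult.commute)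
  also have "\<dots> = w (Br (Ad a z) (Ad a y)) x"
    using cocycle[of x "Ad a z" "Ad a y"] w_skew[of "Ad a z" "Br x (Ad a y)"] by simp
  finally show ?thesis by (simp add: x form_Y_X[OF a] Br_Ad[OF a])
qed

section \<open>The one-forms of right invariant fields and their primitives\<close>

lemma form_chart_vector_expand:
  assumes d: "d \<in> atlas G" "q \<in> fst d" and u: "u \<in> tangent_at G q" and v: "v \<in> tangent_at G q"
  shows "\<Omega> q u v = (\<Sum>l\<in>UNIV. coords d v $ l * \<Omega> q u (chart_vector d q (axis l 1)))"
proof -
  have q: "q \<in> carrier G" using d chart_subset by blast
  have "\<Omega> q u (chart_vector d q (a *\<^sub>R \<xi> + b *\<^sub>R \<eta>)) = a * \<Omega> q u (chart_vector d q \<xi>) + b * \<Omega> q u (chart_vector d q \<eta>)" for a b \<xi> \<eta>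
  proof -
    have "chart_vector d q (a *\<^sub>R \<xi> + b *\<^sub>R \<eta>) = (\<lambda>f. a * chart_vector d q \<xi> f + b * chart_vector d q \<eta> f)"
      by (rule ext) (rule chart_vector_linear[OF d])
    then show ?thesis
      by (simp only: form_linear_right[OF q u chart_vector_tangent[OF d] chart_vector_tangent[OF d]])
  qed
  from this[of 1 _ 1] this[of _ _ 0 0] have "linear (\<lambda>\<xi>. \<Omega> q u (chart_vector d q \<xi>))"
    by (intro linearI) simp_all
  from linear_axis_expansion[OF this, of "coords d v"] show ?thesis
    using tangent_eq_chart_vector[OF v d] by simp
qed

definition form_coeff :: "('g, real ^ 'n) chart \<Rightarrow> real ^ 'n \<Rightarrow> 'n \<Rightarrow> 'g \<Rightarrow> real" where
  "form_coeff d z l q = \<Omega> q (Y z q) (chart_vector d q (axis l 1))"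

lemma form_coeff_X:
  assumes d: "d \<in> atlas G" "q \<in> fst d"
  shows "w (Ad q z) y = (\<Sum>l\<in>UNIV. X y q (\<lambda>r. snd d r $ l) * form_coeff d z l q)"
proof -
  have q: "q \<in> carrier G" using d chart_subset by blast
  show ?thesis
    using form_chart_vector_expand[OF d Y_tangent[OF q] X_tangent[OF q], of z y]
    by (simp add: form_Y_X[OF q] form_coeff_def coords_def)
qed

text \<open>Smoothness of the form is known on global fields, and coordinate fields are not global.
  The coefficients are therefore found as the solution of the system \<open>form_coeff_X\<close>:
  its matrix consists of the components of the left invariant frame and is invertible, and its
  right-hand side is smooth by \<open>smooth_w_Ad\<close>.\<close>

lemma smooth_form_coeff:
  assumes d: "d \<in> atlas G"
  shows "smooth_on (snd d ` fst d) (form_coeff d z l \<circ> chart_inv d)"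
  unfolding smooth_on_def
proof
  fix k
  note D = is_chartD[OF is_chart[OF d]]
  have id: "chart_inv d ` snd d ` fst d = fst d" using D(6) by force
  let ?e = "\<lambda>i. axis i 1 :: real ^ 'n"
  let ?N = "\<lambda>y. \<chi> j l. X (?e j) (chart_inv d y) (\<lambda>r. snd d r $ l)"
  let ?x = "\<lambda>y. \<chi> l. form_coeff d z l (chart_inv d y)"
  let ?b = "\<lambda>y. \<chi> j. w (Ad (chart_inv d y) z) (?e j)"
  have "Ck_on k (snd d ` fst d) (\<lambda>y. ?x y $ l)"
  proof (rule Ck_on_linear_solution[OF D(2)])
    fix i j
    have "smooth_fun_on (atlas G) (fst d) (\<lambda>q. X (?e i) q (\<lambda>r. snd d r $ j))"
      using vector_field_X smooth_fun_on_coord[OF d] D(1) chart_subset[OF d] unfolding vector_field_def Union_charts by blast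
    then have "smooth_on (snd d ` fst d) ((\<lambda>q. X (?e i) q (\<lambda>r. snd d r $ j)) \<circ> chart_inv d)"
      by (intro smooth_fun_on_in_chart[OF d]) (simp_all add: id)
    then show "Ck_on k (snd d ` fst d) (\<lambda>y. ?N y $ i $ j)" by (simp add: smooth_on_def o_def)
    have "smooth_on (snd d ` fst d) ((\<lambda>q. w (Ad q z) (?e i)) \<circ> chart_inv d)"
      using smooth_fun_on_subset[OF smooth_w_Ad chart_subset[OF d]]
      by (intro smooth_fun_on_in_chart[OF d]) (simp_all add: id)
    then show "Ck_on k (snd d ` fst d) (\<lambda>y. ?b y $ i)" by (simp add: smooth_on_def o_def)
  next
    fix y assume y: "y \<in> snd d ` fst d"
    let ?q = "chart_inv d y"
    have q: "?q \<in> fst d" "?q \<in> carrier G" using D(7)[OF y] chart_subset[OF d] by auto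
    show "?N y *v ?x y = ?b y"
      using form_coeff_X[OF d q(1), of z] by (simp add: matrix_vector_mult_def vec_eq_iff)
    have "transpose (?N y) *v \<xi> = coords d (X \<xi> ?q)" for \<xi>
      using X_expand[of \<xi> ?q] by (simp add: matrix_vector_mult_def transpose_def coords_def vec_eq_iff mult.commute)
    moreover have "inj (\<lambda>\<xi>. coords d (X \<xi> ?q))"
      using tangent_eq_chart_vector[OF X_tangent[OF q(2)] d q(1)] X_inject[OF q(2)] by (intro injI) metis
    ultimately have "inj ((*v) (transpose (?N y)))" by (simp add: inj_on_def)
    then have "det (matrix ((*v) (transpose (?N y)))) \<noteq> 0"
      by (simp only: det_nz_iff_inj[OF matrix_vector_mul_linear])
    then show "det (?N y) \<noteq> 0" by simp
  qed
  then show "Ck_on k (snd d ` fst d) (form_coeff d z l \<circ> chart_inv d)" by (simp add: o_def)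
qed

text \<open>The two coordinate vectors at the point are extended by left invariant fields
  \<open>X s\<close> and \<open>X t\<close>, which agree with the coordinate fields there only. They
  need not commute; their bracket contributes \<open>w (Ad q z) (Br s t)\<close>, and by the cocycle
  identity this is exactly the antisymmetrised derivative of \<open>Ad\<close>.\<close>

lemma form_coeff_closed:
  assumes d: "d \<in> atlas G" and y: "y \<in> snd d ` fst d"
  shows "dirderiv (form_coeff d z l \<circ> chart_inv d) (axis k 1) y = dirderiv (form_coeff d z k \<circ> chart_inv d) (axis l 1) y"
proof -
  note D = is_chartD[OF is_chart[OF d]]
  define q where "q = chart_inv d y"
  have q: "q \<in> fst d" "q \<in> carrier G" "snd d q = y" using D(7,8)[OF y] chart_subset[OF d] by (auto simp: q_def)
  let ?e = "\<lambda>i. axis i 1 :: real ^ 'n"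
  let ?c = "\<lambda>l r. snd d r $ l"
  obtain s where s: "chart_vector d q (?e k) = X s q" using X_surj[OF q(2) chart_vector_tangent[OF d q(1)]] .
  obtain t where t: "chart_vector d q (?e l) = X t q" using X_surj[OF q(2) chart_vector_tangent[OF d q(1)]] .
  have cs: "X s q (?c m) = ?e k $ m" and ct: "X t q (?c m) = ?e l $ m" for m
    using coords_chart_vector[OF d q(1), of "?e k"] coords_chart_vector[OF d q(1), of "?e l"]
    by (simp_all add: s t coords_def vec_eq_iff)
  have snB: "smooth_near (atlas G) q (form_coeff d z m)" for m
    using smooth_form_coeff[OF d] by (intro smooth_nearI[OF D(1) q(1)] smooth_fun_onI_chart[OF d D(1)]) auto
  have snX: "smooth_near (atlas G) q (\<lambda>r. X b r (?c m))" for b m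
    by (rule vector_field_smooth_near[OF vector_field_X q(2) smooth_near_coord[OF d q(1)]])
  have *: "- w (Br a (Ad q z)) b = (\<Sum>m\<in>UNIV. X b q (?c m) * X a q (form_coeff d z m)) +
      (\<Sum>m\<in>UNIV. form_coeff d z m q * X a q (\<lambda>r. X b r (?c m)))" for a b
  proof -
    have "- w (Br a (Ad q z)) b = X a q (\<lambda>r. \<Sum>m\<in>UNIV. X b r (?c m) * form_coeff d z m r)"
      unfolding X_of_w_Ad[OF q(2), symmetric]
      by (rule tangent_cong[OF X_tangent[OF q(2)] q(2) D(1) q(1)]) (rule form_coeff_X[OF d])
    also have "\<dots> = (\<Sum>m\<in>UNIV. X b q (?c m) * X a q (form_coeff d z m) + form_coeff d z m q * X a q (\<lambda>r. X b r (?c m)))"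
      by (simp only: tangent_sum[OF X_tangent[OF q(2)] smooth_near_mult[OF snX snB]] tangent_mult[OF X_tangent[OF q(2)] snX snB])
    finally show ?thesis by (simp add: sum.distrib)
  qed
  have "X s q (\<lambda>r. X t r (?c m)) - X t q (\<lambda>r. X s r (?c m)) = X (Br s t) q (?c m)" for m
    using smooth_near_coord[OF d q(1)] by (simp add: lie_bracket_X[OF q(2), symmetric] lie_bracket_def)
  then have "(\<Sum>m\<in>UNIV. form_coeff d z m q * X s q (\<lambda>r. X t r (?c m))) - (\<Sum>m\<in>UNIV. form_coeff d z m q * X t q (\<lambda>r. X s r (?c m)))
     = w (Ad q z) (Br s t)"
    unfolding form_coeff_X[OF d q(1)] by (simp add: sum_subtractf[symmetric] right_diff_distrib[symmetric] mult.commute)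
  moreover have "- w (Br s (Ad q z)) t + w (Br t (Ad q z)) s = w (Ad q z) (Br s t)"
    using cocycle[of s "Ad q z" t] w_skew[of "Ad q z" "Br s t"] Br_skew[of "Ad q z" t]
      linear_neg[OF linear_w_left[of s], of "Br t (Ad q z)"] by simp
  ultimately have "(\<Sum>m\<in>UNIV. X t q (?c m) * X s q (form_coeff d z m)) = (\<Sum>m\<in>UNIV. X s q (?c m) * X t q (form_coeff d z m))"
    using *[of s t] *[of t s] by linarith
  then have "X s q (form_coeff d z l) = X t q (form_coeff d z k)"
    unfolding cs ct by (simp add: axis_def if_distrib[of "\<lambda>x. x * _"] cong: if_cong)
  moreover have "X s q (form_coeff d z m) = dirderiv (form_coeff d z m \<circ> chart_inv d) (?e k) y"
    "X t q (form_coeff d z m) = dirderiv (form_coeff d z m \<circ> chart_inv d) (?e l) y" for m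
    using snB q(3) by (simp_all flip: s t add: chart_vector_def)
  ultimately show ?thesis by simp
qed

lemma local_primitive:
  assumes d: "d \<in> atlas G" and B: "ball c r \<subseteq> snd d ` fst d"
  obtains F where "smooth_fun_on (atlas G) (chart_inv d ` ball c r) F"
    "\<And>q v. q \<in> chart_inv d ` ball c r \<Longrightarrow> v \<in> tangent_at G q \<Longrightarrow> v F = \<Omega> q (Y z q) v"
proof -
  note D = is_chartD[OF is_chart[OF d]]
  let ?\<beta> = "\<lambda>l. form_coeff d z l \<circ> chart_inv d"
  have sm: "smooth_on (ball c r) (?\<beta> l)" for l
    by (rule smooth_on_subset[OF smooth_form_coeff[OF d] B])
  have cl: "dirderiv (?\<beta> i) (axis j 1) x = dirderiv (?\<beta> j) (axis i 1) x" if "x \<in> ball c r" for i j x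
    by (rule form_coeff_closed[OF d subsetD[OF B that]])
  obtain H where "H c = 0" and H: "\<And>x. x \<in> ball c r \<Longrightarrow> (H has_derivative (\<lambda>v. \<Sum>i\<in>UNIV. ?\<beta> i x * v $ i)) (at x)"
    by (rule Poincare_one_form[where \<beta> = ?\<beta>, OF sm cl]) (assumption, rule that)
  have smH: "smooth_on (ball c r) H"
    by (rule smooth_onI_derivative[OF open_ball H], assumption)
      (intro smooth_on_sum smooth_on_mult sm smooth_on_const open_ball)
  let ?W = "chart_inv d ` ball c r"
  have W: "?W \<subseteq> fst d" "open ?W" "snd d ` ?W = ball c r"
    using chart_inv_image[OF is_chart[OF d] B] open_chart_inv_image[OF is_chart[OF d] B open_ball] by auto
  have eq: "((\<lambda>q. H (snd d q)) \<circ> chart_inv d) y = H y" if "y \<in> ball c r" for y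
    using D(8)[OF subsetD[OF B that]] by simp
  have "smooth_on (snd d ` ?W) ((\<lambda>q. H (snd d q)) \<circ> chart_inv d)"
    unfolding W(3) by (rule smooth_on_cong[OF open_ball eq[symmetric] smH])
  then have smF: "smooth_fun_on (atlas G) ?W (\<lambda>q. H (snd d q))"
    by (intro smooth_fun_onI_chart[OF d W(2,1)])
  have "v (\<lambda>q. H (snd d q)) = \<Omega> q (Y z q) v" if q: "q \<in> ?W" and v: "v \<in> tangent_at G q" for q v
  proof -
    have qd: "q \<in> fst d" "snd d q \<in> ball c r" "q \<in> carrier G" using q W chart_subset[OF d] by auto
    have "((\<lambda>q. H (snd d q)) \<circ> chart_inv d has_derivative (\<lambda>v. \<Sum>i\<in>UNIV. ?\<beta> i (snd d q) * v $ i)) (at (snd d q))"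
      by (rule has_derivative_transform_within_open[OF H[OF qd(2)] open_ball qd(2)]) (simp only: eq)
    from frechet_derivative_at[OF this, symmetric]
    have "v (\<lambda>q. H (snd d q)) = (\<Sum>i\<in>UNIV. ?\<beta> i (snd d q) * coords d v $ i)"
      using tangent_eq_dirderiv[OF v d qd(1) smooth_nearI[OF W(2) q smF]] by simp
    also have "\<dots> = \<Omega> q (Y z q) v"
      using form_chart_vector_expand[OF d qd(1) Y_tangent[OF qd(3)] v, of z] D(6)[OF qd(1)]
      by (simp add: form_coeff_def mult.commute)
    finally show ?thesis .
  qed
  with smF show ?thesis using that by blast
qed

text \<open>The indicator function of the complement of the group absorbs the arbitrary values of a vector field
  outside the group.\<close>

lemma tensorial_vanishes:
  assumes V: "vector_field (atlas G) V" and p: "p \<in> carrier G"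
    and add: "\<And>V W. vector_field (atlas G) V \<Longrightarrow> vector_field (atlas G) W \<Longrightarrow> T (\<lambda>q f. V q f + W q f) = T V + T W"
    and mult: "\<And>h V. smooth_fun_on (atlas G) (carrier G) h \<Longrightarrow> vector_field (atlas G) V \<Longrightarrow>
      T (\<lambda>q f. h q * V q f) = h p * T V"
    and frame: "\<And>i. T (X (axis i 1)) = (0::real)"
  shows "T V = 0"
proof -
  \<comment> \<open>Pairing with \<open>dual i\<close> reads off component \<open>i\<close>, so
    these are the coefficients of \<open>V\<close> in the left invariant frame.\<close>
  define h where "h i q = (if q \<in> carrier G then \<Omega> q (X (dual i) q) (V q) else 0)" for i q
  define k :: "'g \<Rightarrow> real" where "k q = (if q \<in> carrier G then 0 else 1)" for q
  have h: "smooth_fun_on (atlas G) (carrier G) (h i)" for i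
    by (rule smooth_fun_on_cong[OF open_M _ smooth_form[OF vector_field_X V]]) (simp add: h_def)
  have k: "smooth_fun_on (atlas G) (carrier G) k"
    by (rule smooth_fun_on_cong[OF open_M _ smooth_fun_on_const[of _ 0]]) (simp add: k_def)
  let ?S = "\<lambda>I q f. \<Sum>i\<in>I. h i q * X (axis i 1) q f"
  have vS: "vector_field (atlas G) (?S I)" for I
    by (intro vector_field_sum vector_field_mult h vector_field_X)
  have "T (?S I) = 0" if "finite I" for I
    using that
  proof (induction I rule: finite_induct)
    case empty
    show ?case using mult[OF smooth_fun_on_const[of _ 0] V] by simp
  next
    case (insert i I)
    have "T (\<lambda>q f. h i q * X (axis i 1) q f + ?S I q f) = T (\<lambda>q f. h i q * X (axis i 1) q f) + T (?S I)"
      by (rule add[OF vector_field_mult[OF h vector_field_X] vS])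
    then show ?case using insert mult[OF h vector_field_X] by (simp add: frame)
  qed
  then have "T (?S UNIV) = 0" by simp
  moreover have "T (\<lambda>q f. k q * V q f) = 0" using mult[OF k V] p by (simp add: k_def)
  moreover have "V = (\<lambda>q f. ?S UNIV q f + k q * V q f)"
  proof (intro ext)
    fix q f
    show "V q f = ?S UNIV q f + k q * V q f"
    proof (cases "q \<in> carrier G")
      case True
      obtain \<xi> where \<xi>: "V q = X \<xi> q" using X_surj[OF True vector_field_tangent[OF V True]] .
      have "h i q = \<xi> $ i" for i using True by (simp add: h_def \<xi> form_X w_dual)
      then show ?thesis using True X_expand[of \<xi> q f] by (simp add: \<xi> k_def)
    qed (simp add: h_def k_def)
  qed
  ultimately show ?thesis using add[OF vS vector_field_mult[OF k V], of UNIV] by simp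
qed

section \<open>Local momentum maps and their normalisation\<close>

lemma form_Y_expand:
  assumes q: "q \<in> carrier G" and v: "v \<in> tangent_at G q"
  shows "\<Omega> q (Y z q) v = (\<Sum>i\<in>UNIV. z $ i * \<Omega> q (Y (axis i 1) q) v)"
proof -
  obtain \<eta> where \<eta>: "v = X \<eta> q" using X_surj[OF q v] .
  have "linear (\<lambda>z. w (Ad q z) \<eta>)"
    using linear_compose[OF linear_Ad[OF q] linear_w_left] by (simp add: o_def)
  from linear_axis_expansion[OF this, of z] show ?thesis by (simp add: \<eta> form_Y_X[OF q])
qed

text \<open>The values of \<open>J\<close> are elements of the dual of the Lie algebra, written in
  the standard basis: the function \<open>J q \<bullet> z\<close> is the Hamiltonian of
  \<open>Y z\<close>, with the convention that its differential is
  \<open>\<Omega> q (Y z q)\<close>.\<close>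

definition moment_on :: "'g set \<Rightarrow> ('g \<Rightarrow> real ^ 'n) \<Rightarrow> bool" where
  "moment_on W J \<longleftrightarrow> open W \<and> W \<subseteq> carrier G \<and> (\<forall>i. smooth_fun_on (atlas G) W (\<lambda>q. J q $ i)) \<and>
     (\<forall>i. \<forall>q\<in>W. \<forall>v\<in>tangent_at G q. v (\<lambda>q. J q $ i) = \<Omega> q (Y (axis i 1) q) v)"

lemma moment_on_derivation:
  "moment_on W J \<Longrightarrow> q \<in> W \<Longrightarrow> v \<in> tangent_at G q \<Longrightarrow> v (\<lambda>q. J q $ i) = \<Omega> q (Y (axis i 1) q) v"
  by (simp add: moment_on_def)

lemma smooth_w_Ad_Ad: "smooth_fun_on (atlas G) (carrier G) (\<lambda>q. w (Ad q z) (Ad q y))"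
  by (rule smooth_fun_on_cong[OF open_M _ smooth_form[OF vector_field_Y[of z] vector_field_Y[of y]]])
    (simp add: form_X flip: X_Ad)

text \<open>By \<open>X_of_w_Ad_Ad\<close> both terms have the differential that belongs to
  \<open>Br z y\<close>, so their difference is constant on the image of a ball. This is
  infinitesimal equivariance of \<open>J\<close> up to a constant depending on \<open>z\<close> and
  \<open>y\<close>.\<close>

lemma moment_equivariant:
  assumes d: "d \<in> atlas G" and B: "ball c r \<subseteq> snd d ` fst d" and J: "moment_on (chart_inv d ` ball c r) J"
    and pq: "p \<in> chart_inv d ` ball c r" "q \<in> chart_inv d ` ball c r"
  shows "w (Ad p z) (Ad p y) - J p \<bullet> Br z y = w (Ad q z) (Ad q y) - J q \<bullet> Br z y"
proof -
  let ?W = "chart_inv d ` ball c r"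
  have W: "open ?W" "?W \<subseteq> carrier G" using J by (auto simp: moment_on_def)
  have smJ: "smooth_fun_on (atlas G) ?W (\<lambda>q. J q $ i)" for i using J by (auto simp: moment_on_def)
  let ?j = "\<lambda>q. \<Sum>i\<in>UNIV. Br z y $ i * J q $ i"
  let ?h = "\<lambda>q. w (Ad q z) (Ad q y) + (-1) * ?j q"
  have smj: "smooth_fun_on (atlas G) ?W ?j"
    by (intro smooth_fun_on_sum smooth_fun_on_mult smooth_fun_on_const W smJ)
  have smf: "smooth_fun_on (atlas G) ?W (\<lambda>q. w (Ad q z) (Ad q y))"
    by (rule smooth_fun_on_subset[OF smooth_w_Ad_Ad W(2)])
  have "?h p = ?h q"
  proof (rule constant_if_derivations_vanish[OF d B open_ball convex_ball _ _ pq])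
    show "smooth_fun_on (atlas G) ?W ?h"
      by (intro smooth_fun_on_add smooth_fun_on_mult smooth_fun_on_const W smj smf)
    fix q v assume q: "q \<in> ?W" and v: "v \<in> tangent_at G q"
    have qG: "q \<in> carrier G" using q W by blast
    note sn = smooth_nearI[OF W(1) q]
    have "v ?j = (\<Sum>i\<in>UNIV. Br z y $ i * v (\<lambda>q. J q $ i))"
      by (simp only: tangent_sum[OF v smooth_near_mult[OF smooth_near_const sn[OF smJ]]] tangent_scale[OF v sn[OF smJ]])
    also have "\<dots> = \<Omega> q (Y (Br z y) q) v"
      unfolding form_Y_expand[OF qG v, of "Br z y"] moment_on_derivation[OF J q v] ..
    finally have "v ?j = v (\<lambda>q. w (Ad q z) (Ad q y))" by (simp add: X_of_w_Ad_Ad[OF qG v])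
    then show "v ?h = 0"
      by (simp only: tangent_add[OF v sn[OF smf] smooth_near_mult[OF smooth_near_const sn[OF smj]]] tangent_scale[OF v sn[OF smj]])
  qed
  then show ?thesis by (simp add: inner_vec_def mult.commute)
qed

lemma moment_exists:
  assumes p: "p \<in> carrier G"
  obtains d r J where "d \<in> atlas G" "p \<in> fst d" "r > 0" "ball (snd d p) r \<subseteq> snd d ` fst d"
    "p \<in> chart_inv d ` ball (snd d p) r" "moment_on (chart_inv d ` ball (snd d p) r) J"
proof -
  obtain d where d: "d \<in> atlas G" "p \<in> fst d" using chart_at[OF p] .
  note D = is_chartD[OF is_chart[OF d(1)]]
  obtain r where r: "r > 0" "ball (snd d p) r \<subseteq> snd d ` fst d" using D(2) d(2) openE by blast
  let ?W = "chart_inv d ` ball (snd d p) r"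
  have "\<exists>F. smooth_fun_on (atlas G) ?W F \<and> (\<forall>q\<in>?W. \<forall>v\<in>tangent_at G q. v F = \<Omega> q (Y (axis i 1) q) v)" for i
    using local_primitive[OF d(1) r(2)] by metis
  then obtain F where F: "\<And>i. smooth_fun_on (atlas G) ?W (F i)"
    "\<And>i q v. q \<in> ?W \<Longrightarrow> v \<in> tangent_at G q \<Longrightarrow> v (F i) = \<Omega> q (Y (axis i 1) q) v" by metis
  have W: "open ?W" "?W \<subseteq> carrier G"
    using open_chart_inv_image[OF is_chart[OF d(1)] r(2) open_ball] chart_inv_image(1)[OF is_chart[OF d(1)] r(2)]
      chart_subset[OF d(1)] by auto
  have "moment_on ?W (\<lambda>q. \<chi> i. F i q)" using F W by (simp add: moment_on_def)
  moreover have "p \<in> ?W" using r(1) D(6)[OF d(2)] by (intro image_eqI[of _ _ "snd d p"]) simp_all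
  ultimately show ?thesis using that d r by blast
qed

lemma moment_shift:
  assumes "moment_on W J"
  shows "moment_on W (\<lambda>q. J q + k)"
proof -
  have sm: "smooth_fun_on (atlas G) W (\<lambda>q. J q $ i)" and W: "open W" for i using assms by (auto simp: moment_on_def)
  have "v (\<lambda>q. J q $ i + k $ i) = v (\<lambda>q. J q $ i)" if "q \<in> W" "v \<in> tangent_at G q" for v q i
    using tangent_add[OF that(2) smooth_nearI[OF W that(1) sm] smooth_near_const] tangent_const[OF that(2)] by simp
  then show ?thesis
    using assms smooth_fun_on_add[OF W sm smooth_fun_on_const] by (simp add: moment_on_def)
qed

text \<open>The pullback of the cocycle \<open>w\<close> by \<open>Ad a\<close> is cohomologous to \<open>w\<close>: the points \<open>a\<close> for which it is
  form a set that is open and closed, because of \<open>moment_equivariant\<close>.\<close>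

lemma cohomologous:
  assumes conn: "connected (carrier G)" and p: "p \<in> carrier G"
  shows "\<exists>k. \<forall>z y. w (Ad p z) (Ad p y) = w z y + k \<bullet> Br z y"
proof (rule connected_induction_simple[OF conn one_closed p,
    of "\<lambda>p. \<exists>k. \<forall>z y. w (Ad p z) (Ad p y) = w z y + k \<bullet> Br z y"])
  show "\<exists>k. \<forall>z y. w (Ad \<one> z) (Ad \<one> y) = w z y + k \<bullet> Br z y"
    by (rule exI[of _ 0]) (simp add: Ad_one)
  fix a assume a: "a \<in> carrier G"
  obtain d r J where d: "d \<in> atlas G" "ball (snd d a) r \<subseteq> snd d ` fst d"
    "a \<in> chart_inv d ` ball (snd d a) r" "moment_on (chart_inv d ` ball (snd d a) r) J"
    using moment_exists[OF a] by metis
  let ?W = "chart_inv d ` ball (snd d a) r"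
  \<comment> \<open>On one ball the pullbacks at \<open>x\<close> and at \<open>y\<close> differ by
    the coboundary of \<open>J y - J x\<close>, so the property passes from one point to the
    other.\<close>
  have "\<exists>k. \<forall>z y'. w (Ad y z) (Ad y y') = w z y' + k \<bullet> Br z y'"
    if xy: "x \<in> ?W" "y \<in> ?W" and k: "\<forall>z y'. w (Ad x z) (Ad x y') = w z y' + k \<bullet> Br z y'" for x y k
  proof (intro exI allI)
    fix z y'
    show "w (Ad y z) (Ad y y') = w z y' + (k + J y - J x) \<bullet> Br z y'"
      using moment_equivariant[OF d(1,2,4) xy, of z y'] k by (simp add: inner_add_left inner_diff_left)
  qed
  moreover have "openin (top_of_set (carrier G)) ?W"
    using d(4) open_M by (simp add: moment_on_def openin_open_eq)
  ultimately show "\<exists>T. openin (top_of_set (carrier G)) T \<and> a \<in> T \<and>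
      (\<forall>x\<in>T. \<forall>y\<in>T. (\<exists>k. \<forall>z y'. w (Ad x z) (Ad x y') = w z y' + k \<bullet> Br z y') \<longrightarrow>
        (\<exists>k. \<forall>z y'. w (Ad y z) (Ad y y') = w z y' + k \<bullet> Br z y'))"
    using d(3) by (intro exI[of _ ?W]) blast
qed

text \<open>A momentum map may be changed by an additive constant vector. The shift
  \<open>k - J p\<close> turns the constant of \<open>moment_equivariant\<close> into
  \<open>w z y\<close> itself; that a suitable \<open>k\<close> exists at \<open>p\<close> is the
  content of \<open>cohomologous\<close>.\<close>

lemma moment_normalized:
  assumes conn: "connected (carrier G)" and p: "p \<in> carrier G"
  obtains d r J where "d \<in> atlas G" "p \<in> fst d" "r > 0" "ball (snd d p) r \<subseteq> snd d ` fst d"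
    "p \<in> chart_inv d ` ball (snd d p) r" "moment_on (chart_inv d ` ball (snd d p) r) J"
    "\<And>q z y. q \<in> chart_inv d ` ball (snd d p) r \<Longrightarrow> w (Ad q z) (Ad q y) = w z y + J q \<bullet> Br z y"
proof -
  obtain d r J where d: "d \<in> atlas G" "p \<in> fst d" "r > 0" "ball (snd d p) r \<subseteq> snd d ` fst d"
    "p \<in> chart_inv d ` ball (snd d p) r" and J: "moment_on (chart_inv d ` ball (snd d p) r) J"
    using moment_exists[OF p] .
  obtain k where k: "\<And>z y. w (Ad p z) (Ad p y) = w z y + k \<bullet> Br z y" using cohomologous[OF assms] by blast
  have "w (Ad q z) (Ad q y) = w z y + (J q + (k - J p)) \<bullet> Br z y"
    if "q \<in> chart_inv d ` ball (snd d p) r" for q z y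
    using moment_equivariant[OF d(1,4) J that d(5), of z y] k[of z y]
    by (simp add: inner_add_left inner_diff_left)
  with that[OF d moment_shift[OF J]] show ?thesis by blast
qed

text \<open>A vector annihilated by all components of \<open>J\<close> pairs to zero with every
  right invariant vector. These span the tangent space, since \<open>Ad q\<close> is onto, and the
  form is nondegenerate.\<close>

lemma moment_immersion:
  assumes J: "moment_on W J" and q: "q \<in> W" and v: "v \<in> tangent_at G q" and zero: "\<And>i. v (\<lambda>q. J q $ i) = 0"
  shows "v = (\<lambda>f. 0)"
proof -
  have qG: "q \<in> carrier G" using J q by (auto simp: moment_on_def)
  obtain \<eta> where \<eta>: "v = X \<eta> q" using X_surj[OF qG v] .
  have "w (Ad q z) \<eta> = 0" for z
    using form_Y_expand[OF qG v, of z] zero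
    by (simp add: moment_on_derivation[OF J q v, symmetric]) (simp add: \<eta> form_Y_X[OF qG])
  moreover have "surj (Ad q)"
    using linear_injective_imp_surjective[OF linear_Ad[OF qG] inj_Ad[OF qG]] by simp
  ultimately have "w \<eta> \<zeta> = 0" for \<zeta>
    using w_skew[of \<eta> \<zeta>] by (metis neg_0_equal_iff_equal surjD)
  then have "\<eta> = 0" by (rule w_nondegenerate)
  then show ?thesis using X_linear[of 0 0 0 0] by (simp add: \<eta>)
qed

lemma moment_on_subset: "moment_on W J \<Longrightarrow> open U \<Longrightarrow> U \<subseteq> W \<Longrightarrow> moment_on U J"
  using smooth_fun_on_subset unfolding moment_on_def by (meson subset_iff)

text \<open>\<open>moment_immersion\<close> makes the derivative of \<open>J\<close> in a chart
  injective throughout the ball, so the inverse function theorem applies. Transitions to arbitrary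
  charts of the atlas are factored through \<open>d\<close>.\<close>

lemma moment_chart:
  assumes d: "d \<in> atlas G" and B: "ball c r \<subseteq> snd d ` fst d" and J: "moment_on (chart_inv d ` ball c r) J"
    and p: "p \<in> chart_inv d ` ball c r"
  obtains U where "p \<in> U" "U \<subseteq> chart_inv d ` ball c r" "open U" "(U, J) \<in> maximal_atlas (atlas G)"
proof -
  note D = is_chartD[OF is_chart[OF d]]
  let ?W = "chart_inv d ` ball c r" and ?\<phi> = "J \<circ> chart_inv d"
  have W: "?W \<subseteq> fst d" "snd d ` ?W = ball c r"
    using chart_inv_image[OF is_chart[OF d] B] by auto
  have smJ: "smooth_fun_on (atlas G) ?W (\<lambda>q. J q $ i)" for i using J by (simp add: moment_on_def)
  have sm: "smooth_on (ball c r) ?\<phi>"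
    using smooth_fun_on_in_chart[OF d B smJ] by (simp add: smooth_on_vec_nth_iff[OF open_ball] o_def)
  have inj: "\<xi> = 0" if y: "y \<in> ball c r" and z: "dirderiv ?\<phi> \<xi> y = 0" for y \<xi>
  proof -
    define q where "q = chart_inv d y"
    have q: "q \<in> ?W" "q \<in> fst d" "snd d q = y" using y W(1) D(8)[OF subsetD[OF B y]] by (auto simp: q_def)
    have "chart_vector d q \<xi> (\<lambda>q. J q $ i) = 0" for i
    proof -
      have "((\<lambda>x. ?\<phi> x $ i) has_derivative (\<lambda>v. dirderiv ?\<phi> v y $ i)) (at y)"
        by (rule bounded_linear.has_derivative[OF bounded_linear_vec_nth smooth_on_has_derivative[OF sm y]])
      from frechet_derivative_at[OF this, symmetric] z
      show ?thesis by (simp add: chart_vector_def q(3) o_def)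
    qed
    then have "chart_vector d q \<xi> = (\<lambda>f. 0)"
      by (rule moment_immersion[OF J q(1) chart_vector_tangent[OF d q(2)]])
    then have "coords d (chart_vector d q \<xi>) = 0" by (simp add: coords_def vec_eq_iff)
    then show ?thesis by (simp add: coords_chart_vector[OF d q(2)])
  qed
  have dp: "snd d p \<in> ball c r" using p W(2) by blast
  obtain U0 g where U0: "open U0" "U0 \<subseteq> ball c r" "snd d p \<in> U0" "open (?\<phi> ` U0)"
    and hom: "homeomorphism U0 (?\<phi> ` U0) ?\<phi> g" and smg: "smooth_on (?\<phi> ` U0) g"
    by (rule smooth_inverse_function[OF open_ball sm dp inj]) (assumption, assumption, rule that)
  define U where "U = chart_inv d ` U0"
  have U0d: "U0 \<subseteq> snd d ` fst d" using U0(2) B by blast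
  have "p \<in> U" unfolding U_def using U0(3) D(6)[of p] W(1) p by (intro image_eqI[of _ _ "snd d p"]) auto
  moreover have "U \<subseteq> ?W" unfolding U_def by (rule image_mono[OF U0(2)])
  ultimately have U: "open U" "U \<subseteq> ?W" "p \<in> U" "U \<subseteq> fst d" "snd d ` U = U0"
    using open_chart_inv_image[OF is_chart[OF d] U0d U0(1)] W(1)
      chart_inv_image(2)[OF is_chart[OF d] U0d] by (simp_all add: U_def)
  have JU: "J ` U = ?\<phi> ` U0" by (simp add: U_def image_comp)
  have dhom: "homeomorphism U U0 (snd d) (chart_inv d)"
  proof (rule homeomorphismI)
    show "continuous_on U (snd d)" "continuous_on U0 (chart_inv d)"
      using continuous_on_subset[OF D(4) U(4)] continuous_on_subset[OF D(5) U0d] by auto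
    show "snd d ` U \<subseteq> U0" "chart_inv d ` U0 \<subseteq> U" using U(5) by (auto simp: U_def)
    show "chart_inv d (snd d q) = q" if "q \<in> U" for q using D(6) U(4) that by blast
    show "snd d (chart_inv d y) = y" if "y \<in> U0" for y using D(8) U0d that by blast
  qed
  have h1: "homeomorphism U (?\<phi> ` U0) (?\<phi> \<circ> snd d) (chart_inv d \<circ> g)"
    by (rule homeomorphism_compose[OF dhom hom])
  have Jeq: "(?\<phi> \<circ> snd d) q = J q" if "q \<in> U" for q using D(6) U(4) that by auto
  have injJ: "inj_on J U"
    using h1 Jeq unfolding homeomorphism_def by (metis inj_on_inverseI)
  \<comment> \<open>Charts and transitions are phrased with \<open>inv_into\<close>; on the image of
    \<open>J\<close> it coincides with the explicit inverse, whose smoothness is known.\<close>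
  have inv: "inv_into U J y = (chart_inv d \<circ> g) y" if "y \<in> J ` U" for y
  proof (rule inv_into_f_eq[OF injJ])
    show "(chart_inv d \<circ> g) y \<in> U" using h1 that unfolding homeomorphism_def JU by blast
    then show "J ((chart_inv d \<circ> g) y) = y" using h1 that Jeq unfolding homeomorphism_def JU by metis
  qed
  have "homeomorphism U (J ` U) J (inv_into U J)"
  proof (rule homeomorphism_cong[OF h1 refl JU])
    show "J q = (?\<phi> \<circ> snd d) q" if "q \<in> U" for q using Jeq[OF that] ..
    show "inv_into U J y = (chart_inv d \<circ> g) y" if "y \<in> ?\<phi> ` U0" for y using that unfolding JU[symmetric] by (rule inv)
  qed
  moreover have "open (J ` U)" unfolding JU by (rule U0(4))
  ultimately have chart: "is_chart (U, J)" using U(1) by (simp add: is_chart_def)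
  have "smooth_transition (U, J) e" if e: "e \<in> atlas G" for e
  proof -
    have op: "open (J ` (U \<inter> fst e))"
      using open_chart_image[OF chart is_chartD(1)[OF is_chart[OF e]]] by simp
    have tr: "smooth_on (snd d ` (fst d \<inter> fst e)) (snd e \<circ> chart_inv d)"
      using smooth_atlas d e by (simp add: smooth_atlas_def smooth_transition_def)
    have gJ: "g (J q) = snd d q" if "q \<in> U" for q
      using hom Jeq[OF that] that U(5) unfolding homeomorphism_def by (metis comp_apply image_eqI)
    have "smooth_on (J ` (U \<inter> fst e)) ((snd e \<circ> chart_inv d) \<circ> g)"
    proof (rule smooth_on_compose[OF op open_chart_image[OF is_chart[OF d] is_chartD(1)[OF is_chart[OF e]]] _ _ tr])
      show "g ` J ` (U \<inter> fst e) \<subseteq> snd d ` (fst d \<inter> fst e)" using gJ U(4) by auto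
      show "smooth_on (J ` (U \<inter> fst e)) g" using JU by (intro smooth_on_subset[OF smg]) auto
    qed
    then have "smooth_on (J ` (U \<inter> fst e)) (snd e \<circ> inv_into U J)"
    proof (rule smooth_on_cong[OF op, rotated])
      fix y assume "y \<in> J ` (U \<inter> fst e)"
      then have "y \<in> J ` U" by blast
      then show "((snd e \<circ> chart_inv d) \<circ> g) y = (snd e \<circ> inv_into U J) y" by (simp only: inv comp_apply)
    qed
    then show ?thesis by (simp add: smooth_transition_def)
  qed
  moreover have "smooth_transition e (U, J)" if e: "e \<in> atlas G" for e
  proof -
    have "smooth_on (snd e ` (fst e \<inter> U)) ((\<lambda>q. J q $ i) \<circ> chart_inv e)" for i
      using smooth_fun_on_subset[OF smJ U(2)] e by (simp add: smooth_fun_on_def)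
    then have "smooth_on (snd e ` (fst e \<inter> U)) (J \<circ> chart_inv e)"
      by (simp add: smooth_on_vec_nth_iff[OF open_chart_image[OF is_chart[OF e] U(1)]] o_def)
    then show ?thesis by (simp add: smooth_transition_def)
  qed
  ultimately have "(U, J) \<in> maximal_atlas (atlas G)"
    using chart subset_trans[OF U(4) chart_subset[OF d]] by (simp add: maximal_atlas_def)
  then show ?thesis using that U by blast
qed

section \<open>Momentum components are affine coordinates\<close>

lemma moment_affine:
  assumes aff: "symplectic_affine_structure G \<Omega> D" and J: "moment_on U J"
    and V: "vector_field (atlas G) V" and W: "vector_field (atlas G) W" and q: "q \<in> U"
  shows "D V W q (\<lambda>r. J r $ i) = V q (\<lambda>r. W r (\<lambda>r. J r $ i))"
proof -
  let ?x = "\<lambda>r. J r $ i"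
  let ?e = "\<lambda>i. axis i 1 :: real ^ 'n"
  have U: "open U" "U \<subseteq> carrier G" and qG: "q \<in> carrier G" using J q by (auto simp: moment_on_def)
  have snx: "smooth_near (atlas G) q ?x" using J q by (intro smooth_nearI[OF U(1)]) (auto simp: moment_on_def)
  have dx: "v ?x = \<Omega> r (Y (?e i) r) v" if "r \<in> U" "v \<in> tangent_at G r" for r v
    by (rule moment_on_derivation[OF J that])
  have conn: "affine_connection (atlas G) D" using aff by (simp add: symplectic_affine_structure_def)
  have D_vf: "vector_field (atlas G) (D V W)" if "vector_field (atlas G) V" "vector_field (atlas G) W" for V W
    using conn that by (simp add: affine_connection_def)
  have D_add: "D (\<lambda>q f. V q f + V' q f) W q = (\<lambda>f. D V W q f + D V' W q f)"
    "D W (\<lambda>q f. V q f + V' q f) q = (\<lambda>f. D W V q f + D W V' q f)"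
    if "vector_field (atlas G) V" "vector_field (atlas G) V'" "vector_field (atlas G) W" for V V' W
    using conn that qG unfolding affine_connection_def Union_charts by blast+
  have D_mult: "D (\<lambda>q f. h q * V q f) W q = (\<lambda>f. h q * D V W q f)"
    "D W (\<lambda>q f. h q * V q f) q = (\<lambda>f. h q * D W V q f + W q h * V q f)"
    if "smooth_fun_on (atlas G) (carrier G) h" "vector_field (atlas G) V" "vector_field (atlas G) W" for h V W
    using conn that qG unfolding affine_connection_def Union_charts by blast+
  \<comment> \<open>On the frame both sides equal \<open>w (?e k) (Br (?e j) ?Z)\<close>, the left
    one by the condition defining the connection and the right one by the derivative of
    \<open>Ad\<close>. This is the parallelism of the one-form.\<close>
  have frame: "D (X (?e j)) (X (?e k)) q ?x = X (?e j) q (\<lambda>r. X (?e k) r ?x)" for j k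
  proof -
    let ?Z = "Ad q (?e i)"
    have v: "D (X (?e j)) (X (?e k)) q \<in> tangent_at G q"
      by (intro vector_field_tangent D_vf vector_field_X qG)
    \<comment> \<open>The third vector in the defining condition may be adapted to the fixed point
      \<open>q\<close>: the left invariant field of \<open>?Z\<close> agrees with
      \<open>Y (?e i)\<close> at \<open>q\<close>.\<close>
    have key: "\<Omega> q (D (X (?e j)) (X (?e k)) q) (X ?Z q) = - \<Omega> q (X (?e k) q) (lie_bracket (atlas G) (X (?e j)) (X ?Z) q)"
      using aff qG E_in unfolding symplectic_affine_structure_def X_def by blast
    have "D (X (?e j)) (X (?e k)) q ?x = \<Omega> q (X ?Z q) (D (X (?e j)) (X (?e k)) q)"
      using dx[OF q v] by (simp add: X_Ad[OF qG])
    also have "\<dots> = w (?e k) (Br (?e j) ?Z)"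
      using key form_skew[OF qG X_tangent[OF qG] v] by (simp add: lie_bracket_X[OF qG] form_X[OF qG])
    also have "\<dots> = X (?e j) q (\<lambda>r. w (Ad r (?e i)) (?e k))"
      by (simp add: X_of_w_Ad[OF qG] flip: w_skew)
    also have "\<dots> = X (?e j) q (\<lambda>r. X (?e k) r ?x)"
    proof (rule tangent_cong[OF X_tangent[OF qG] qG U(1) q])
      fix r assume "r \<in> U" "r \<in> carrier G"
      then show "w (Ad r (?e i)) (?e k) = X (?e k) r ?x" by (simp add: dx X_tangent form_Y_X)
    qed
    finally show ?thesis .
  qed
  \<comment> \<open>In the differentiated field both terms satisfy the same Leibniz rule, so the
    derivative of the factor cancels and the difference is function-linear. In the other field each
    term is function-linear by itself.\<close>
  have left: "D (X (?e j)) W q ?x - X (?e j) q (\<lambda>r. W r ?x) = 0" for j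
  proof (rule tensorial_vanishes[OF W qG])
    note T = X_tangent[OF qG, of "?e j"]
    fix V W assume V: "vector_field (atlas G) V" and W: "vector_field (atlas G) W"
    show "D (X (?e j)) (\<lambda>q f. V q f + W q f) q ?x - X (?e j) q (\<lambda>r. V r ?x + W r ?x) =
      (D (X (?e j)) V q ?x - X (?e j) q (\<lambda>r. V r ?x)) + (D (X (?e j)) W q ?x - X (?e j) q (\<lambda>r. W r ?x))"
      by (simp add: D_add(2)[OF V W vector_field_X]
          tangent_add[OF T vector_field_smooth_near[OF V qG snx] vector_field_smooth_near[OF W qG snx]])
  next
    note T = X_tangent[OF qG, of "?e j"]
    fix h V assume h: "smooth_fun_on (atlas G) (carrier G) h" and V: "vector_field (atlas G) V"
    show "D (X (?e j)) (\<lambda>q f. h q * V q f) q ?x - X (?e j) q (\<lambda>r. h r * V r ?x) =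
      h q * (D (X (?e j)) V q ?x - X (?e j) q (\<lambda>r. V r ?x))"
      by (simp add: D_mult(2)[OF h V vector_field_X] algebra_simps
          tangent_mult[OF T smooth_nearI[OF open_M qG h] vector_field_smooth_near[OF V qG snx]])
  qed (simp add: frame)
  have "D V W q ?x - V q (\<lambda>r. W r ?x) = 0"
  proof (rule tensorial_vanishes[OF V qG])
    fix V V' assume V: "vector_field (atlas G) V" "vector_field (atlas G) V'"
    show "D (\<lambda>q f. V q f + V' q f) W q ?x - (V q (\<lambda>r. W r ?x) + V' q (\<lambda>r. W r ?x)) =
      (D V W q ?x - V q (\<lambda>r. W r ?x)) + (D V' W q ?x - V' q (\<lambda>r. W r ?x))"
      by (simp add: D_add(1)[OF V W])
  next
    fix h V assume h: "smooth_fun_on (atlas G) (carrier G) h" and V: "vector_field (atlas G) V"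
    show "D (\<lambda>q f. h q * V q f) W q ?x - h q * V q (\<lambda>r. W r ?x) = h q * (D V W q ?x - V q (\<lambda>r. W r ?x))"
      by (simp add: D_mult(1)[OF h V W] algebra_simps)
  qed (use left in simp)
  then show ?thesis by simp
qed

section \<open>The Poisson bracket of the momentum components\<close>

lemma r_tensor_eq:
  assumes "\<And>\<eta>. \<alpha> (E \<eta>) = w \<xi> \<eta>" "\<alpha> \<in> extensional (lie_algebra G)"
  shows "r_tensor G \<Omega> \<alpha> \<beta> = \<beta> (E \<xi>)"
proof -
  have qE: "q_map G \<Omega> (E \<xi>) (E \<eta>) = w \<xi> \<eta>" for \<xi> \<eta>
    by (simp add: q_map_def E_in w_def)
  \<comment> \<open>Inverting \<open>q_map\<close> requires equality of functionals on the whole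
    type; outside the Lie algebra it is supplied by extensionality.\<close>
  have \<alpha>: "\<alpha> = q_map G \<Omega> (E \<xi>)"
  proof (rule extensionalityI[OF assms(2)])
    show "q_map G \<Omega> (E \<xi>) \<in> extensional (lie_algebra G)" by (simp add: q_map_def)
    fix x assume "x \<in> lie_algebra G"
    then show "\<alpha> x = q_map G \<Omega> (E \<xi>) x" using assms(1)[of "E_inv x"] qE[of \<xi> "E_inv x"] by (simp add: E_E_inv)
  qed
  have "inj_on (q_map G \<Omega>) (lie_algebra G)"
  proof (rule inj_onI)
    fix x y assume xy: "x \<in> lie_algebra G" "y \<in> lie_algebra G" "q_map G \<Omega> x = q_map G \<Omega> y"
    then have "w (E_inv x) \<eta> = w (E_inv y) \<eta>" for \<eta>
      using qE[of "E_inv x" \<eta>] qE[of "E_inv y" \<eta>] by (simp add: E_E_inv)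
    then have "w (E_inv x - E_inv y) \<eta> = 0" for \<eta> using linear_diff[OF linear_w_left[of \<eta>]] by simp
    then have "E_inv x - E_inv y = 0" by (rule w_nondegenerate)
    then show "x = y" using xy(1,2) E_E_inv by (metis eq_iff_diff_eq_0)
  qed
  from the_inv_into_f_f[OF this E_in] show ?thesis
    by (simp add: r_tensor_def r_map_def \<alpha>)
qed

text \<open>Pulled back by left translation, the covector of component \<open>i\<close> corresponds
  under \<open>r\<close> to \<open>Ad q (axis i 1)\<close>, and a single pairing remains. Pulled
  back by right translation it is \<open>\<eta> \<mapsto> w (Ad q (axis i 1)) (Ad q \<eta>)\<close>;
  its image under \<open>r\<close> is expanded in the vectors \<open>dual k\<close>, which produces
  the sum of products.\<close>

lemma moment_bracket:
  assumes J: "moment_on U J" and q: "q \<in> U"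
  shows "poisson_bracket G (poisson_lie_tensor G \<Omega>) (\<lambda>u. J u $ i) (\<lambda>u. J u $ j) q =
    w (Ad q (axis j 1)) (Ad q (axis i 1)) -
    (\<Sum>k\<in>UNIV. w (Ad q (axis i 1)) (Ad q (axis k 1)) * w (Ad q (axis j 1)) (Ad q (dual k)))"
proof -
  let ?e = "\<lambda>i. axis i 1 :: real ^ 'n"
  have qG: "q \<in> carrier G" using J q by (auto simp: moment_on_def)
  let ?\<alpha> = "\<lambda>i. differential_at (atlas G) q (\<lambda>u. J u $ i)"
  have \<alpha>: "?\<alpha> i v = \<Omega> q (Y (?e i) q) v" if "v \<in> tangent_at G q" for i v
    using that by (simp add: differential_at_def moment_on_derivation[OF J q])
  let ?L = "\<lambda>i. pull_to_unit G (ltrans G q) (?\<alpha> i)" and ?R = "\<lambda>i. pull_to_unit G (rtrans G q) (?\<alpha> i)"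
  have L: "?L i (E \<eta>) = w (Ad q (?e i)) \<eta>" for i \<eta>
    using \<alpha>[OF X_tangent[OF qG], of i \<eta>] form_Y_X[OF qG]
    by (simp add: pull_to_unit_def E_in X_def left_inv_field_def)
  have R: "?R i (E \<eta>) = w (Ad q (?e i)) (Ad q \<eta>)" for i \<eta>
    using \<alpha>[OF Y_tangent[OF qG], of i \<eta>] form_Y_X[OF qG, of "?e i" "Ad q \<eta>"]
    by (simp add: X_Ad[OF qG]) (simp add: pull_to_unit_def E_in Y_def right_inv_field_def)
  have ext: "pull_to_unit G F \<beta> \<in> extensional (lie_algebra G)" for F \<beta>
    by (simp only: pull_to_unit_def restrict_extensional)
  have "r_plus G \<Omega> q (?\<alpha> i) (?\<alpha> j) = w (Ad q (?e j)) (Ad q (?e i))"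
    unfolding r_plus_def r_tensor_eq[OF L ext] by (rule L)
  moreover have "r_minus G \<Omega> q (?\<alpha> i) (?\<alpha> j) =
      (\<Sum>k\<in>UNIV. w (Ad q (?e i)) (Ad q (?e k)) * w (Ad q (?e j)) (Ad q (dual k)))"
  proof -
    define \<kappa> where "\<kappa> = (\<Sum>k\<in>UNIV. w (Ad q (?e i)) (Ad q (?e k)) *\<^sub>R dual k)"
    have lin: "linear (\<lambda>\<eta>. w (Ad q z) (Ad q \<eta>))" for z
      using linear_compose[OF linear_Ad[OF qG] linear_w] by (simp add: o_def)
    have "w \<kappa> \<eta> = (\<Sum>k\<in>UNIV. w (Ad q (?e i)) (Ad q (?e k)) * \<eta> $ k)" for \<eta>
      using linear_sum[OF linear_w_left[of \<eta>], of "\<lambda>k. w (Ad q (?e i)) (Ad q (?e k)) *\<^sub>R dual k" UNIV]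
        linear_scale[OF linear_w_left[of \<eta>]] by (simp add: \<kappa>_def w_dual)
    then have \<kappa>: "?R i (E \<eta>) = w \<kappa> \<eta>" for \<eta>
      using linear_axis_expansion[OF lin, of "?e i" \<eta>] by (simp add: R mult.commute)
    have "r_minus G \<Omega> q (?\<alpha> i) (?\<alpha> j) = ?R j (E \<kappa>)"
      unfolding r_minus_def by (rule r_tensor_eq[OF \<kappa> ext])
    also have "\<dots> = (\<Sum>k\<in>UNIV. w (Ad q (?e i)) (Ad q (?e k)) * w (Ad q (?e j)) (Ad q (dual k)))"
      using linear_sum[OF lin[of "?e j"], of "\<lambda>k. w (Ad q (?e i)) (Ad q (?e k)) *\<^sub>R dual k" UNIV]
        linear_scale[OF lin[of "?e j"]] by (simp add: R \<kappa>_def)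
    finally show ?thesis .
  qed
  ultimately show ?thesis by (simp add: poisson_bracket_def poisson_lie_tensor_def)
qed

text \<open>The constant terms cancel because \<open>dual\<close> is dual to the standard basis; this is the vanishing of
  the Poisson Lie tensor at the unit.\<close>

lemma moment_bracket_polynomial:
  assumes J: "moment_on U J" and norm: "\<And>q z y. q \<in> U \<Longrightarrow> w (Ad q z) (Ad q y) = w z y + J q \<bullet> Br z y"
  shows "\<exists>(b :: 'n \<Rightarrow> real) (B :: 'n \<Rightarrow> 'n \<Rightarrow> real). \<forall>q\<in>U.
     poisson_bracket G (poisson_lie_tensor G \<Omega>) (\<lambda>u. J u $ i) (\<lambda>u. J u $ j) q =
       (\<Sum>s\<in>UNIV. b s * J q $ s) + (\<Sum>l\<in>UNIV. \<Sum>k\<in>UNIV. B l k * J q $ l * J q $ k)"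
proof (intro exI ballI)
  let ?e = "\<lambda>i. axis i 1 :: real ^ 'n"
  let ?a = "\<lambda>k. Br (?e i) (?e k)" and ?c = "\<lambda>k. Br (?e j) (dual k)"
  \<comment> \<open>The linear terms: one from the left invariant part and, from each product in the
    right invariant part, the two in which one factor contributes only its constant.\<close>
  let ?b = "Br (?e j) (?e i) - (\<Sum>k\<in>UNIV. w (?e i) (?e k) *\<^sub>R ?c k + w (?e j) (dual k) *\<^sub>R ?a k)"
  fix q assume q: "q \<in> U"
  let ?x = "J q"
  \<comment> \<open>The constants of the second factors are minus the components of
    \<open>?e j\<close>, so the sum of products of constants picks out the single term
    \<open>- w (?e i) (?e j)\<close>, equal to the constant of the left invariant part.\<close>
  have "w (?e j) (dual k) = - (?e j $ k)" for k using w_skew[of "?e j" "dual k"] w_dual by simp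
  then have const: "(\<Sum>k\<in>UNIV. w (?e i) (?e k) * w (?e j) (dual k)) = w (?e j) (?e i)"
    using w_skew[of "?e j" "?e i"]
    by (simp add: axis_def if_distrib[of "\<lambda>x. _ * x"] sum_negf cong: if_cong)
  have quad: "(\<Sum>k\<in>UNIV. (?x \<bullet> ?a k) * (?x \<bullet> ?c k)) =
      (\<Sum>l\<in>UNIV. \<Sum>m\<in>UNIV. (\<Sum>k\<in>UNIV. ?a k $ l * ?c k $ m) * ?x $ l * ?x $ m)"
  proof -
    have "(\<Sum>k\<in>UNIV. (?x \<bullet> ?a k) * (?x \<bullet> ?c k)) =
      (\<Sum>k\<in>UNIV. \<Sum>l\<in>UNIV. \<Sum>m\<in>UNIV. ?a k $ l * ?c k $ m * ?x $ l * ?x $ m)"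
      by (simp add: inner_vec_def sum_product mult_ac)
    also have "\<dots> = (\<Sum>l\<in>UNIV. \<Sum>m\<in>UNIV. \<Sum>k\<in>UNIV. ?a k $ l * ?c k $ m * ?x $ l * ?x $ m)"
      by (subst sum.swap) (rule sum.cong[OF refl], rule sum.swap)
    finally show ?thesis by (simp add: sum_distrib_right)
  qed
  have "poisson_bracket G (poisson_lie_tensor G \<Omega>) (\<lambda>u. J u $ i) (\<lambda>u. J u $ j) q =
    (w (?e j) (?e i) + ?x \<bullet> Br (?e j) (?e i)) -
    (\<Sum>k\<in>UNIV. (w (?e i) (?e k) + ?x \<bullet> ?a k) * (w (?e j) (dual k) + ?x \<bullet> ?c k))"
    unfolding moment_bracket[OF J q] norm[OF q] ..
  also have "\<dots> = ?x \<bullet> ?b - (\<Sum>k\<in>UNIV. (?x \<bullet> ?a k) * (?x \<bullet> ?c k))"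
    using const
    by (simp add: inner_diff_right inner_sum_right inner_add_right distrib_left distrib_right sum.distrib mult.commute)
  also have "\<dots> = (\<Sum>s\<in>UNIV. ?b $ s * ?x $ s) + (\<Sum>l\<in>UNIV. \<Sum>m\<in>UNIV. (- (\<Sum>k\<in>UNIV. ?a k $ l * ?c k $ m)) * ?x $ l * ?x $ m)"
    unfolding quad by (simp add: inner_vec_def[of _ ?b] mult.commute[of "?x $ _"] sum_negf)
  finally show "poisson_bracket G (poisson_lie_tensor G \<Omega>) (\<lambda>u. J u $ i) (\<lambda>u. J u $ j) q =
     (\<Sum>s\<in>UNIV. ?b $ s * ?x $ s) + (\<Sum>l\<in>UNIV. \<Sum>m\<in>UNIV. (- (\<Sum>k\<in>UNIV. ?a k $ l * ?c k $ m)) * ?x $ l * ?x $ m)" .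
qed

end

theorem theorem4p0p1:
  fixes G :: "('g::{t2_space, second_countable_topology}, 'n::finite) lie_struct"
    and \<Omega> :: "'g form2"
    and D :: "'g connection"
    and n :: nat
  assumes dim: "CARD('n) = 2 * n"
    and sympl: "symplectic_lie_group G \<Omega>"
    and conn: "connected (carrier G)"
    and aff: "symplectic_affine_structure G \<Omega> D"
  shows "\<forall>p\<in>carrier G. \<exists>U x. p \<in> U \<and> affine_chart (atlas G) D (U, x) \<and>
    (\<forall>i j. \<exists>(b :: 'n \<Rightarrow> real) (B :: 'n \<Rightarrow> 'n \<Rightarrow> real). \<forall>q\<in>U.
       poisson_bracket G (poisson_lie_tensor G \<Omega>) (\<lambda>u. x u $ i) (\<lambda>u. x u $ j) q =
         (\<Sum>s\<in>UNIV. b s * x q $ s) + (\<Sum>l\<in>UNIV. \<Sum>k\<in>UNIV. B l k * x q $ l * x q $ k))"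
proof
  interpret symplectic_group G \<Omega> by unfold_locales (rule sympl)
  fix p assume p: "p \<in> carrier G"
  obtain d r J where d: "d \<in> atlas G" "ball (snd d p) r \<subseteq> snd d ` fst d" "p \<in> chart_inv d ` ball (snd d p) r"
    and J: "moment_on (chart_inv d ` ball (snd d p) r) J"
    and norm: "\<And>q z y. q \<in> chart_inv d ` ball (snd d p) r \<Longrightarrow> w (Ad q z) (Ad q y) = w z y + J q \<bullet> Br z y"
    by (rule moment_normalized[OF conn p]) (rule that)
  \<comment> \<open>The inverse function theorem may shrink the domain; the momentum property and
    the normalisation both restrict to \<open>U\<close>.\<close>
  obtain U where U: "p \<in> U" "U \<subseteq> chart_inv d ` ball (snd d p) r" "open U" "(U, J) \<in> maximal_atlas (atlas G)"
    using moment_chart[OF d(1,2) J d(3)] .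
  have JU: "moment_on U J" by (rule moment_on_subset[OF J U(3,2)])
  have "affine_chart (atlas G) D (U, J)"
    using U(4) moment_affine[OF aff JU] by (simp add: affine_chart_def)
  moreover have "\<exists>(b :: 'n \<Rightarrow> real) (B :: 'n \<Rightarrow> 'n \<Rightarrow> real). \<forall>q\<in>U.
     poisson_bracket G (poisson_lie_tensor G \<Omega>) (\<lambda>u. J u $ i) (\<lambda>u. J u $ j) q =
       (\<Sum>s\<in>UNIV. b s * J q $ s) + (\<Sum>l\<in>UNIV. \<Sum>k\<in>UNIV. B l k * J q $ l * J q $ k)" for i j
    using U(2) norm by (intro moment_bracket_polynomial[OF JU]) blast
  ultimately show "\<exists>U x. p \<in> U \<and> affine_chart (atlas G) D (U, x) \<and>
    (\<forall>i j. \<exists>(b :: 'n \<Rightarrow> real) (B :: 'n \<Rightarrow> 'n \<Rightarrow> real). \<forall>q\<in>U.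
       poisson_bracket G (poisson_lie_tensor G \<Omega>) (\<lambda>u. x u $ i) (\<lambda>u. x u $ j) q =
         (\<Sum>s\<in>UNIV. b s * x q $ s) + (\<Sum>l\<in>UNIV. \<Sum>k\<in>UNIV. B l k * x q $ l * x q $ k))"
    using U(1) by blast
qed

end
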